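(* Let $\mathsf{R}$ (resp. $\mathsf{R}'$) be the set of 2-colored partitions satisfying conditions (D1)–(D3) (resp. (D1)–(D4)) listed in the context. Then, as formal power series in $q$, $$\sum_{\lambda\in\mathsf{R}}q^{|\lambda|}=\frac{(q^2,q^4;q^6)_\infty}{(q,q,q^3,q^3,q^5,q^5;q^6)_\infty},\qquad \sum_{\lambda\in\mathsf{R}'}q^{|\lambda|}=\frac{1}{(q^2,q^3,q^3,q^4;q^6)_\infty}.$$
   Context: $q$-Pochhammer symbols: $(a;q)_n=\prod_{0\le j<n}(1-aq^j)$ for $n\in\mathbb{Z}_{\ge0}\sqcup\{\infty\}$, and $(a_1,\dots,a_k;q)_n=(a_1;q)_n\cdots(a_k;q)_n$. For each positive integer $k$ there is an ordinary copy $k$ and a "colored" copy $\underline{k}_c$. Put $\mathsf{cont}(k)=\mathsf{cont}(\underline{k}_c)=k$, $\mathsf{color}(k)=+$, $\mathsf{color}(\underline{k}_c)=-$. Order them by $\cdots>3>\underline{3}_c>2>\underline{2}_c>1>\underline{1}_c$. A 2-colored partition is a finite (possibly empty) weakly decreasing sequence $\lambda=(\lambda_1,\dots,\lambda_\ell)$ of positive integers and colored positive integers (its parts) for this order; its size is $|\lambda|=\mathsf{cont}(\lambda_1)+\dots+\mathsf{cont}(\lambda_\ell)$. We say $\lambda$ contains $\mu=(\mu_1,\dots,\mu_{\ell'})$ if there is $0\le i\le \ell-\ell'$ with $\lambda_{j+i}=\mu_j$ for $1\le j\le\ell'$. Conditions on $\lambda$: (D1) If consecutive parts $\lambda_a,\lambda_{a+1}$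 ($1\le a<\ell$) satisfy $\mathsf{cont}(\lambda_a)-\mathsf{cont}(\lambda_{a+1})\le 1$, then $\mathsf{cont}(\lambda_a)+\mathsf{cont}(\lambda_{a+1})\in3\mathbb{Z}$ and $\mathsf{color}(\lambda_a)\neq\mathsf{color}(\lambda_{a+1})$. (D2) If consecutive parts $\lambda_a,\lambda_{a+1}$ ($1\le a<\ell$) satisfy $\mathsf{cont}(\lambda_a)-\mathsf{cont}(\lambda_{a+1})=2$ and $\mathsf{cont}(\lambda_a)+\mathsf{cont}(\lambda_{a+1})\notin3\mathbb{Z}$, then $(\mathsf{color}(\lambda_a),\mathsf{color}(\lambda_{a+1}))\neq(-,+)$. (D3) $\lambda$ does not contain $(3k,\underline{3k}_c,\underline{3k-2}_c)$, $(3k+2,3k,\underline{3k}_c)$, or $(\underline{3k+2}_c,3k+1,3k-1,\underline{3k-2}_c)$ for any $k\ge1$. (D4) $\lambda$ does not contain $1$, $\underline{1}_c$, or $\underline{2}_c$ as a part. *)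

theory Defs
  imports
    "HOL-Analysis.Analysis"
    "HOL-Library.Sublist"
    "HOL-Library.Extended_Nat"
    "HOL-Computational_Algebra.Formal_Power_Series"
begin

text \<open>
  The infinite case is the library's infinite product. It is applied below to formal power
  series, whose topology is that of coefficientwise stabilisation.
\<close>

definition qpoch :: "'a::{t2_space, comm_ring_1} \<Rightarrow> 'a \<Rightarrow> enat \<Rightarrow> 'a" where
  "qpoch a q n = (case n of enat m \<Rightarrow> (\<Prod>j<m. 1 - a * q ^ j) | \<infinity> \<Rightarrow> (\<Prod>j. 1 - a * q ^ j))"

definition qpochs :: "'a::{t2_space, comm_ring_1} list \<Rightarrow> 'a \<Rightarrow> enat \<Rightarrow> 'a" where
  "qpochs as q n = (\<Prod>a\<leftarrow>as. qpoch a q n)"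

datatype colour = PlusC | MinusC

text \<open>
  \<open>Ord k\<close> is the ordinary integer $k$ and \<open>Col k\<close> its colored copy. Positivity of $k$ is not
  part of the type; it is required in \<open>partition2\<close>.
\<close>

datatype part = Ord nat | Col nat

fun cont :: "part \<Rightarrow> nat" where
  "cont (Ord k) = k"
| "cont (Col k) = k"

fun color :: "part \<Rightarrow> colour" where
  "color (Ord k) = PlusC"
| "color (Col k) = MinusC"

text \<open>The order is $\cdots > 2 > \underline{2}_c > 1 > \underline{1}_c$.\<close>

instantiation part :: linorder
begin

definition less_part :: "part \<Rightarrow> part \<Rightarrow> bool" where
  "x < y \<longleftrightarrow> cont x < cont y \<or> (cont x = cont y \<and> color x = MinusC \<and> color y = PlusC)"

definition less_eq_part :: "part \<Rightarrow> part \<Rightarrow> bool" where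
  "x \<le> y \<longleftrightarrow> x < y \<or> x = (y::part)"

instance
proof
  fix x y z :: part
  show "(x < y) = (x \<le> y \<and> \<not> y \<le> x)"
    by (cases x; cases y) (auto simp: less_part_def less_eq_part_def)
  show "x \<le> x"
    by (simp add: less_eq_part_def)
  show "x \<le> y \<Longrightarrow> y \<le> z \<Longrightarrow> x \<le> z"
    by (cases x; cases y; cases z) (auto simp: less_part_def less_eq_part_def)
  show "x \<le> y \<Longrightarrow> y \<le> x \<Longrightarrow> x = y"
    by (cases x; cases y) (auto simp: less_part_def less_eq_part_def)
  show "x \<le> y \<or> y \<le> x"
    by (cases x; cases y) (auto simp: less_part_def less_eq_part_def)
qed

end

definition partition2 :: "part list \<Rightarrow> bool" where
  "partition2 l \<longleftrightarrow> sorted_wrt (\<ge>) l \<and> (\<forall>x\<in>set l. cont x \<ge> 1)"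

definition psize :: "part list \<Rightarrow> nat" where
  "psize l = (\<Sum>x\<leftarrow>l. cont x)"

definition D1 :: "part list \<Rightarrow> bool" where
  "D1 l \<longleftrightarrow> (\<forall>a. Suc a < length l \<longrightarrow>
     int (cont (l ! a)) - int (cont (l ! Suc a)) \<le> 1 \<longrightarrow>
       3 dvd cont (l ! a) + cont (l ! Suc a) \<and> color (l ! a) \<noteq> color (l ! Suc a))"

definition D2 :: "part list \<Rightarrow> bool" where
  "D2 l \<longleftrightarrow> (\<forall>a. Suc a < length l \<longrightarrow>
     int (cont (l ! a)) - int (cont (l ! Suc a)) = 2 \<and> \<not> 3 dvd cont (l ! a) + cont (l ! Suc a) \<longrightarrow>
       (color (l ! a), color (l ! Suc a)) \<noteq> (MinusC, PlusC))"

text \<open>Containment is as a contiguous block, i.e. \<open>sublist\<close>, not \<open>subseq\<close>.\<close>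

definition D3 :: "part list \<Rightarrow> bool" where
  "D3 l \<longleftrightarrow> (\<forall>k\<ge>1.
     \<not> sublist [Ord (3*k), Col (3*k), Col (3*k - 2)] l \<and>
     \<not> sublist [Ord (3*k + 2), Ord (3*k), Col (3*k)] l \<and>
     \<not> sublist [Col (3*k + 2), Ord (3*k + 1), Ord (3*k - 1), Col (3*k - 2)] l)"

definition D4 :: "part list \<Rightarrow> bool" where
  "D4 l \<longleftrightarrow> Ord 1 \<notin> set l \<and> Col 1 \<notin> set l \<and> Col 2 \<notin> set l"

definition R :: "part list set" where
  "R = {l. partition2 l \<and> D1 l \<and> D2 l \<and> D3 l}"

definition R' :: "part list set" where
  "R' = {l. partition2 l \<and> D1 l \<and> D2 l \<and> D3 l \<and> D4 l}"

abbreviation q :: "rat fps" where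
  "q \<equiv> fps_X"

end

theory Submission
  imports Defs
begin

text \<open>
  Both products are generating functions of cylindric partitions of rank and level 3, multiplied by
  $(q;q)_\infty$: for the profile $(1,1,1)$ in the case of \<open>R\<close>, for $(3,0,0)$ in the case of \<open>R'\<close>.
  The product formulas come from repeatedly toggling local maxima in cyclic sequences of
  interlacing partitions, which multiplies the generating function by a factor $1 - q^k$ and
  changes the weights until only constant sequences contribute. Splitting off the largest parts
  (the Corteel-Welsh recursion, an inclusion-exclusion over the local maxima) shows that the same
  two series are the initial values of the unique solution of a $2 \times 2$ system in
  $z = q^{3i}$.

  The set \<open>R\<close>, cut into blocks $\{3k+1,3k+2,3k+3\}$, leads to a different system, of
  order 3. The link is a function $S(x,y)$ of two variables: the diagonal
  $S(z,z)$ solves the cylindric system, and $S(z,z^2)$ counts the members of \<open>R\<close> with all parts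
  exceeding $3k$, where $z = q^{3k}$. The two curves meet at $(1,1)$, which gives the theorem.
\<close>

text \<open>The obstacle is that the two recursions move differently. Adding a block sends $(x,y)$
  to $(xq^3,yq^6)$, which preserves $y = x^2$ but not $y = x$, where the cylindric system lives. The
  hinge is the identity $S(x,y) = S(x,yq^3) + yq^3 S(xq^3,yq^6)$ with its companion for $K$
  (\<open>SS_shift\<close>, \<open>KK_shift\<close>). It trades a block shift for a shift of $y$
  alone, so that the system can be rewritten around the point $(xq^3,yq^3)$. On the diagonal it then
  closes on $S(z,z)$ and $K(z,z) + zq^2 S(zq^3,zq^6)$. At $z = 1$ the second series counts
  \<open>R'\<close>, because (D4) acts on the first block as if the list stood on an ordinary part
  0.

  Only values at powers of $q$ occur, never formal variables $x$, $y$, $z$. Solutions of one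
  recursion that tend to 1 as the index grows are identified by showing that their difference is
  divisible by every power of $q$.\<close>

unbundle no vec_syntax
unbundle fps_syntax

section \<open>Congruences of power series\<close>

lemma X_power_dvd_iff: "q ^ n dvd f \<longleftrightarrow> (\<forall>i<n. f $ i = 0)"
proof
  assume "\<forall>i<n. f $ i = 0"
  then have "f = q ^ n * fps_shift n f"
    by (intro fps_ext) (auto simp: fps_X_power_mult_nth)
  then show "q ^ n dvd f" by (metis dvd_triv_left)
qed (auto simp: fps_X_power_mult_nth elim!: dvdE)

text \<open>Takes the place of topology: convergence and uniqueness below are congruences modulo all
  powers of \<open>q\<close>. Only \<open>qpoch_eprod\<close> and \<open>gf_has_sum\<close> make
  contact with the topology used in the statement.\<close>

lemma fps_eqI_dvd:
  assumes "\<And>n. q ^ n dvd f - g"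
  shows "f = g"
proof (rule fps_ext)
  fix n show "f $ n = g $ n" using assms[of "Suc n"] unfolding X_power_dvd_iff by simp
qed

lemma dvd_diff_trans:
  fixes a b c d :: "'a::comm_ring_1"
  assumes "d dvd a - b" "d dvd b - c" shows "d dvd a - c"
  using dvd_add[OF assms] by simp

text \<open>Coefficient \<open>n\<close> is read off term \<open>n + 1\<close> because, in the
  sequences used here, term \<open>n\<close> is correct only modulo \<open>q ^ n\<close>.\<close>

definition flim :: "(nat \<Rightarrow> rat fps) \<Rightarrow> rat fps" where
  "flim f = Abs_fps (\<lambda>n. f (Suc n) $ n)"

lemma flim_cong:
  assumes "\<And>n. q ^ n dvd f (Suc n) - f n"
  shows "q ^ n dvd flim f - f n"
proof -
  have step: "f (m + k) $ i = f m $ i" if "i < m" for m k i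
    using that
  proof (induction k)
    case (Suc k)
    then show ?case using assms[of "m + k"] unfolding X_power_dvd_iff by simp
  qed simp
  have "f n $ i = f (Suc i) $ i" if "i < n" for i
    using step[of i "Suc i" "n - Suc i"] that by simp
  then show ?thesis by (simp add: X_power_dvd_iff flim_def)
qed

section \<open>Infinite products (q^a; q^d) as limits of congruences\<close>

definition eprod :: "nat \<Rightarrow> nat \<Rightarrow> rat fps" where
  "eprod a d = flim (\<lambda>n. \<Prod>j<n. 1 - q ^ (a + d * j))"

lemma prod_cong_step: "d \<ge> 1 \<Longrightarrow> q ^ (a + n) dvd (\<Prod>j<Suc n. 1 - q ^ (a + d * j)) - (\<Prod>j<n. 1 - q ^ (a + d * j))"
proof -
  assume "d \<ge> 1"
  then have "q ^ (a + n) dvd q ^ (a + d * n)" by (intro le_imp_power_dvd) simp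
  moreover have "(\<Prod>j<Suc n. 1 - q ^ (a + d * j)) - (\<Prod>j<n. 1 - q ^ (a + d * j)) = - (q ^ (a + d * n) * (\<Prod>j<n. 1 - q ^ (a + d * j)))"
    by (simp add: algebra_simps)
  ultimately show ?thesis by simp
qed

lemma eprod_cong:
  assumes "d \<ge> 1"
  shows "q ^ n dvd eprod a d - (\<Prod>j<n. 1 - q ^ (a + d * j))"
  unfolding eprod_def
proof (rule flim_cong)
  fix n show "q ^ n dvd (\<Prod>j<Suc n. 1 - q ^ (a + d * j)) - (\<Prod>j<n. 1 - q ^ (a + d * j))"
    using prod_cong_step[OF assms, of a n] by (metis power_add dvd_mult_right)
qed

lemma eprod_rec:
  assumes "d \<ge> 1"
  shows "eprod a d = (1 - q ^ a) * eprod (a + d) d"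
proof (rule fps_eqI_dvd)
  fix n
  let ?P = "\<lambda>a n. \<Prod>j<n. 1 - q ^ (a + d * j)"
  have "?P a (Suc n) = (1 - q ^ a) * ?P (a + d) n"
    unfolding prod.lessThan_Suc_shift by (simp add: algebra_simps)
  moreover have "q ^ n dvd eprod a d - ?P a (Suc n)"
    using eprod_cong[OF assms, of "Suc n" a] by (metis power_Suc dvd_mult_right)
  moreover have "q ^ n dvd (1 - q ^ a) * ?P (a + d) n - (1 - q ^ a) * eprod (a + d) d"
    using dvd_mult[OF eprod_cong[OF assms, of n "a + d"], of "- (1 - q ^ a)"] by (simp add: algebra_simps)
  ultimately show "q ^ n dvd eprod a d - (1 - q ^ a) * eprod (a + d) d"
    by (metis dvd_diff_trans)
qed

lemma eprod_cong_1:
  assumes "d \<ge> 1"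
  shows "q ^ a dvd eprod a d - 1"
proof -
  have "q ^ a dvd (\<Prod>j<n. 1 - q ^ (a + d * j)) - 1" for n
  proof (induction n)
    case (Suc n)
    have "q ^ a dvd (\<Prod>j<Suc n. 1 - q ^ (a + d * j)) - (\<Prod>j<n. 1 - q ^ (a + d * j))"
      using prod_cong_step[OF assms, of a n] by (metis power_add dvd_mult_left)
    then show ?case using Suc dvd_diff_trans by blast
  qed simp
  then show ?thesis using eprod_cong[OF assms, of a a] dvd_diff_trans by blast
qed

lemma eprod_nz: "d \<ge> 1 \<Longrightarrow> a \<ge> 1 \<Longrightarrow> eprod a d $ 0 = 1"
  using eprod_cong_1[of d a] by (auto simp: X_power_dvd_iff)

lemma eprod_nonzero: "d \<ge> 1 \<Longrightarrow> a \<ge> 1 \<Longrightarrow> eprod a d \<noteq> 0"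
  using eprod_nz[of d a] by auto

lemma qpoch_eprod:
  assumes "d \<ge> 1" "a \<ge> 1"
  shows "qpoch (q ^ a) (q ^ d) \<infinity> = eprod a d"
proof -
  have eq: "q ^ a * (q ^ d) ^ j = q ^ (a + d * j)" for j
    by (simp only: power_add power_mult)
  have lim: "(\<lambda>n. \<Prod>i\<le>n. 1 - q ^ (a + d * i)) \<longlonglongrightarrow> eprod a d"
  proof (rule tendsto_fpsI)
    fix n
    show "\<forall>\<^sub>F m in sequentially. (\<Prod>i\<le>m. 1 - q ^ (a + d * i)) $ n = eprod a d $ n"
      using eventually_ge_at_top[of n]
    proof eventually_elim
      case (elim m)
      have "\<forall>i<Suc m. (eprod a d - (\<Prod>j<Suc m. 1 - q ^ (a + d * j))) $ i = 0"
        using eprod_cong[OF assms(1), of "Suc m" a] by (simp only: X_power_dvd_iff)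
      with elim have "(eprod a d - (\<Prod>j\<le>m. 1 - q ^ (a + d * j))) $ n = 0"
        by (simp only: lessThan_Suc_atMost less_Suc_eq_le)
      then show ?case by (simp only: fps_sub_nth right_minus_eq)
    qed
  qed
  \<comment> \<open>A convergent infinite product must have a nonzero limit; this one has constant
    coefficient 1 because \<open>a \<ge> 1\<close>.\<close>
  have "raw_has_prod (\<lambda>j. 1 - q ^ a * (q ^ d) ^ j) 0 (eprod a d)"
    unfolding raw_has_prod_def eq add_0_right using lim eprod_nonzero[OF assms] by blast
  then have "(\<lambda>j. 1 - q ^ a * (q ^ d) ^ j) has_prod eprod a d" unfolding has_prod_def by blast
  then show ?thesis unfolding qpoch_def by (simp add: has_prod_unique[symmetric])
qed

section \<open>Generating functions of graded sets\<close>

text \<open>Weights are integers because toggling produces negative coefficients. Nonnegativity and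
  finiteness can then no longer be read off the weight and are transported along bijections
  instead.\<close>

definition graded :: "('a \<Rightarrow> int) \<Rightarrow> 'a set \<Rightarrow> bool" where
  "graded w S \<longleftrightarrow> (\<forall>s\<in>S. 0 \<le> w s) \<and> (\<forall>n. finite {s \<in> S. w s = n})"

definition gf :: "('a \<Rightarrow> int) \<Rightarrow> 'a set \<Rightarrow> rat fps" where
  "gf w S = Abs_fps (\<lambda>n. of_nat (card {s \<in> S. w s = int n}))"

lemma gf_nth: "gf w S $ n = of_nat (card {s \<in> S. w s = int n})"
  by (simp add: gf_def)

lemma graded_subset: "graded w S \<Longrightarrow> T \<subseteq> S \<Longrightarrow> graded w T"
  unfolding graded_def by (auto intro: rev_finite_subset)

lemma graded_bij:
  assumes "bij_betw f S T" "\<And>s. s \<in> S \<Longrightarrow> w' (f s) = w s"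
  shows "graded w S \<longleftrightarrow> graded w' T"
proof -
  have T: "T = f ` S" and inj: "inj_on f S" using assms(1) by (auto simp: bij_betw_def)
  have "{t \<in> T. w' t = n} = f ` {s \<in> S. w s = n}" for n using assms(2) T by auto
  moreover have "finite (f ` {s \<in> S. w s = n}) = finite {s \<in> S. w s = n}" for n
    by (rule finite_image_iff) (rule inj_on_subset[OF inj], auto)
  ultimately show ?thesis unfolding graded_def using assms(2) T by auto
qed

lemma gf_bij:
  assumes "bij_betw f S T" "\<And>s. s \<in> S \<Longrightarrow> w' (f s) = w s"
  shows "gf w S = gf w' T"
proof (rule fps_ext)
  fix n
  have "{t \<in> T. w' t = n} = f ` {s \<in> S. w s = n}" for n using assms by (auto simp: bij_betw_def)
  moreover have "inj_on f {s \<in> S. w s = n}" for n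
    using assms(1) by (auto simp: bij_betw_def intro: inj_on_subset)
  ultimately show "gf w S $ n = gf w' T $ n" by (simp add: gf_nth card_image)
qed

lemma gf_Un:
  assumes "graded w S" "graded w T"
  shows "gf w (S \<union> T) = gf w S + gf w T - gf w (S \<inter> T)"
proof (rule fps_ext)
  fix n
  let ?A = "{s \<in> S. w s = int n}" and ?B = "{s \<in> T. w s = int n}"
  have "finite ?A" "finite ?B" using assms by (auto simp: graded_def)
  then have "card ?A + card ?B = card (?A \<union> ?B) + card (?A \<inter> ?B)" by (rule card_Un_Int)
  then have "of_nat (card ?A) + of_nat (card ?B) = (of_nat (card (?A \<union> ?B)) + of_nat (card (?A \<inter> ?B)) :: rat)"
    by (simp only: of_nat_add[symmetric])
  moreover have "{s \<in> S \<union> T. w s = int n} = ?A \<union> ?B" "{s \<in> S \<inter> T. w s = int n} = ?A \<inter> ?B" by auto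
  ultimately show "gf w (S \<union> T) $ n = (gf w S + gf w T - gf w (S \<inter> T)) $ n"
    by (simp add: gf_nth)
qed

lemma gf_empty [simp]: "gf w {} = 0"
  by (simp add: gf_def fps_eq_iff)

lemma gf_Un_disjoint:
  "graded w S \<Longrightarrow> graded w T \<Longrightarrow> S \<inter> T = {} \<Longrightarrow> gf w (S \<union> T) = gf w S + gf w T"
  by (simp add: gf_Un)

lemma gf_shift:
  assumes "graded w S"
  shows "gf (\<lambda>s. w s + int k) S = q ^ k * gf w S"
proof (rule fps_ext)
  fix n
  have "0 \<le> w s" if "s \<in> S" for s using assms that by (simp add: graded_def)
  then have "{s \<in> S. w s + int k = int n} = (if n < k then {} else {s \<in> S. w s = int (n - k)})"
    by (cases "n < k") (force, simp add: of_nat_diff eq_diff_eq)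
  then show "gf (\<lambda>s. w s + int k) S $ n = (q ^ k * gf w S) $ n"
    by (auto simp: gf_nth fps_X_power_mult_nth)
qed

lemma graded_Un: "graded w S \<Longrightarrow> graded w T \<Longrightarrow> graded w (S \<union> T)"
proof -
  assume *: "graded w S" "graded w T"
  have "{s \<in> S \<union> T. w s = n} = {s \<in> S. w s = n} \<union> {s \<in> T. w s = n}" for n by auto
  with * show ?thesis unfolding graded_def by auto
qed

lemma gf_cong_1:
  assumes "z \<in> S" "w z = 0" "\<And>s. s \<in> S \<Longrightarrow> s \<noteq> z \<Longrightarrow> w s \<ge> int n"
  shows "q ^ n dvd gf w S - 1"
proof -
  have "{s \<in> S. w s = int i} = (if i = 0 then {z} else {})" if "i < n" for i
  proof -
    have "w s \<noteq> int i" if "s \<in> S" "s \<noteq> z" for s using assms(3)[OF that] \<open>i < n\<close> by simp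
    then have "s = z" if "s \<in> S" "w s = int i" for s using that by blast
    then have "{s \<in> S. w s = int i} \<subseteq> {z}" by blast
    moreover have "z \<in> {s \<in> S. w s = int i} \<longleftrightarrow> i = 0" using assms(1,2) by simp
    ultimately show ?thesis by (metis subset_singletonD singletonI empty_iff)
  qed
  then show ?thesis by (auto simp: X_power_dvd_iff gf_nth)
qed

lemma gf_has_sum:
  assumes "graded (\<lambda>s. int (w s)) S"
  shows "((\<lambda>s. q ^ w s) has_sum gf (\<lambda>s. int (w s)) S) S"
proof (rule has_sum_fpsI)
  fix n
  have eq: "{s \<in> S. (q ^ w s) $ n \<noteq> 0} = {s \<in> S. int (w s) = int n}" by auto
  show "finite {s \<in> S. (q ^ w s) $ n \<noteq> 0}" using assms unfolding eq graded_def by blast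
  show "gf (\<lambda>s. int (w s)) S $ n = (\<Sum>s | s \<in> S \<and> (q ^ w s) $ n \<noteq> 0. (q ^ w s) $ n)"
    unfolding eq by (simp add: gf_nth)
qed

section \<open>Cyclically interlacing partitions\<close>

text \<open>
  A partition is an antitone function with finite support. A word \<open>w\<close> prescribes for each edge of
  a cycle whether the partition grows (\<open>True\<close>) or shrinks (\<open>False\<close>) along it; antitonicity is a
  consequence of the interlacing conditions.
\<close>

definition psum :: "(nat \<Rightarrow> nat) \<Rightarrow> nat" where
  "psum f = (\<Sum>k | f k \<noteq> 0. f k)"

definition fin_supp :: "(nat \<Rightarrow> nat) \<Rightarrow> bool" where
  "fin_supp f \<longleftrightarrow> finite {k. f k \<noteq> 0}"

definition interlaces :: "(nat \<Rightarrow> nat) \<Rightarrow> (nat \<Rightarrow> nat) \<Rightarrow> bool" where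
  "interlaces m l \<longleftrightarrow> (\<forall>k. m k \<le> l k \<and> l (Suc k) \<le> m k)"

definition edge :: "bool \<Rightarrow> (nat \<Rightarrow> nat) \<Rightarrow> (nat \<Rightarrow> nat) \<Rightarrow> bool" where
  "edge u f g = (if u then interlaces f g else interlaces g f)"

definition cyl :: "bool list \<Rightarrow> (nat \<Rightarrow> nat) list set" where
  "cyl w = {t. length t = length w \<and>
     (\<forall>i<length w. fin_supp (t ! i) \<and> edge (w ! i) (t ! i) (t ! (Suc i mod length w)))}"

definition flip :: "nat \<Rightarrow> bool list \<Rightarrow> bool list" where
  "flip j w = w[j - 1 := False, j := True]"

text \<open>Index 0 is left out so that \<open>j - 1\<close> never wraps around (words are rotated
  instead). Length at least 3 keeps the two neighbours of \<open>j\<close> distinct from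
  \<open>j\<close> and from each other.\<close>

definition peak :: "bool list \<Rightarrow> nat \<Rightarrow> bool" where
  "peak w j \<longleftrightarrow> 3 \<le> length w \<and> 1 \<le> j \<and> j < length w \<and> w ! (j - 1) \<and> \<not> w ! j"

lemma psum_eq:
  assumes "\<And>k. L \<le> k \<Longrightarrow> f k = 0"
  shows "psum f = (\<Sum>k<L. f k)"
proof -
  have "{k. f k \<noteq> 0} \<subseteq> {..<L}" using assms by (metis (mono_tags, lifting) lessThan_iff mem_Collect_eq not_less subsetI)
  then show ?thesis unfolding psum_def by (intro sum.mono_neutral_left) auto
qed

lemma fin_supp_bound:
  assumes "fin_supp f"
  obtains L where "\<And>k. L \<le> k \<Longrightarrow> f k = 0"
proof -
  from assms obtain L where "\<forall>k\<in>{k. f k \<noteq> 0}. k < L"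
    unfolding fin_supp_def using finite_nat_set_iff_bounded by blast
  then have "f k = 0" if "L \<le> k" for k using that by (metis mem_Collect_eq not_less)
  then show ?thesis using that by blast
qed

lemma fin_suppI:
  assumes "\<And>k. L \<le> k \<Longrightarrow> f k = 0"
  shows "fin_supp f"
proof -
  have "{k. f k \<noteq> 0} \<subseteq> {..<L}" using assms by (metis (mono_tags, lifting) lessThan_iff mem_Collect_eq not_less subsetI)
  then show ?thesis unfolding fin_supp_def by (rule finite_subset) simp
qed

lemma fin_supp_le:
  assumes "fin_supp g" "\<And>k. f k \<le> g k"
  shows "fin_supp f"
proof -
  have "{k. f k \<noteq> 0} \<subseteq> {k. g k \<noteq> 0}" using assms(2) by (metis (mono_tags, lifting) Collect_mono le_zero_eq)
  then show ?thesis using assms(1) unfolding fin_supp_def by (rule finite_subset)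
qed

lemma psum_mono: "fin_supp g \<Longrightarrow> (\<And>k. f k \<le> g k) \<Longrightarrow> psum f \<le> psum g"
proof -
  assume "fin_supp g" and le: "\<And>k. f k \<le> g k"
  then obtain L where L: "\<And>k. L \<le> k \<Longrightarrow> g k = 0" by (metis fin_supp_bound)
  then have "f k = 0" if "L \<le> k" for k using le[of k] that by simp
  then show ?thesis using psum_eq[of L f] psum_eq[of L g] L le by (simp add: sum_mono)
qed

lemma le_psum: "fin_supp f \<Longrightarrow> f k \<le> psum f"
  unfolding psum_def fin_supp_def by (cases "f k = 0") (auto intro!: member_le_sum)

text \<open>Such an \<open>f\<close> has at most \<open>n\<close> nonzero values, each at most
  \<open>n\<close>.\<close>

lemma finite_small:
  "finite {f. (\<forall>k. f (Suc k) \<le> f k) \<and> fin_supp f \<and> psum f \<le> n}"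
proof (rule finite_subset)
  show "finite {f. \<forall>k. (k \<in> {..<n} \<longrightarrow> f k \<in> {..n}) \<and> (k \<notin> {..<n} \<longrightarrow> f k = (0::nat))}"
    by (rule finite_set_of_finite_funs) auto
  show "{f. (\<forall>k. f (Suc k) \<le> f k) \<and> fin_supp f \<and> psum f \<le> n} \<subseteq> {f. \<forall>k. (k \<in> {..<n} \<longrightarrow> f k \<in> {..n}) \<and> (k \<notin> {..<n} \<longrightarrow> f k = (0::nat))}"
  proof (intro subsetI CollectI allI conjI impI)
    fix f :: "nat \<Rightarrow> nat" and k
    assume "f \<in> {f. (\<forall>k. f (Suc k) \<le> f k) \<and> fin_supp f \<and> psum f \<le> n}"
    then have f: "\<forall>k. f (Suc k) \<le> f k" "fin_supp f" "psum f \<le> n" by auto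
    show "f k \<in> {..n}" using le_psum[OF f(2), of k] f(3) by simp
    assume k: "k \<notin> {..<n}"
    show "f k = 0"
    proof (rule ccontr)
      assume "f k \<noteq> 0"
      have dec: "f k \<le> f i" if "i \<le> k" for i
        using lift_Suc_antimono_le[of f i k] f(1) that by blast
      have "(\<Sum>i\<le>k. 1) \<le> (\<Sum>i\<le>k. f i)"
        by (rule sum_mono) (use dec \<open>f k \<noteq> 0\<close> in fastforce)
      also have "\<dots> \<le> psum f"
        unfolding psum_def by (rule sum_le_included[where i = id]) (use f(2) dec \<open>f k \<noteq> 0\<close> in \<open>auto simp: fin_supp_def\<close>, fastforce)
      finally show False using f(3) k by simp
    qed
  qed
qed

lemma edge_antimono:
  assumes "edge u f g"
  shows "f (Suc k) \<le> f k" "g (Suc k) \<le> g k"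
  using assms unfolding edge_def interlaces_def by (meson order.trans)+

lemma all_less_Suc_mod: "(\<forall>i<n. P (Suc i mod n)) \<longleftrightarrow> (\<forall>i<n. P i)"
proof (intro iffI allI impI)
  fix i assume *: "\<forall>i<n. P (Suc i mod n)" "i < n"
  show "P i"
  proof (cases i)
    case 0
    then show ?thesis using *(1)[rule_format, of "n - 1"] *(2) by simp
  next
    case (Suc m)
    then show ?thesis using *(1)[rule_format, of m] *(2) by simp
  qed
qed simp

text \<open>The share of \<open>cyl w\<close> that does not involve entry \<open>j\<close>. It is
  common to \<open>w\<close> and \<open>flip j w\<close>, which differ only in the two edges at
  \<open>j\<close>.\<close>

definition rest :: "nat \<Rightarrow> bool list \<Rightarrow> (nat \<Rightarrow> nat) list \<Rightarrow> bool" where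
  "rest j w t \<longleftrightarrow> length t = length w \<and> (\<forall>i<length w. i \<noteq> j \<longrightarrow> fin_supp (t ! i) \<and>
     (i \<noteq> j - 1 \<longrightarrow> edge (w ! i) (t ! i) (t ! (Suc i mod length w))))"

lemma Suc_mod_neq:
  assumes "3 \<le> n" "1 \<le> j" "j < n"
  shows "Suc j mod n \<noteq> j" "Suc j mod n \<noteq> j - 1" "Suc (j - 1) mod n = j" "Suc j mod n < n" "j - 1 < n" "j - 1 \<noteq> j"
    "i < n \<Longrightarrow> i \<noteq> j - 1 \<Longrightarrow> Suc i mod n \<noteq> j"
  using assms by (auto simp: mod_Suc mod_less)

lemma cyl_rest:
  assumes "3 \<le> length w" "1 \<le> j" "j < length w"
  shows "t \<in> cyl w \<longleftrightarrow> rest j w t \<and> fin_supp (t ! j) \<and> edge (w ! (j - 1)) (t ! (j - 1)) (t ! j) \<and>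
    edge (w ! j) (t ! j) (t ! (Suc j mod length w))"
proof -
  have split: "(\<forall>i<n. A i \<and> E i) \<longleftrightarrow> (\<forall>i<n. i \<noteq> j \<longrightarrow> A i \<and> (i \<noteq> j - 1 \<longrightarrow> E i)) \<and> A j \<and> E (j - 1) \<and> E j"
    if "j < n" "j - 1 < n" for A E :: "nat \<Rightarrow> bool" and n
    using that by metis
  show ?thesis
    unfolding cyl_def rest_def mem_Collect_eq split[OF assms(3) Suc_mod_neq(5)[OF assms]] Suc_mod_neq(3)[OF assms]
    by blast
qed

lemma rest_update:
  assumes "3 \<le> length w" "1 \<le> j" "j < length w"
  shows "rest j w (t[j := f]) \<longleftrightarrow> rest j w t" "rest j (flip j w) t \<longleftrightarrow> rest j w t"
proof -
  have ne: "j \<noteq> Suc i mod length w" if "i < length w" "i \<noteq> j - 1" for i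
    using Suc_mod_neq(7)[OF assms that] by simp
  show "rest j w (t[j := f]) \<longleftrightarrow> rest j w t"
    unfolding rest_def by (simp add: ne cong: imp_cong conj_cong)
  show "rest j (flip j w) t \<longleftrightarrow> rest j w t"
    unfolding rest_def flip_def by (simp cong: imp_cong conj_cong)
qed

lemma length_flip [simp]: "length (flip j w) = length w"
  by (simp add: flip_def)

lemma cyl_peak:
  assumes "peak w j"
  shows "t \<in> cyl w \<longleftrightarrow> rest j w t \<and> fin_supp (t ! j) \<and> interlaces (t ! (j - 1)) (t ! j) \<and> interlaces (t ! (Suc j mod length w)) (t ! j)"
  using cyl_rest[of w j t] assms by (auto simp: peak_def edge_def)

lemma cyl_flip:
  assumes "peak w j"
  shows "t \<in> cyl (flip j w) \<longleftrightarrow> rest j w t \<and> fin_supp (t ! j) \<and> interlaces (t ! j) (t ! (j - 1)) \<and> interlaces (t ! j) (t ! (Suc j mod length w))"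
proof -
  have w: "3 \<le> length w" "1 \<le> j" "j < length w" using assms by (auto simp: peak_def)
  have "flip j w ! (j - 1) = False" "flip j w ! j = True"
    using w by (auto simp: flip_def nth_list_update)
  then show ?thesis using cyl_rest[of "flip j w" j t] rest_update(2)[OF w] w by (auto simp: edge_def)
qed

definition wt :: "int list \<Rightarrow> (nat \<Rightarrow> nat) list \<Rightarrow> int" where
  "wt x t = (\<Sum>i<length t. x ! i * int (psum (t ! i)))"

lemma wt_update:
  assumes "j < length t"
  shows "wt x (t[j := f]) = wt x t + x ! j * (int (psum f) - int (psum (t ! j)))"
proof -
  have "wt x (t[j := f]) = x ! j * int (psum f) + (\<Sum>i\<in>{..<length t} - {j}. x ! i * int (psum (t ! i)))"
    unfolding wt_def using assms by (subst sum.remove[of _ j]) (auto intro!: sum.cong)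
  moreover have "wt x t = x ! j * int (psum (t ! j)) + (\<Sum>i\<in>{..<length t} - {j}. x ! i * int (psum (t ! i)))"
    unfolding wt_def using assms by (subst sum.remove[of _ j]) auto
  ultimately show ?thesis by (simp add: algebra_simps)
qed

text \<open>A toggle replaces the size at \<open>j\<close> by the sum of the neighbours' sizes minus
  it; substituting this into the weight gives these coefficients. Their sum is invariant.\<close>

definition flip_wt :: "nat \<Rightarrow> int list \<Rightarrow> int list" where
  "flip_wt j x = (let i = Suc j mod length x in
     x[j - 1 := x ! (j - 1) + x ! j, i := x ! i + x ! j, j := - x ! j])"

lemma wt_list_update:
  assumes "j < length t" "length x = length t"
  shows "wt (x[j := a]) t = wt x t + (a - x ! j) * int (psum (t ! j))"
proof -
  have "wt (x[j := a]) t = a * int (psum (t ! j)) + (\<Sum>i\<in>{..<length t} - {j}. x ! i * int (psum (t ! i)))"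
    unfolding wt_def using assms by (subst sum.remove[of _ j]) (auto intro!: sum.cong)
  moreover have "wt x t = x ! j * int (psum (t ! j)) + (\<Sum>i\<in>{..<length t} - {j}. x ! i * int (psum (t ! i)))"
    unfolding wt_def using assms by (subst sum.remove[of _ j]) auto
  ultimately show ?thesis by (simp add: algebra_simps)
qed

lemma wt_flip:
  assumes "3 \<le> length t" "1 \<le> j" "j < length t" "length x = length t"
  shows "wt (flip_wt j x) t = wt x t + x ! j * (int (psum (t ! (j - 1))) + int (psum (t ! (Suc j mod length t))) - 2 * int (psum (t ! j)))"
  unfolding flip_wt_def Let_def assms(4)
  using Suc_mod_neq[OF assms(1-3)] assms by (simp add: wt_list_update algebra_simps nth_list_update)

subsection \<open>Toggling a peak\<close>

text \<open>
  The partition \<open>f\<close> at a peak is exchanged for a partition below its neighbours \<open>m\<close> and \<open>n\<close> by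
  reflecting each part, except the first, in the interval of its admissible values. The excess of
  the first part over its minimum is a free natural number, which accounts for the factor
  $1 - q^{x_j}$ in \<open>toggle_gf\<close>.
\<close>

definition toggle :: "(nat \<Rightarrow> nat) \<Rightarrow> (nat \<Rightarrow> nat) \<Rightarrow> (nat \<Rightarrow> nat) \<Rightarrow> nat \<Rightarrow> nat" where
  "toggle m n f k = min (m k) (n k) + max (m (Suc k)) (n (Suc k)) - f (Suc k)"

definition untoggle :: "(nat \<Rightarrow> nat) \<Rightarrow> (nat \<Rightarrow> nat) \<Rightarrow> (nat \<Rightarrow> nat) \<Rightarrow> nat \<Rightarrow> nat" where
  "untoggle m n f = case_nat (max (m 0) (n 0)) (\<lambda>k. min (m k) (n k) + max (m (Suc k)) (n (Suc k)) - f k)"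

lemma toggle_interlaces:
  assumes "interlaces m f" "interlaces n f"
  shows "interlaces (toggle m n f) m" "interlaces (toggle m n f) n" "f 0 = max (m 0) (n 0) \<Longrightarrow> untoggle m n (toggle m n f) = f"
proof -
  have *: "m k \<le> f k" "f (Suc k) \<le> m k" "n k \<le> f k" "f (Suc k) \<le> n k" for k
    using assms by (auto simp: interlaces_def)
  have "toggle m n f k \<le> m k \<and> toggle m n f k \<le> n k" "m (Suc k) \<le> toggle m n f k \<and> n (Suc k) \<le> toggle m n f k" for k
    using *(1,3)[of "Suc k"] *(2,4)[of k] unfolding toggle_def by linarith+
  then show "interlaces (toggle m n f) m" "interlaces (toggle m n f) n"
    by (auto simp: interlaces_def)
  show "untoggle m n (toggle m n f) = f" if "f 0 = max (m 0) (n 0)"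
  proof
    fix k show "untoggle m n (toggle m n f) k = f k"
      using that *(2,4)[of "k - 1"] *(1,3)[of k] by (cases k) (auto simp: untoggle_def toggle_def)
  qed
qed

lemma untoggle_interlaces:
  assumes "interlaces f m" "interlaces f n"
  shows "interlaces m (untoggle m n f)" "interlaces n (untoggle m n f)" "toggle m n (untoggle m n f) = f"
proof -
  have *: "f k \<le> m k" "m (Suc k) \<le> f k" "f k \<le> n k" "n (Suc k) \<le> f k" for k
    using assms by (auto simp: interlaces_def)
  have le: "m k \<le> untoggle m n f k \<and> n k \<le> untoggle m n f k" for k
    using *(1,3)[of "k - 1"] by (cases k) (auto simp: untoggle_def)
  have ge: "untoggle m n f (Suc k) \<le> m k \<and> untoggle m n f (Suc k) \<le> n k" for k
    using *(2,4)[of k] by (auto simp: untoggle_def)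
  show "interlaces m (untoggle m n f)" "interlaces n (untoggle m n f)"
    using le ge by (auto simp: interlaces_def)
  show "toggle m n (untoggle m n f) = f"
  proof
    fix k show "toggle m n (untoggle m n f) k = f k"
      using *(1,3)[of k] by (auto simp: untoggle_def toggle_def)
  qed
qed

lemma psum_untoggle:
  assumes "fin_supp m" "fin_supp n" "interlaces f m" "interlaces f n"
  shows "fin_supp (untoggle m n f)" "psum (untoggle m n f) + psum f = psum m + psum n"
proof -
  obtain L1 L2 where L12: "\<And>k. L1 \<le> k \<Longrightarrow> m k = 0" "\<And>k. L2 \<le> k \<Longrightarrow> n k = 0"
    using fin_supp_bound[OF assms(1)] fin_supp_bound[OF assms(2)] by metis
  define L where "L = max L1 L2"
  have L: "m k = 0" "n k = 0" if "L \<le> k" for k using L12 that by (auto simp: L_def)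
  have *: "f k \<le> m k" "f k \<le> n k" for k using assms by (auto simp: interlaces_def)
  then have Lf: "f k = 0" if "L \<le> k" for k using L[OF that] by (metis le_zero_eq)
  have Lu: "untoggle m n f k = 0" if "Suc L \<le> k" for k
    using that L by (cases k) (auto simp: untoggle_def)
  then show "fin_supp (untoggle m n f)" by (rule fin_suppI)
  have "psum (untoggle m n f) = (\<Sum>k<Suc L. untoggle m n f k)" by (rule psum_eq) (rule Lu)
  also have "\<dots> = max (m 0) (n 0) + (\<Sum>k<L. min (m k) (n k) + max (m (Suc k)) (n (Suc k)) - f k)"
    unfolding sum.lessThan_Suc_shift by (simp add: untoggle_def)
  finally have "psum (untoggle m n f) = max (m 0) (n 0) + (\<Sum>k<L. min (m k) (n k) + max (m (Suc k)) (n (Suc k)) - f k)" .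
  moreover have "(\<Sum>k<L. min (m k) (n k) + max (m (Suc k)) (n (Suc k)) - f k) + (\<Sum>k<L. f k)
      = (\<Sum>k<L. min (m k) (n k) + max (m (Suc k)) (n (Suc k)))"
    unfolding sum.distrib[symmetric]
  proof (rule sum.cong[OF refl])
    fix k show "min (m k) (n k) + max (m (Suc k)) (n (Suc k)) - f k + f k = min (m k) (n k) + max (m (Suc k)) (n (Suc k))"
      using *[of k] by (simp add: min_def)
  qed
  \<comment> \<open>The new first part completes the shifted maxima to the sum of all maxima, and
    minimum plus maximum is \<open>m k + n k\<close>.\<close>
  moreover have "max (m 0) (n 0) + (\<Sum>k<L. max (m (Suc k)) (n (Suc k))) = (\<Sum>k<Suc L. max (m k) (n k))"
    by (simp only: sum.lessThan_Suc_shift)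
  moreover have "\<dots> = (\<Sum>k<L. max (m k) (n k))" using L[of L] by simp
  moreover have "(\<Sum>k<L. min (m k) (n k)) + (\<Sum>k<L. max (m k) (n k)) = (\<Sum>k<L. m k) + (\<Sum>k<L. n k)"
    unfolding sum.distrib[symmetric] by (rule sum.cong) auto
  ultimately show "psum (untoggle m n f) + psum f = psum m + psum n"
    using psum_eq[of L f] psum_eq[of L m] psum_eq[of L n] L Lf by (simp add: sum.distrib)
qed

lemma psum_tail:
  assumes "fin_supp f"
  shows "fin_supp (\<lambda>k. f (Suc k))" "psum f = f 0 + psum (\<lambda>k. f (Suc k))"
proof -
  obtain L where L: "\<And>k. L \<le> k \<Longrightarrow> f k = 0" using fin_supp_bound[OF assms] by metis
  then have L': "\<And>k. L \<le> k \<Longrightarrow> f (Suc k) = 0" "\<And>k. Suc L \<le> k \<Longrightarrow> f k = 0" by simp_all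
  show "fin_supp (\<lambda>k. f (Suc k))" using fin_suppI[OF L'(1)] .
  have "psum f = (\<Sum>k<Suc L. f k)" by (rule psum_eq) (rule L'(2))
  also have "\<dots> = f 0 + (\<Sum>k<L. f (Suc k))" by (rule sum.lessThan_Suc_shift)
  also have "(\<Sum>k<L. f (Suc k)) = psum (\<lambda>k. f (Suc k))" by (rule psum_eq[symmetric]) (rule L'(1))
  finally show "psum f = f 0 + psum (\<lambda>k. f (Suc k))" .
qed

lemma fin_supp_case_nat: "fin_supp f \<Longrightarrow> fin_supp (case_nat v f)"
  by (metis (no_types, lifting) Suc_le_D Suc_le_mono fin_suppI fin_supp_bound old.nat.simps(5))

lemma psum_case_nat: "fin_supp f \<Longrightarrow> psum (case_nat v f) = v + psum f"
  using psum_tail(2)[OF fin_supp_case_nat, of f v] by simp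

lemma fun_upd_case_nat: "f(0 := v) = case_nat v (\<lambda>k. f (Suc k))"
  by (rule ext) (auto split: nat.splits)

lemma fin_supp_upd: "fin_supp f \<Longrightarrow> fin_supp (f(0 := v))"
  unfolding fun_upd_case_nat by (intro fin_supp_case_nat psum_tail)

lemma psum_upd: "fin_supp f \<Longrightarrow> psum (f(0 := Suc (f 0))) = Suc (psum f)"
  unfolding fun_upd_case_nat using psum_tail[of f] by (simp add: psum_case_nat)

context
  fixes w :: "bool list" and j :: nat
  assumes pk: "peak w j"
begin

abbreviation (input) nb1 :: "(nat \<Rightarrow> nat) list \<Rightarrow> nat \<Rightarrow> nat" where "nb1 t \<equiv> t ! (j - 1)"
abbreviation (input) nb2 :: "(nat \<Rightarrow> nat) list \<Rightarrow> nat \<Rightarrow> nat" where "nb2 t \<equiv> t ! (Suc j mod length w)"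

lemma w_len: "3 \<le> length w" "1 \<le> j" "j < length w"
  using pk by (auto simp: peak_def)

lemma upd_nth:
  assumes "length t = length w"
  shows "nb1 (t[j := f]) = nb1 t" "nb2 (t[j := f]) = nb2 t" "t[j := f] ! j = f"
proof -
  have "j \<noteq> Suc j mod length w" "j \<noteq> j - 1" using Suc_mod_neq[OF w_len] by simp_all
  then show "nb1 (t[j := f]) = nb1 t" "nb2 (t[j := f]) = nb2 t" "t[j := f] ! j = f"
    using w_len assms by simp_all
qed

lemma cyl_nb:
  assumes "t \<in> cyl w \<or> t \<in> cyl (flip j w)"
  shows "length t = length w" "fin_supp (nb1 t)" "fin_supp (nb2 t)"
  using assms Suc_mod_neq[OF w_len] by (auto simp: cyl_def)

lemma upd_cyl_peak: "t[j := f] \<in> cyl w \<longleftrightarrow> rest j w t \<and> fin_supp f \<and> interlaces (nb1 t) f \<and> interlaces (nb2 t) f"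
proof (cases "length t = length w")
  case True
  then show ?thesis unfolding cyl_peak[OF pk] rest_update(1)[OF w_len] by (simp only: upd_nth)
qed (auto simp: cyl_def rest_def)

lemma upd_cyl_flip: "t[j := f] \<in> cyl (flip j w) \<longleftrightarrow> rest j w t \<and> fin_supp f \<and> interlaces f (nb1 t) \<and> interlaces f (nb2 t)"
proof (cases "length t = length w")
  case True
  then show ?thesis unfolding cyl_flip[OF pk] rest_update(1)[OF w_len] by (simp only: upd_nth)
qed (auto simp: cyl_def rest_def)

lemma toggle_bij:
  "bij_betw (\<lambda>t. t[j := untoggle (nb1 t) (nb2 t) (t ! j)]) (cyl (flip j w))
     {t \<in> cyl w. (t ! j) 0 = max (nb1 t 0) (nb2 t 0)}"
proof (rule bij_betw_byWitness[where f' = "\<lambda>t. t[j := toggle (nb1 t) (nb2 t) (t ! j)]"])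
  show "\<forall>t\<in>cyl (flip j w). (\<lambda>t. t[j := toggle (nb1 t) (nb2 t) (t ! j)]) (t[j := untoggle (nb1 t) (nb2 t) (t ! j)]) = t"
  proof
    fix t assume t: "t \<in> cyl (flip j w)"
    then have p: "interlaces (t ! j) (nb1 t)" "interlaces (t ! j) (nb2 t)" unfolding cyl_flip[OF pk] by auto
    have l: "length t = length w" using cyl_nb(1)[of t] t by blast
    show "(\<lambda>t. t[j := toggle (nb1 t) (nb2 t) (t ! j)]) (t[j := untoggle (nb1 t) (nb2 t) (t ! j)]) = t"
      unfolding upd_nth[OF l] untoggle_interlaces(3)[OF p] list_update_overwrite list_update_id ..
  qed
  show "\<forall>t\<in>{t \<in> cyl w. (t ! j) 0 = max (nb1 t 0) (nb2 t 0)}.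
      (\<lambda>t. t[j := untoggle (nb1 t) (nb2 t) (t ! j)]) (t[j := toggle (nb1 t) (nb2 t) (t ! j)]) = t"
  proof
    fix t assume t: "t \<in> {t \<in> cyl w. (t ! j) 0 = max (nb1 t 0) (nb2 t 0)}"
    then have p: "interlaces (nb1 t) (t ! j)" "interlaces (nb2 t) (t ! j)" "(t ! j) 0 = max (nb1 t 0) (nb2 t 0)"
      using cyl_peak[OF pk, of t] by auto
    have l: "length t = length w" using cyl_nb(1)[of t] t by blast
    show "(\<lambda>t. t[j := untoggle (nb1 t) (nb2 t) (t ! j)]) (t[j := toggle (nb1 t) (nb2 t) (t ! j)]) = t"
      unfolding upd_nth[OF l] toggle_interlaces(3)[OF p] list_update_overwrite list_update_id ..
  qed
  show "(\<lambda>t. t[j := untoggle (nb1 t) (nb2 t) (t ! j)]) ` cyl (flip j w) \<subseteq> {t \<in> cyl w. (t ! j) 0 = max (nb1 t 0) (nb2 t 0)}"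
  proof (rule image_subsetI)
    fix t assume t: "t \<in> cyl (flip j w)"
    then have p: "rest j w t" "interlaces (t ! j) (nb1 t)" "interlaces (t ! j) (nb2 t)" unfolding cyl_flip[OF pk] by auto
    have l: "length t = length w" and f: "fin_supp (nb1 t)" "fin_supp (nb2 t)" using cyl_nb[of t] t by auto
    show "t[j := untoggle (nb1 t) (nb2 t) (t ! j)] \<in> {t \<in> cyl w. (t ! j) 0 = max (nb1 t 0) (nb2 t 0)}"
      using p psum_untoggle(1)[OF f p(2,3)] untoggle_interlaces[OF p(2,3)]
      unfolding mem_Collect_eq upd_cyl_peak upd_nth[OF l] by (simp add: untoggle_def)
  qed
  show "(\<lambda>t. t[j := toggle (nb1 t) (nb2 t) (t ! j)]) ` {t \<in> cyl w. (t ! j) 0 = max (nb1 t 0) (nb2 t 0)} \<subseteq> cyl (flip j w)"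
  proof (rule image_subsetI)
    fix t assume t: "t \<in> {t \<in> cyl w. (t ! j) 0 = max (nb1 t 0) (nb2 t 0)}"
    then have p: "rest j w t" "interlaces (nb1 t) (t ! j)" "interlaces (nb2 t) (t ! j)" using cyl_peak[OF pk, of t] by auto
    have f: "fin_supp (nb1 t)" using cyl_nb[of t] t by auto
    have "fin_supp (toggle (nb1 t) (nb2 t) (t ! j))"
      by (rule fin_supp_le[OF f]) (use toggle_interlaces(1)[OF p(2,3)] in \<open>simp add: interlaces_def\<close>)
    then show "t[j := toggle (nb1 t) (nb2 t) (t ! j)] \<in> cyl (flip j w)"
      using p toggle_interlaces[OF p(2,3)] unfolding upd_cyl_flip by blast
  qed
qed

lemma wt_untoggle:
  assumes "t \<in> cyl (flip j w)" "length x = length w"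
  shows "wt x (t[j := untoggle (nb1 t) (nb2 t) (t ! j)]) = wt (flip_wt j x) t"
proof -
  have p: "interlaces (t ! j) (nb1 t)" "interlaces (t ! j) (nb2 t)" using assms(1) unfolding cyl_flip[OF pk] by auto
  have l: "length t = length w" and f: "fin_supp (nb1 t)" "fin_supp (nb2 t)" using cyl_nb[of t] assms(1) by auto
  have "int (psum (untoggle (nb1 t) (nb2 t) (t ! j))) = int (psum (nb1 t)) + int (psum (nb2 t)) - int (psum (t ! j))"
    using psum_untoggle(2)[OF f p] by linarith
  note eq = this
  have j: "3 \<le> length t" "j < length t" "length x = length t" using w_len l assms(2) by simp_all
  show ?thesis
    unfolding wt_update[OF j(2)] wt_flip[OF j(1) w_len(2) j(2,3)] eq l by (simp add: algebra_simps)
qed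

text \<open>Interlacing bounds the first part at a peak only from below, so it can always be raised
  by 1.\<close>

lemma increment_bij:
  "bij_betw (\<lambda>t. t[j := (t ! j)(0 := Suc ((t ! j) 0))]) (cyl w) {t \<in> cyl w. (t ! j) 0 \<noteq> max (nb1 t 0) (nb2 t 0)}"
proof (rule bij_betw_byWitness[where f' = "\<lambda>t. t[j := (t ! j)(0 := (t ! j) 0 - 1)]"])
  have gt: "nb1 t 0 \<le> (t ! j) 0" "nb2 t 0 \<le> (t ! j) 0" if "t \<in> cyl w" for t
    using that unfolding cyl_peak[OF pk] interlaces_def by auto
  show "\<forall>t\<in>cyl w. (\<lambda>t. t[j := (t ! j)(0 := (t ! j) 0 - 1)]) (t[j := (t ! j)(0 := Suc ((t ! j) 0))]) = t"
    using cyl_nb(1) upd_nth(3) by simp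
  show "\<forall>t\<in>{t \<in> cyl w. (t ! j) 0 \<noteq> max (nb1 t 0) (nb2 t 0)}.
      (\<lambda>t. t[j := (t ! j)(0 := Suc ((t ! j) 0))]) (t[j := (t ! j)(0 := (t ! j) 0 - 1)]) = t"
  proof
    fix t assume t: "t \<in> {t \<in> cyl w. (t ! j) 0 \<noteq> max (nb1 t 0) (nb2 t 0)}"
    then have l: "length t = length w" using cyl_nb(1) by simp
    have "(t ! j) 0 > 0" using t gt[of t] by auto
    then show "(\<lambda>t. t[j := (t ! j)(0 := Suc ((t ! j) 0))]) (t[j := (t ! j)(0 := (t ! j) 0 - 1)]) = t"
      using upd_nth(3)[OF l] by simp
  qed
  show "(\<lambda>t. t[j := (t ! j)(0 := Suc ((t ! j) 0))]) ` cyl w \<subseteq> {t \<in> cyl w. (t ! j) 0 \<noteq> max (nb1 t 0) (nb2 t 0)}"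
  proof (rule image_subsetI)
    fix t assume t: "t \<in> cyl w"
    then have l: "length t = length w" and p: "rest j w t" "fin_supp (t ! j)" "interlaces (nb1 t) (t ! j)" "interlaces (nb2 t) (t ! j)"
      using cyl_nb(1)[of t] cyl_peak[OF pk, of t] by auto
    have "interlaces (nb1 t) ((t ! j)(0 := Suc ((t ! j) 0)))" "interlaces (nb2 t) ((t ! j)(0 := Suc ((t ! j) 0)))"
      using p(3,4) by (auto simp: interlaces_def le_SucI)
    then show "t[j := (t ! j)(0 := Suc ((t ! j) 0))] \<in> {t \<in> cyl w. (t ! j) 0 \<noteq> max (nb1 t 0) (nb2 t 0)}"
      using p(1) fin_supp_upd[OF p(2)] gt[OF t] unfolding mem_Collect_eq upd_cyl_peak upd_nth[OF l] by auto
  qed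
  show "(\<lambda>t. t[j := (t ! j)(0 := (t ! j) 0 - 1)]) ` {t \<in> cyl w. (t ! j) 0 \<noteq> max (nb1 t 0) (nb2 t 0)} \<subseteq> cyl w"
  proof (rule image_subsetI)
    fix t assume t: "t \<in> {t \<in> cyl w. (t ! j) 0 \<noteq> max (nb1 t 0) (nb2 t 0)}"
    then have p: "rest j w t" "fin_supp (t ! j)" "interlaces (nb1 t) (t ! j)" "interlaces (nb2 t) (t ! j)"
      using cyl_peak[OF pk, of t] by auto
    have "max (nb1 t 0) (nb2 t 0) < (t ! j) 0" using t gt[of t] by auto
    then have "interlaces (nb1 t) ((t ! j)(0 := (t ! j) 0 - 1))" "interlaces (nb2 t) ((t ! j)(0 := (t ! j) 0 - 1))"
      using p(3,4) by (auto simp: interlaces_def)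
    then show "t[j := (t ! j)(0 := (t ! j) 0 - 1)] \<in> cyl w"
      using p(1) fin_supp_upd[OF p(2)] unfolding upd_cyl_peak by blast
  qed
qed

lemma toggle_gf:
  assumes len: "length x = length w" and pos: "0 < x ! j" and gr: "graded (wt x) (cyl w)"
  shows "graded (wt (flip_wt j x)) (cyl (flip j w))"
    and "(1 - q ^ nat (x ! j)) * gf (wt x) (cyl w) = gf (wt (flip_wt j x)) (cyl (flip j w))"
proof -
  let ?P = "{t \<in> cyl w. (t ! j) 0 = max (nb1 t 0) (nb2 t 0)}" and ?Q = "{t \<in> cyl w. (t ! j) 0 \<noteq> max (nb1 t 0) (nb2 t 0)}"
  have grP: "graded (wt x) ?P" "graded (wt x) ?Q" by (rule graded_subset[OF gr], blast)+
  show "graded (wt (flip_wt j x)) (cyl (flip j w))"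
    using graded_bij[OF toggle_bij, of "wt x" "wt (flip_wt j x)"] wt_untoggle[OF _ len] grP(1) by blast
  have P: "gf (wt (flip_wt j x)) (cyl (flip j w)) = gf (wt x) ?P"
    by (rule gf_bij[OF toggle_bij]) (rule wt_untoggle[OF _ len])
  have "gf (\<lambda>t. wt x t + int (nat (x ! j))) (cyl w) = gf (wt x) ?Q"
  proof (rule gf_bij[OF increment_bij])
    fix t assume t: "t \<in> cyl w"
    then have "length t = length w" "fin_supp (t ! j)" using cyl_nb(1)[of t] cyl_peak[OF pk, of t] by auto
    then show "wt x (t[j := (t ! j)(0 := Suc ((t ! j) 0))]) = wt x t + int (nat (x ! j))"
      using w_len pos by (simp add: wt_update psum_upd)
  qed
  then have Q: "gf (wt x) ?Q = q ^ nat (x ! j) * gf (wt x) (cyl w)" unfolding gf_shift[OF gr] by (rule sym)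
  have "gf (wt x) (?P \<union> ?Q) = gf (wt x) ?P + gf (wt x) ?Q"
    by (rule gf_Un_disjoint[OF grP]) blast
  moreover have "?P \<union> ?Q = cyl w" by blast
  ultimately show "(1 - q ^ nat (x ! j)) * gf (wt x) (cyl w) = gf (wt (flip_wt j x)) (cyl (flip j w))"
    unfolding P Q by (simp add: algebra_simps)
qed

end

section \<open>Rotating the cycle\<close>

lemma rotate1_cyl: "rotate1 t \<in> cyl (rotate1 w) \<longleftrightarrow> t \<in> cyl w"
proof (cases "length t = length w")
  case True
  let ?P = "\<lambda>i. fin_supp (t ! i) \<and> edge (w ! i) (t ! i) (t ! (Suc i mod length w))"
  have "rotate1 t \<in> cyl (rotate1 w) \<longleftrightarrow> (\<forall>i<length w. ?P (Suc i mod length w))"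
  proof -
    have "Suc i mod length w < length w" if "i < length w" for i
      using that by (intro mod_less_divisor) linarith
    then show ?thesis using True by (simp add: cyl_def nth_rotate1 cong: imp_cong)
  qed
  also have "\<dots> \<longleftrightarrow> (\<forall>i<length w. ?P i)" by (rule all_less_Suc_mod)
  finally show ?thesis using True by (simp add: cyl_def)
qed (simp add: cyl_def)

lemma rotate1_bij: "bij_betw rotate1 (cyl w) (cyl (rotate1 w))"
proof (rule bij_betw_byWitness[where f' = "\<lambda>t. if t = [] then [] else last t # butlast t"])
  have r: "rotate1 (if t = [] then [] else last t # butlast t) = t" for t :: "(nat \<Rightarrow> nat) list" by simp
  show "\<forall>t\<in>cyl w. (if rotate1 t = [] then [] else last (rotate1 t) # butlast (rotate1 t)) = t"
    by (auto simp: rotate1_hd_tl)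
  show "\<forall>t\<in>cyl (rotate1 w). rotate1 (if t = [] then [] else last t # butlast t) = t" using r by blast
  show "rotate1 ` cyl w \<subseteq> cyl (rotate1 w)" using rotate1_cyl by blast
  show "(\<lambda>t. if t = [] then [] else last t # butlast t) ` cyl (rotate1 w) \<subseteq> cyl w"
    using rotate1_cyl r by (metis (no_types, lifting) image_subsetI)
qed

lemma sum_Suc_mod: "(\<Sum>i<n. h (Suc i mod n)) = (\<Sum>i<n. h i :: 'a::comm_monoid_add)"
proof (cases n)
  case (Suc m)
  have "(\<Sum>i<Suc m. h (Suc i mod Suc m)) = (\<Sum>i<m. h (Suc i)) + h 0" by simp
  also have "\<dots> = (\<Sum>i<Suc m. h i)" unfolding sum.lessThan_Suc_shift by (simp add: add.commute)
  finally show ?thesis unfolding Suc .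
qed simp

lemma wt_rotate1: "length x = length t \<Longrightarrow> wt (rotate1 x) (rotate1 t) = wt x t"
  using sum_Suc_mod[of "\<lambda>i. x ! i * int (psum (t ! i))" "length t"] by (simp add: wt_def nth_rotate1)

lemma rotate_gf:
  assumes "length x = length w"
  shows "graded (wt (rotate1 x)) (cyl (rotate1 w)) \<longleftrightarrow> graded (wt x) (cyl w)"
    "gf (wt (rotate1 x)) (cyl (rotate1 w)) = gf (wt x) (cyl w)"
proof -
  have wt: "wt (rotate1 x) (rotate1 t) = wt x t" if "t \<in> cyl w" for t
    using that assms by (intro wt_rotate1) (simp add: cyl_def)
  show "graded (wt (rotate1 x)) (cyl (rotate1 w)) \<longleftrightarrow> graded (wt x) (cyl w)"
    by (rule graded_bij[OF rotate1_bij, symmetric]) (rule wt)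
  show "gf (wt (rotate1 x)) (cyl (rotate1 w)) = gf (wt x) (cyl w)"
    by (rule gf_bij[OF rotate1_bij, symmetric]) (rule wt)
qed

text \<open>The starting point for gradedness: \<open>toggle_gf\<close> and \<open>rotate_gf\<close>
  pass it on from here to weights with negative entries.\<close>

lemma graded_ones:
  assumes "x = replicate (length w) 1"
  shows "graded (wt x) (cyl w)"
proof -
  have wt: "wt x t = int (\<Sum>i<length w. psum (t ! i))" if "t \<in> cyl w" for t
    using that by (simp add: wt_def assms cyl_def)
  let ?S = "\<lambda>n. {f. (\<forall>k. f (Suc k) \<le> f k) \<and> fin_supp f \<and> psum f \<le> n}"
  have "finite {t \<in> cyl w. wt x t = n}" for n
  proof (rule finite_subset)
    show "finite {t. set t \<subseteq> ?S (nat n) \<and> length t = length w}"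
      by (rule finite_lists_length_eq[OF finite_small])
    show "{t \<in> cyl w. wt x t = n} \<subseteq> {t. set t \<subseteq> ?S (nat n) \<and> length t = length w}"
    proof (rule subsetI)
      fix t assume t: "t \<in> {t \<in> cyl w. wt x t = n}"
      then have l: "length t = length w" by (simp add: cyl_def)
      have n: "nat n = (\<Sum>i<length w. psum (t ! i))" using t wt[of t] by (metis (mono_tags, lifting) mem_Collect_eq nat_int)
      have "f \<in> ?S (nat n)" if "f \<in> set t" for f
      proof -
        from that obtain i where i: "i < length w" "f = t ! i" using l by (metis in_set_conv_nth)
        have "fin_supp f" "edge (w ! i) f (t ! (Suc i mod length w))" using t i by (auto simp: cyl_def)
        moreover have "psum f \<le> (\<Sum>i<length w. psum (t ! i))" unfolding i(2) by (rule member_le_sum) (use i in auto)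
        ultimately show ?thesis unfolding n using edge_antimono(1) by blast
      qed
      with l show "t \<in> {t. set t \<subseteq> ?S (nat n) \<and> length t = length w}" by blast
    qed
  qed
  then show ?thesis using wt by (auto simp: graded_def intro!: sum_nonneg)
qed

lemma list_update_numeral: "(a # xs)[numeral n := v] = a # xs[pred_numeral n := v]"
  by (simp add: numeral_eq_Suc)

definition zigzag :: "bool list" where
  "zigzag = [True, False, True, False, True, False]"

lemma length_zigzag: "length zigzag = 6"
  by (simp add: zigzag_def)

text \<open>Toggling all three peaks gives the opposite alternating word, and one rotation restores
  \<open>zigzag\<close>. The operation can therefore be iterated with only the weights
  changing.\<close>

lemma triple_toggle:
  assumes gr: "graded (wt [v0, p1, v2, p3, v4, p5]) (cyl zigzag)" and pos: "0 < p1" "0 < p3" "0 < p5"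
  defines "x' \<equiv> [- p1, v2 + p1 + p3, - p3, v4 + p3 + p5, - p5, v0 + p1 + p5]"
  shows "graded (wt x') (cyl zigzag)"
    and "(1 - q ^ nat p1) * (1 - q ^ nat p3) * (1 - q ^ nat p5) * gf (wt [v0, p1, v2, p3, v4, p5]) (cyl zigzag)
      = gf (wt x') (cyl zigzag)"
proof -
  let ?w1 = "[False, True, True, False, True, False]" and ?w2 = "[False, True, False, True, True, False]"
    and ?w3 = "[False, True, False, True, False, True]"
  let ?x0 = "[v0, p1, v2, p3, v4, p5]" and ?x1 = "[v0 + p1, - p1, v2 + p1, p3, v4, p5]"
    and ?x2 = "[v0 + p1, - p1, v2 + p1 + p3, - p3, v4 + p3, p5]"
    and ?x3 = "[v0 + p1 + p5, - p1, v2 + p1 + p3, - p3, v4 + p3 + p5, - p5]"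
  have pk: "peak zigzag 1" "peak ?w1 3" "peak ?w2 5" by (simp_all add: peak_def zigzag_def)
  have w: "flip 1 zigzag = ?w1" "flip 3 ?w1 = ?w2" "flip 5 ?w2 = ?w3"
    by (simp_all add: flip_def zigzag_def list_update_numeral)
  have x: "flip_wt 1 ?x0 = ?x1" "flip_wt 3 ?x1 = ?x2" "flip_wt 5 ?x2 = ?x3"
    by (simp_all add: flip_wt_def list_update_numeral Let_def)
  have n: "?x0 ! 1 = p1" "?x1 ! 3 = p3" "?x2 ! 5 = p5" by simp_all
  have rot: "rotate1 ?w3 = zigzag" "rotate1 ?x3 = [- p1, v2 + p1 + p3, - p3, v4 + p3 + p5, - p5, v0 + p1 + p5]"
    by (simp_all add: zigzag_def)
  have len: "length ?x0 = length zigzag" "length ?x1 = length ?w1" "length ?x2 = length ?w2" "length ?x3 = length ?w3"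
    by (simp_all add: length_zigzag)
  note s1 = toggle_gf[OF pk(1) len(1), unfolded w x n, OF pos(1) gr]
  note s2 = toggle_gf[OF pk(2) len(2), unfolded w x n, OF pos(2) s1(1)]
  note s3 = toggle_gf[OF pk(3) len(3), unfolded w x n, OF pos(3) s2(1)]
  note r = rotate_gf[OF len(4), unfolded rot]
  show "graded (wt x') (cyl zigzag)" unfolding x'_def using s3(1) r(1) by blast
  show "(1 - q ^ nat p1) * (1 - q ^ nat p3) * (1 - q ^ nat p5) * gf (wt ?x0) (cyl zigzag) = gf (wt x') (cyl zigzag)"
    unfolding x'_def r(2) s3(2)[symmetric] s2(2)[symmetric] s1(2)[symmetric] by (simp only: mult_ac)
qed

section \<open>Partitions\<close>

definition partitions :: "(nat \<Rightarrow> nat) set" where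
  "partitions = {f. (\<forall>k. f (Suc k) \<le> f k) \<and> fin_supp f}"

definition parts_upto :: "nat \<Rightarrow> (nat \<Rightarrow> nat) set" where
  "parts_upto K = {f. (\<forall>k. f (Suc k) \<le> f k) \<and> (\<forall>k\<ge>K. f k = 0)}"

text \<open>The 6 is the sum of the six weights, invariant under toggling and rotation; a constant
  sequence with entries \<open>f\<close> has weight \<open>6 * psum f\<close>.\<close>

definition partitions_gf :: "rat fps" where
  "partitions_gf = gf (\<lambda>f. 6 * int (psum f)) partitions"

lemma parts_upto_partitions: "parts_upto K \<subseteq> partitions"
  by (auto simp: parts_upto_def partitions_def intro: fin_suppI)

lemma graded_partitions: "graded (\<lambda>f. 6 * int (psum f)) partitions"
proof -
  have "finite {f \<in> partitions. 6 * int (psum f) = n}" for n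
    by (rule finite_subset[OF _ finite_small[of "nat n"]]) (auto simp: partitions_def)
  then show ?thesis by (simp add: graded_def)
qed

text \<open>Lowering the first \<open>K + 1\<close> values by 1 maps the partitions with exactly
  \<open>K + 1\<close> parts onto those with at most \<open>K + 1\<close>, at a saving of
  \<open>6 * (K + 1)\<close>.\<close>

lemma gf_parts_upto:
  "(\<Prod>j<K. 1 - q ^ (6 + 6 * j)) * gf (\<lambda>f. 6 * int (psum f)) (parts_upto K) = 1"
proof (induction K)
  case 0
  have "parts_upto 0 = {\<lambda>_. 0}" by (auto simp: parts_upto_def)
  then have "{f \<in> parts_upto 0. 6 * int (psum f) = int n} = (if n = 0 then {\<lambda>_. 0} else {})" for n
    by (auto simp: psum_def)
  then show ?case by (simp add: gf_def fps_eq_iff)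
next
  case (Suc K)
  let ?w = "\<lambda>f. 6 * int (psum f)" and ?h = "\<lambda>f k. if k \<le> K then Suc (f k) else f k"
  have bij: "bij_betw ?h (parts_upto (Suc K)) (parts_upto (Suc K) - parts_upto K)"
  proof (rule bij_betw_byWitness[where f' = "\<lambda>f k. f k - (if k \<le> K then 1 else 0)"])
    have pos: "1 \<le> f k" if f: "f \<in> parts_upto (Suc K) - parts_upto K" and k: "k \<le> K" for f k
    proof -
      have "f K \<noteq> 0"
      proof
        assume "f K = 0"
        then have "f k = 0" if "K \<le> k" for k using f that by (cases "k = K") (auto simp: parts_upto_def)
        then show False using f by (auto simp: parts_upto_def)
      qed
      moreover have "f K \<le> f k" using lift_Suc_antimono_le[of f k K] f k by (auto simp: parts_upto_def)
      ultimately show ?thesis by simp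
    qed
    show "\<forall>f\<in>parts_upto (Suc K). (\<lambda>k. ?h f k - (if k \<le> K then 1 else 0)) = f" by auto
    show "\<forall>f\<in>parts_upto (Suc K) - parts_upto K. ?h (\<lambda>k. f k - (if k \<le> K then 1 else 0)) = f"
      using pos by fastforce
    show "?h ` parts_upto (Suc K) \<subseteq> parts_upto (Suc K) - parts_upto K"
    proof (rule image_subsetI)
      fix f assume f: "f \<in> parts_upto (Suc K)"
      have "?h f (Suc k) \<le> ?h f k" for k using f by (auto simp: parts_upto_def le_SucI)
      moreover have "?h f k = 0" if "Suc K \<le> k" for k using f that by (auto simp: parts_upto_def)
      ultimately have "?h f \<in> parts_upto (Suc K)" unfolding parts_upto_def mem_Collect_eq by blast
      moreover have "?h f \<notin> parts_upto K"
      proof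
        assume "?h f \<in> parts_upto K"
        then have "?h f K = 0" unfolding parts_upto_def mem_Collect_eq by (metis order_refl)
        then show False by simp
      qed
      ultimately show "?h f \<in> parts_upto (Suc K) - parts_upto K" by (rule DiffI)
    qed
    show "(\<lambda>f k. f k - (if k \<le> K then 1 else 0)) ` (parts_upto (Suc K) - parts_upto K) \<subseteq> parts_upto (Suc K)"
    proof (rule image_subsetI)
      fix f assume f: "f \<in> parts_upto (Suc K) - parts_upto K"
      have "f (Suc k) - (if Suc k \<le> K then 1 else 0) \<le> f k - (if k \<le> K then 1 else 0)" for k
      proof -
        have "f (Suc k) \<le> f k" using f by (simp add: parts_upto_def)
        moreover have "f (Suc k) = 0" if "\<not> Suc k \<le> K" using f that by (simp add: parts_upto_def)
        ultimately show ?thesis by auto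
      qed
      then show "(\<lambda>k. f k - (if k \<le> K then 1 else 0)) \<in> parts_upto (Suc K)"
        using f by (auto simp: parts_upto_def)
    qed
  qed
  have gr: "graded ?w (parts_upto K)" for K by (rule graded_subset[OF graded_partitions parts_upto_partitions])
  have "gf (\<lambda>f. ?w f + int (6 + 6 * K)) (parts_upto (Suc K)) = gf ?w (parts_upto (Suc K) - parts_upto K)"
  proof (rule gf_bij[OF bij])
    fix f assume f: "f \<in> parts_upto (Suc K)"
    have "psum (?h f) = (\<Sum>k<Suc K. ?h f k)" by (rule psum_eq) (use f in \<open>auto simp: parts_upto_def\<close>)
    also have "\<dots> = (\<Sum>k<Suc K. f k + 1)" by (rule sum.cong) auto
    also have "\<dots> = (\<Sum>k<Suc K. f k) + Suc K" by (simp only: sum.distrib) simp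
    also have "(\<Sum>k<Suc K. f k) = psum f" by (rule psum_eq[symmetric]) (use f in \<open>auto simp: parts_upto_def\<close>)
    finally show "?w (?h f) = ?w f + int (6 + 6 * K)" by simp
  qed
  then have 1: "gf ?w (parts_upto (Suc K) - parts_upto K) = q ^ (6 + 6 * K) * gf ?w (parts_upto (Suc K))"
    unfolding gf_shift[OF gr] by (rule sym)
  have sub: "parts_upto K \<subseteq> parts_upto (Suc K)" by (auto simp: parts_upto_def)
  have "gf ?w (parts_upto K \<union> (parts_upto (Suc K) - parts_upto K)) = gf ?w (parts_upto K) + gf ?w (parts_upto (Suc K) - parts_upto K)"
    by (rule gf_Un_disjoint[OF gr graded_subset[OF gr]]) blast+
  moreover have "parts_upto K \<union> (parts_upto (Suc K) - parts_upto K) = parts_upto (Suc K)" using sub by blast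
  ultimately have "(1 - q ^ (6 + 6 * K)) * gf ?w (parts_upto (Suc K)) = gf ?w (parts_upto K)"
    unfolding 1 by (simp add: algebra_simps)
  then show ?case using Suc.IH by (simp only: prod.lessThan_Suc mult.assoc)
qed

lemma dvd_mult_cong:
  fixes a b c d :: "'a::comm_ring_1"
  assumes "e dvd a - b" "e dvd c - d"
  shows "e dvd a * c - b * d"
proof -
  have "a * c - b * d = a * (c - d) + (a - b) * d" by (simp add: algebra_simps)
  then show ?thesis using assms by simp
qed

lemma dvd_power_cong:
  fixes a b :: "'a::comm_ring_1"
  assumes "e dvd a - b"
  shows "e dvd a ^ n - b ^ n"
  by (induction n) (use assms in \<open>auto intro: dvd_mult_cong\<close>)

lemma partitions_gf_eprod: "partitions_gf * eprod 6 6 = 1"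
proof (rule fps_eqI_dvd)
  fix n
  let ?w = "\<lambda>f. 6 * int (psum f)"
  have "{f \<in> partitions. ?w f = int i} = {f \<in> parts_upto n. ?w f = int i}" if i: "i < n" for i
  proof -
    have "f \<in> parts_upto n" if f: "f \<in> partitions" "?w f = int i" for f
    proof -
      have "f k = 0" if k: "n \<le> k" for k
      proof (rule ccontr)
        assume "f k \<noteq> 0"
        have fin_supp: "fin_supp f" using f(1) by (simp add: partitions_def)
        then obtain L where L: "\<And>k. L \<le> k \<Longrightarrow> f k = 0" by (metis fin_supp_bound)
        have dec: "f k \<le> f j" if "j \<le> k" for j
          using lift_Suc_antimono_le[of f j k] f(1) that by (simp add: partitions_def)
        have "k < L" using L[of k] \<open>f k \<noteq> 0\<close> by (meson not_less)
        have "(\<Sum>j<n. 1) \<le> (\<Sum>j<n. f j)"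
        proof (rule sum_mono)
          fix j assume "j \<in> {..<n}"
          then show "1 \<le> f j" using dec[of j] k \<open>f k \<noteq> 0\<close> by simp
        qed
        then have "n \<le> (\<Sum>j<n. f j)" by simp
        also have "\<dots> \<le> (\<Sum>j<L. f j)" by (rule sum_mono2) (use k \<open>k < L\<close> in auto)
        also have "\<dots> = psum f" by (rule psum_eq[symmetric]) (rule L)
        finally show False using f(2) i by simp
      qed
      then show ?thesis using f(1) by (simp add: parts_upto_def partitions_def)
    qed
    then show ?thesis using parts_upto_partitions by blast
  qed
  then have 1: "q ^ n dvd partitions_gf - gf ?w (parts_upto n)"
    by (simp add: X_power_dvd_iff partitions_gf_def gf_nth)
  have 2: "q ^ n dvd eprod 6 6 - (\<Prod>j<n. 1 - q ^ (6 + 6 * j))" by (rule eprod_cong) simp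
  show "q ^ n dvd partitions_gf * eprod 6 6 - 1"
    using dvd_mult_cong[OF 1 2] gf_parts_upto[of n] by (simp add: mult.commute)
qed

lemma eq_if_psum_eq:
  assumes "fin_supp g" "\<And>k. f k \<le> g k" "psum f = psum g"
  shows "f = g"
proof
  fix k
  obtain L where L: "\<And>k. L \<le> k \<Longrightarrow> g k = 0" using fin_supp_bound[OF assms(1)] by metis
  then have L': "f k = 0" if "L \<le> k" for k using assms(2)[of k] that by simp
  show "f k = g k"
  proof (cases "k < L")
    case True
    show ?thesis
    proof (rule ccontr)
      assume "f k \<noteq> g k"
      then have "f k < g k" using assms(2)[of k] by simp
      then have "(\<Sum>k<L. f k) < (\<Sum>k<L. g k)"
        by (intro sum_strict_mono_ex1) (use assms(2) True in auto)
      then show False using psum_eq[of L f] psum_eq[of L g] L L' assms(3) by simp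
    qed
  qed (use L L' in simp)
qed

lemma i6: "{..<6} = {0, 1, 2, 3, 4, 5::nat}"
  by auto

lemma all6: "(\<forall>i<6. P i) \<longleftrightarrow> P 0 \<and> P 1 \<and> P 2 \<and> P 3 \<and> P 4 \<and> P (5::nat)"
proof -
  have "(\<forall>i<6. P i) \<longleftrightarrow> (\<forall>i\<in>{..<6}. P i)" by auto
  then show ?thesis unfolding i6 by simp
qed

text \<open>Shifting weight \<open>c\<close> from each valley to each peak adds
  \<open>c * e\<close>, where \<open>e\<close> is the total size at the peaks minus that at the
  valleys. Since \<open>e\<close> is nonnegative and vanishes only on constant sequences, while the
  old weight is nonnegative by gradedness, every other sequence has weight at least
  \<open>n\<close>.\<close>

lemma zigzag_limit:
  assumes gr: "graded (wt [y0, y1, y2, y3, y4, y5]) (cyl zigzag)" and sum: "y0 + y1 + y2 + y3 + y4 + y5 = 6"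
    and c: "int n \<le> c"
  shows "q ^ n dvd gf (wt [y0 - c, y1 + c, y2 - c, y3 + c, y4 - c, y5 + c]) (cyl zigzag) - partitions_gf"
proof -
  let ?x = "[y0 - c, y1 + c, y2 - c, y3 + c, y4 - c, y5 + c]"
  let ?r = "\<lambda>f. [f, f, f, f, f, f :: nat \<Rightarrow> nat]"
  have wt6: "wt [a0, a1, a2, a3, a4, a5] [f0, f1, f2, f3, f4, f5] = a0 * int (psum f0) + a1 * int (psum f1) + a2 * int (psum f2)
      + a3 * int (psum f3) + a4 * int (psum f4) + a5 * int (psum f5)" for a0 a1 a2 a3 a4 a5 f0 f1 f2 f3 f4 f5
    by (simp add: wt_def i6)
  have cyl6: "[f0, f1, f2, f3, f4, f5] \<in> cyl zigzag \<longleftrightarrow> fin_supp f0 \<and> fin_supp f1 \<and> fin_supp f2 \<and> fin_supp f3 \<and> fin_supp f4 \<and> fin_supp f5 \<and>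
      interlaces f0 f1 \<and> interlaces f2 f1 \<and> interlaces f2 f3 \<and> interlaces f4 f3 \<and> interlaces f4 f5 \<and> interlaces f0 f5" for f0 f1 f2 f3 f4 f5
    unfolding cyl_def mem_Collect_eq length_zigzag all6 by (simp add: zigzag_def edge_def conj_ac)
  have "{t \<in> cyl zigzag. wt ?x t = int i} = ?r ` {f \<in> partitions. 6 * int (psum f) = int i}" if i: "i < n" for i
  proof (intro equalityI subsetI)
    fix t assume t: "t \<in> {t \<in> cyl zigzag. wt ?x t = int i}"
    then have "length t = 6" by (simp add: cyl_def length_zigzag)
    then obtain f0 f1 f2 f3 f4 f5 where t6: "t = [f0, f1, f2, f3, f4, f5]"
      by (auto simp: eval_nat_numeral length_Suc_conv)
    then have f: "fin_supp f0" "fin_supp f1" "fin_supp f2" "fin_supp f3" "fin_supp f4" "fin_supp f5"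
      "interlaces f0 f1" "interlaces f2 f1" "interlaces f2 f3" "interlaces f4 f3" "interlaces f4 f5" "interlaces f0 f5"
      using t cyl6 by auto
    have le: "psum f \<le> psum g" if "interlaces f g" "fin_supp g" for f g
      by (rule psum_mono[OF that(2)]) (use that(1) in \<open>simp add: interlaces_def\<close>)
    have les: "psum f0 \<le> psum f1" "psum f2 \<le> psum f1" "psum f2 \<le> psum f3" "psum f4 \<le> psum f3" "psum f4 \<le> psum f5" "psum f0 \<le> psum f5"
      using le f by auto
    define e where "e = int (psum f1) + int (psum f3) + int (psum f5) - int (psum f0) - int (psum f2) - int (psum f4)"
    have "0 \<le> e" using les by (simp add: e_def)
    have "wt ?x t = wt [y0, y1, y2, y3, y4, y5] t + c * e"
      unfolding t6 wt6 e_def by (simp add: algebra_simps)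
    moreover have "0 \<le> wt [y0, y1, y2, y3, y4, y5] t" using gr t by (simp add: graded_def)
    ultimately have "c * e < int n" using t i by simp
    have "e = 0"
    proof (rule ccontr)
      assume "e \<noteq> 0"
      with \<open>0 \<le> e\<close> have "1 \<le> e" by simp
      then have "c * 1 \<le> c * e" using c by (intro mult_left_mono) auto
      with \<open>c * e < int n\<close> c show False by simp
    qed
    then have eqs: "psum f0 = psum f1" "psum f2 = psum f1" "psum f2 = psum f3" "psum f4 = psum f3" "psum f4 = psum f5"
      using les by (simp_all add: e_def)
    have ple: "f k \<le> g k" if "interlaces f g" for f g k using that by (simp add: interlaces_def)
    have "f0 = f1" "f2 = f1" "f2 = f3" "f4 = f3" "f4 = f5"
      using eq_if_psum_eq[OF f(2) ple[OF f(7)] eqs(1)] eq_if_psum_eq[OF f(2) ple[OF f(8)] eqs(2)]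
        eq_if_psum_eq[OF f(4) ple[OF f(9)] eqs(3)] eq_if_psum_eq[OF f(4) ple[OF f(10)] eqs(4)]
        eq_if_psum_eq[OF f(6) ple[OF f(11)] eqs(5)] by blast+
    then have tr: "t = ?r f0" using t6 by simp
    have "wt ?x (?r f0) = (y0 + y1 + y2 + y3 + y4 + y5) * int (psum f0)" unfolding wt6 by (simp add: algebra_simps)
    then have "6 * int (psum f0) = int i" using t tr sum by simp
    moreover have "f0 \<in> partitions" using f(1,7) \<open>f0 = f1\<close> by (simp add: partitions_def interlaces_def)
    ultimately show "t \<in> ?r ` {f \<in> partitions. 6 * int (psum f) = int i}" using tr by blast
  next
    fix t assume "t \<in> ?r ` {f \<in> partitions. 6 * int (psum f) = int i}"
    then obtain f where f: "t = ?r f" "f \<in> partitions" "6 * int (psum f) = int i" by blast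
    have "wt ?x (?r f) = (y0 + y1 + y2 + y3 + y4 + y5) * int (psum f)" unfolding wt6 by (simp add: algebra_simps)
    then show "t \<in> {t \<in> cyl zigzag. wt ?x t = int i}"
      using f sum by (simp add: cyl6 partitions_def interlaces_def)
  qed
  moreover have "inj_on ?r A" for A by (rule inj_onI) simp
  ultimately have "card {t \<in> cyl zigzag. wt ?x t = int i} = card {f \<in> partitions. 6 * int (psum f) = int i}" if "i < n" for i
    using that by (simp add: card_image)
  then show ?thesis by (simp add: X_power_dvd_iff gf_nth partitions_gf_def)
qed

section \<open>The product formulas for the profiles (1,1,1) and (3,0,0)\<close>

lemma limit_product:
  assumes "\<And>n. Z 0 * E 0 = Z n * E n" "\<And>n. q ^ n dvd Z n - partitions_gf" "\<And>n. q ^ n dvd E n - 1"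
  shows "Z 0 * E 0 = partitions_gf"
proof (rule fps_eqI_dvd)
  fix n show "q ^ n dvd Z 0 * E 0 - partitions_gf"
    using dvd_mult_cong[OF assms(2,3), of n] unfolding assms(1)[of n] by simp
qed

lemma eprod_power_cong_1:
  assumes "1 \<le> d" "n \<le> a"
  shows "q ^ n dvd eprod a d ^ k - 1"
  using dvd_power_cong[OF dvd_trans[OF le_imp_power_dvd[OF assms(2)] eprod_cong_1[OF assms(1)]], of k] by simp

text \<open>Each triple toggle raises the peak weights by 2 and lowers the valley weights by 2, at
  the price of the factor \<open>(1 - q ^ (1 + 2 * n)) ^ 3\<close>.\<close>

lemma gf_zigzag: "gf (wt [1, 1, 1, 1, 1, 1]) (cyl zigzag) * eprod 1 2 ^ 3 = partitions_gf"
proof -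
  define x where "x = (\<lambda>n. let v = 1 - 2 * int n; p = 1 + 2 * int n in [v, p, v, p, v, p])"
  have x0: "x 0 = [1, 1, 1, 1, 1, 1]" by (simp add: x_def)
  define Z where "Z = (\<lambda>n. gf (wt (x n)) (cyl zigzag))"
  have gr0: "graded (wt (x 0)) (cyl zigzag)"
    by (rule graded_ones) (simp add: x0 zigzag_def)
  have step: "graded (wt (x (Suc n))) (cyl zigzag) \<and> (1 - q ^ (1 + 2 * n)) ^ 3 * Z n = Z (Suc n)"
    if "graded (wt (x n)) (cyl zigzag)" for n
  proof -
    let ?v = "1 - 2 * int n" and ?p = "1 + 2 * int n"
    have "x n = [?v, ?p, ?v, ?p, ?v, ?p]" "x (Suc n) = [- ?p, ?v + ?p + ?p, - ?p, ?v + ?p + ?p, - ?p, ?v + ?p + ?p]"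
      by (simp_all add: x_def Let_def)
    moreover have "nat ?p = 1 + 2 * n" by simp
    ultimately show ?thesis
      using triple_toggle[of ?v ?p ?v ?p ?v ?p] that unfolding Z_def by (simp add: power3_eq_cube)
  qed
  have gr: "graded (wt (x n)) (cyl zigzag)" for n
    by (induction n) (use gr0 step in auto)
  have "Z 0 * eprod (1 + 2 * 0) 2 ^ 3 = partitions_gf"
  proof (rule limit_product[where E = "\<lambda>n. eprod (1 + 2 * n) 2 ^ 3"])
    show "Z 0 * eprod (1 + 2 * 0) 2 ^ 3 = Z n * eprod (1 + 2 * n) 2 ^ 3" for n
    proof (induction n)
      case (Suc n)
      have e: "eprod (1 + 2 * n) 2 = (1 - q ^ (1 + 2 * n)) * eprod (1 + 2 * Suc n) 2"
        using eprod_rec[of 2 "1 + 2 * n"] by (simp add: algebra_simps)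
      show ?case
        unfolding Suc.IH unfolding e power_mult_distrib step[OF gr[of n], THEN conjunct2, symmetric] by (simp only: mult_ac)
    qed simp
    show "q ^ n dvd Z n - partitions_gf" for n
      using zigzag_limit[of 1 1 1 1 1 1 n "2 * int n"] gr0 unfolding x0 by (simp add: Z_def x_def Let_def)
    show "q ^ n dvd eprod (1 + 2 * n) 2 ^ 3 - 1" for n by (rule eprod_power_cong_1) simp_all
  qed
  then show ?thesis by (simp add: Z_def x0)
qed

text \<open>Toggles at 3, 2 and 4, with weights 1, 2 and 2, lead to \<open>zigzag\<close> and give
  the finite prefactor. The resulting unequal weights recur only after three triple toggles, with
  peaks raised and valleys lowered by 6; hence products of step 6.\<close>

lemma gf_single_peak:
  "gf (wt [1, 1, 1, 1, 1, 1]) (cyl [True, True, True, False, False, False]) * ((1 - q) * (1 - q\<^sup>2)\<^sup>2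
     * (eprod 3 6 ^ 3 * eprod 4 6 ^ 2 * eprod 7 6 * eprod 5 6 * eprod 8 6 ^ 2)) = partitions_gf"
proof -
  let ?w0 = "[True, True, True, False, False, False]" and ?w1 = "[True, True, False, True, False, False]"
    and ?w2 = "[True, False, True, True, False, False]"
  let ?x0 = "[1, 1, 1, 1, 1, 1]" and ?x1 = "[1, 1, 2, - 1, 2, 1]" and ?x2 = "[1, 3, - 2, 1, 2, 1]" and ?x3 = "[1, 3, - 2, 3, - 2, 3]"
  define x where "x = (\<lambda>n. [1 - 6 * int n, 3 + 6 * int n, - 2 - 6 * int n, 3 + 6 * int n, - 2 - 6 * int n, 3 + 6 * int n])"
  have pk: "peak ?w0 3" "peak ?w1 2" "peak ?w2 4" by (simp_all add: peak_def)
  have w: "flip 3 ?w0 = ?w1" "flip 2 ?w1 = ?w2" "flip 4 ?w2 = zigzag"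
    by (simp_all add: flip_def zigzag_def list_update_numeral)
  have xs: "flip_wt 3 ?x0 = ?x1" "flip_wt 2 ?x1 = ?x2" "flip_wt 4 ?x2 = ?x3"
    by (simp_all add: flip_wt_def list_update_numeral Let_def)
  have n: "?x0 ! 3 = 1" "?x1 ! 2 = 2" "?x2 ! 4 = 2" by simp_all
  have len: "length ?x0 = length ?w0" "length ?x1 = length ?w1" "length ?x2 = length ?w2" by simp_all
  have gr0: "graded (wt ?x0) (cyl ?w0)" by (rule graded_ones) simp
  have pos: "(0::int) < 1" "(0::int) < 2" by simp_all
  note s1 = toggle_gf[OF pk(1) len(1), unfolded w xs n, OF pos(1) gr0]
  note s2 = toggle_gf[OF pk(2) len(2), unfolded w xs n, OF pos(2) s1(1)]
  note s3 = toggle_gf[OF pk(3) len(3), unfolded w xs n, OF pos(2) s2(1)]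
  define Z where "Z = (\<lambda>n. gf (wt (x n)) (cyl zigzag))"
  have x0: "x 0 = ?x3" by (simp add: x_def)
  have Z0: "gf (wt ?x0) (cyl ?w0) * ((1 - q) * (1 - q\<^sup>2)\<^sup>2) = Z 0"
    unfolding Z_def x0 s3(2)[symmetric] s2(2)[symmetric] s1(2)[symmetric]
    by (simp add: power2_eq_square mult_ac)
  \<comment> \<open>The exponents of one period are (3, 3, 3), (4, 4, 7) and (5, 8, 8), each raised
    by \<open>6 * n\<close>: the peak weights of \<open>?y0\<close>, \<open>?y1\<close>,
    \<open>?y2\<close> below.\<close>
  define F where "F = (\<lambda>n. (1 - q ^ (3 + 6 * n)) ^ 3 * (1 - q ^ (4 + 6 * n)) ^ 2 * (1 - q ^ (7 + 6 * n))
      * (1 - q ^ (5 + 6 * n)) * (1 - q ^ (8 + 6 * n)) ^ 2)"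
  have step: "graded (wt (x (Suc n))) (cyl zigzag) \<and> F n * Z n = Z (Suc n)"
    if gr: "graded (wt (x n)) (cyl zigzag)" for n
  proof -
    define m where "m = 6 * int n"
    let ?y0 = "[1 - m, 3 + m, - 2 - m, 3 + m, - 2 - m, 3 + m]"
      and ?y1 = "[- (3 + m), 4 + m, - (3 + m), 4 + m, - (3 + m), 7 + m]"
      and ?y2 = "[- (4 + m), 5 + m, - (4 + m), 8 + m, - (7 + m), 8 + m]"
      and ?y3 = "[- (5 + m), 9 + m, - (8 + m), 9 + m, - (8 + m), 9 + m]"
    have m: "0 \<le> m" by (simp add: m_def)
    have y0: "x n = ?y0" and y3: "x (Suc n) = ?y3" by (simp_all add: x_def m_def)
    have nat: "nat (3 + m) = 3 + 6 * n" "nat (4 + m) = 4 + 6 * n" "nat (5 + m) = 5 + 6 * n"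
      "nat (7 + m) = 7 + 6 * n" "nat (8 + m) = 8 + 6 * n"
      by (simp_all add: m_def nat_add_distrib nat_mult_distrib)
    have p: "0 < 3 + m" "0 < 4 + m" "0 < 5 + m" "0 < 7 + m" "0 < 8 + m" using m by simp_all
    have e1: "- 2 - m + (3 + m) + (3 + m) = 4 + m" "1 - m + (3 + m) + (3 + m) = 7 + m" by simp_all
    have e2: "- (3 + m) + (4 + m) + (4 + m) = 5 + m" "- (3 + m) + (4 + m) + (7 + m) = 8 + m" by simp_all
    have e3: "- (4 + m) + (5 + m) + (8 + m) = 9 + m" "- (7 + m) + (8 + m) + (8 + m) = 9 + m" by simp_all
    note t1 = triple_toggle[OF gr[unfolded y0] p(1) p(1) p(1), unfolded e1]
    note t2 = triple_toggle[OF t1(1) p(2) p(2) p(4), unfolded e2]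
    note t3 = triple_toggle[OF t2(1) p(3) p(5) p(5), unfolded e3]
    have "F n * Z n = Z (Suc n)"
      unfolding Z_def y0 y3 t3(2)[symmetric] t2(2)[symmetric] t1(2)[symmetric] nat F_def
      by (simp only: power2_eq_square power3_eq_cube mult_ac)
    then show ?thesis using t3(1) unfolding y3 by blast
  qed
  have gr: "graded (wt (x n)) (cyl zigzag)" for n
    by (induction n) (use s3(1) x0 step in auto)
  define E where "E = (\<lambda>n. eprod (3 + 6 * n) 6 ^ 3 * eprod (4 + 6 * n) 6 ^ 2 * eprod (7 + 6 * n) 6 * eprod (5 + 6 * n) 6
      * eprod (8 + 6 * n) 6 ^ 2)"
  have "Z 0 * E 0 = partitions_gf"
  proof (rule limit_product)
    show "Z 0 * E 0 = Z n * E n" for n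
    proof (induction n)
      case (Suc n)
      have e: "eprod (a + 6 * n) 6 = (1 - q ^ (a + 6 * n)) * eprod (a + 6 * Suc n) 6" for a
        using eprod_rec[of 6 "a + 6 * n"] by (simp add: algebra_simps)
      have "E n = F n * E (Suc n)"
        unfolding E_def F_def e[of 3] e[of 4] e[of 7] e[of 5] e[of 8] power_mult_distrib by (simp only: mult_ac)
      then show ?case unfolding Suc.IH step[OF gr[of n], THEN conjunct2, symmetric] by (simp only: mult_ac)
    qed simp
    show "q ^ n dvd Z n - partitions_gf" for n
      using zigzag_limit[of 1 3 "- 2" 3 "- 2" 3 n "6 * int n"] gr[of 0] unfolding x0 by (simp add: Z_def x_def)
    show "q ^ n dvd E n - 1" for n
    proof -
      have e: "q ^ n dvd eprod (a + 6 * n) 6 ^ k - 1" for a k by (rule eprod_power_cong_1) simp_all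
      show ?thesis unfolding E_def
        using dvd_mult_cong[OF dvd_mult_cong[OF dvd_mult_cong[OF dvd_mult_cong[OF e[of 3 3] e[of 4 2]] e[of 7 1]] e[of 5 1]] e[of 8 2]]
        by simp
    qed
  qed
  then show ?thesis unfolding Z0[symmetric] E_def by (simp add: mult_ac)
qed

section \<open>Capped cylindric partitions\<close>

text \<open>
  If the cap \<open>N\<close> is attained at a peak, removing the first part of the partition there turns the
  peak into a valley, and the removed part is charged to the cap.
\<close>

definition cap :: "bool list \<Rightarrow> nat set \<Rightarrow> ((nat \<Rightarrow> nat) list \<times> nat) set" where
  "cap w J = {(t, N). t \<in> cyl w \<and> (\<forall>i<length w. (t ! i) 0 \<le> N) \<and> (\<forall>j\<in>J. (t ! j) 0 = N)}"

definition cwt :: "nat \<Rightarrow> (nat \<Rightarrow> nat) list \<times> nat \<Rightarrow> int" where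
  "cwt m = (\<lambda>(t, N). wt (replicate (length t) 1) t + int (m * N))"

lemma wt_ones: "wt (replicate (length t) 1) t = int (\<Sum>i<length t. psum (t ! i))"
  by (simp add: wt_def)

lemma le_wt_ones: "i < length t \<Longrightarrow> fin_supp (t ! i) \<Longrightarrow> int ((t ! i) 0) \<le> wt (replicate (length t) 1) t"
proof -
  assume i: "i < length t" "fin_supp (t ! i)"
  have "(t ! i) 0 \<le> psum (t ! i)" by (rule le_psum[OF i(2)])
  also have "\<dots> \<le> (\<Sum>i<length t. psum (t ! i))" by (rule member_le_sum) (use i in auto)
  finally show ?thesis unfolding wt_ones of_nat_le_iff .
qed

text \<open>The weight must bound the cap: either the cap is charged directly, or it is attained by
  a part that the size counts.\<close>

lemma graded_cap:
  assumes "1 \<le> m \<or> (\<exists>j\<in>J. j < length w)"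
  shows "graded (cwt m) (cap w J)"
proof -
  let ?x = "replicate (length w) 1"
  have gr: "graded (wt ?x) (cyl w)" by (rule graded_ones) simp
  have nonneg: "0 \<le> cwt m p" if "p \<in> cap w J" for p
    using that gr by (auto simp: cap_def cwt_def graded_def cyl_def split: prod.splits)
  have "finite {p \<in> cap w J. cwt m p = n}" for n
  proof (rule finite_subset)
    show "finite ((\<Union>k\<in>{0..n}. {t \<in> cyl w. wt ?x t = k}) \<times> {..nat n})"
      using gr by (auto simp: graded_def)
    show "{p \<in> cap w J. cwt m p = n} \<subseteq> (\<Union>k\<in>{0..n}. {t \<in> cyl w. wt ?x t = k}) \<times> {..nat n}"
    proof (rule subsetI)
      fix p assume p: "p \<in> {p \<in> cap w J. cwt m p = n}"
      obtain t N where tN: "p = (t, N)" by (cases p)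
      have t: "t \<in> cyl w" "length t = length w" and J: "\<forall>j\<in>J. (t ! j) 0 = N" and n: "wt ?x t + int (m * N) = n"
        using p tN by (auto simp: cap_def cwt_def cyl_def)
      have "0 \<le> wt ?x t" using gr t(1) by (simp add: graded_def)
      moreover have "int N \<le> n"
      proof (cases "1 \<le> m")
        case True
        then have "N \<le> m * N" by simp
        then show ?thesis using n \<open>0 \<le> wt ?x t\<close> by linarith
      next
        case False
        then obtain j where j: "j \<in> J" "j < length w" using assms by auto
        have "int ((t ! j) 0) \<le> wt ?x t" using le_wt_ones[of j t] j(2) t by (auto simp: cyl_def)
        then have "int N \<le> wt ?x t" using J j(1) t(2) by simp
        then show ?thesis using n of_nat_0_le_iff[of "m * N"] by linarith
      qed
      moreover have "wt ?x t \<le> n" using n by auto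
      ultimately show "p \<in> (\<Union>k\<in>{0..n}. {t \<in> cyl w. wt ?x t = k}) \<times> {..nat n}" using t(1) tN by auto
    qed
  qed
  then show ?thesis using nonneg by (simp add: graded_def)
qed

lemma remove_gf:
  assumes pk: "peak w j" and j: "j \<in> J"
  shows "gf (cwt m) (cap w J) = gf (cwt (m + 1)) (cap (flip j w) (J - {j}))"
proof (rule gf_bij)
  let ?f = "\<lambda>(t, N). (t[j := \<lambda>k. (t ! j) (Suc k)], N)" and ?g = "\<lambda>(t, N). (t[j := case_nat N (t ! j)], N :: nat)"
  have jw: "j < length w" "j - 1 < length w" "Suc j mod length w < length w"
    using w_len[OF pk] Suc_mod_neq[OF w_len[OF pk]] by auto
  have nb: "j \<noteq> j - 1" "j \<noteq> Suc j mod length w" using Suc_mod_neq[OF w_len[OF pk]] by simp_all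
  show "bij_betw ?f (cap w J) (cap (flip j w) (J - {j}))"
  proof (rule bij_betw_byWitness[where f' = ?g])
    have tail: "case_nat (f 0) (\<lambda>k. f (Suc k)) = f" for f :: "nat \<Rightarrow> nat"
      by (rule ext) (auto split: nat.splits)
    show "\<forall>p\<in>cap w J. ?g (?f p) = p"
    proof (rule ballI)
      fix p assume p: "p \<in> cap w J"
      obtain t N where tN: "p = (t, N)" by (cases p)
      have l: "length t = length w" and N: "N = (t ! j) 0" using p tN j by (auto simp: cap_def cyl_def)
      show "?g (?f p) = p" unfolding tN prod.case upd_nth(3)[OF pk l] N tail list_update_overwrite list_update_id ..
    qed
    show "\<forall>p\<in>cap (flip j w) (J - {j}). ?f (?g p) = p"
    proof (rule ballI)
      fix p assume p: "p \<in> cap (flip j w) (J - {j})"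
      obtain t N where tN: "p = (t, N)" by (cases p)
      have l: "length t = length w" using p tN by (auto simp: cap_def cyl_def)
      show "?f (?g p) = p" unfolding tN prod.case upd_nth(3)[OF pk l] by simp
    qed
    show "?f ` cap w J \<subseteq> cap (flip j w) (J - {j})"
    proof (rule image_subsetI)
      fix p assume p: "p \<in> cap w J"
      obtain t N where tN: "p = (t, N)" by (cases p)
      have t: "rest j w t" "fin_supp (t ! j)" "interlaces (t ! (j - 1)) (t ! j)" "interlaces (t ! (Suc j mod length w)) (t ! j)"
        and l: "length t = length w" and c: "\<forall>i<length w. (t ! i) 0 \<le> N" "\<forall>j\<in>J. (t ! j) 0 = N"
        using p tN cyl_peak[OF pk, of t] by (auto simp: cap_def cyl_def)
      have "t[j := \<lambda>k. (t ! j) (Suc k)] \<in> cyl (flip j w)"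
        unfolding upd_cyl_flip[OF pk] using t psum_tail(1)[OF t(2)] by (auto simp: interlaces_def)
      moreover have "(t ! j) (Suc 0) \<le> N" using t(3) c(1) jw(2) unfolding interlaces_def by (metis order.trans)
      ultimately show "?f p \<in> cap (flip j w) (J - {j})"
        using c l jw(1) unfolding tN by (auto simp: cap_def nth_list_update)
    qed
    show "?g ` cap (flip j w) (J - {j}) \<subseteq> cap w J"
    proof (rule image_subsetI)
      fix p assume p: "p \<in> cap (flip j w) (J - {j})"
      obtain t N where tN: "p = (t, N)" by (cases p)
      have t: "rest j w t" "fin_supp (t ! j)" "interlaces (t ! j) (t ! (j - 1))" "interlaces (t ! j) (t ! (Suc j mod length w))"
        and l: "length t = length w" and c: "\<forall>i<length w. (t ! i) 0 \<le> N" "\<forall>j\<in>J - {j}. (t ! j) 0 = N"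
        using p tN cyl_flip[OF pk, of t] by (auto simp: cap_def cyl_def)
      have le: "(t ! (j - 1)) 0 \<le> N" "(t ! (Suc j mod length w)) 0 \<le> N" using c(1) jw by simp_all
      have "interlaces (t ! (j - 1)) (case_nat N (t ! j))" "interlaces (t ! (Suc j mod length w)) (case_nat N (t ! j))"
        using t(3,4) le unfolding interlaces_def by (auto split: nat.splits)
      then have "t[j := case_nat N (t ! j)] \<in> cyl w"
        unfolding upd_cyl_peak[OF pk] using t fin_supp_case_nat[OF t(2)] by blast
      then show "?g p \<in> cap w J"
        using c l jw(1) unfolding tN by (auto simp: cap_def nth_list_update)
    qed
  qed
  fix p assume p: "p \<in> cap w J"
  obtain t N where tN: "p = (t, N)" by (cases p)
  have l: "length t = length w" and f: "fin_supp (t ! j)" and N: "(t ! j) 0 = N"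
    using p tN j jw by (auto simp: cap_def cyl_def)
  show "cwt (m + 1) (?f p) = cwt m p"
    using psum_tail(2)[OF f] N jw(1) l unfolding tN by (simp add: cwt_def wt_update algebra_simps)
qed

text \<open>In use \<open>P\<close> is the set of all peaks of \<open>w\<close>. An attained cap is
  then attained at a peak, where \<open>remove_gf\<close> applies.\<close>

definition dominated :: "bool list \<Rightarrow> nat set \<Rightarrow> bool" where
  "dominated w P \<longleftrightarrow> P \<noteq> {} \<and> P \<subseteq> {..<length w} \<and> (\<forall>t\<in>cyl w. \<forall>i<length w. \<exists>j\<in>P. (t ! i) 0 \<le> (t ! j) 0)"

text \<open>If $F(z)$ is the series of \<open>cyl w\<close> with $z$ marking the largest part, this
  is $F(q^m)/(1-q^m)$ for $m$ at least 1; the geometric factor comes from the slack in the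
  cap.\<close>

definition phi :: "bool list \<Rightarrow> nat \<Rightarrow> rat fps" where
  "phi w m = gf (cwt m) (cap w {})"

text \<open>A cap that is not attained can be lowered by 1, which saves \<open>m\<close>; such pairs
  therefore contribute \<open>q ^ m * phi w m\<close>.\<close>

lemma phi_attained:
  assumes m: "1 \<le> m" and dom: "dominated w P"
  shows "(1 - q ^ m) * phi w m = gf (cwt m) (\<Union>j\<in>P. cap w {j})"
proof -
  let ?F = "\<Union>j\<in>P. cap w {j}" and ?s = "\<lambda>(t, N). (t :: (nat \<Rightarrow> nat) list, Suc N)"
  have P: "j < length w" if "j \<in> P" for j using dom that by (auto simp: dominated_def)
  have gr: "graded (cwt m) (cap w {})" by (rule graded_cap) (use m in simp)
  have un: "cap w {} = ?F \<union> ?s ` cap w {}"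
  proof (intro equalityI subsetI)
    fix p assume p: "p \<in> cap w {}"
    obtain t N where tN: "p = (t, N)" by (cases p)
    have t: "t \<in> cyl w" "\<forall>i<length w. (t ! i) 0 \<le> N" using p tN by (auto simp: cap_def)
    show "p \<in> ?F \<union> ?s ` cap w {}"
    proof (cases "\<exists>j\<in>P. (t ! j) 0 = N")
      case True
      then show ?thesis using t tN by (auto simp: cap_def)
    next
      case False
      then have lt: "(t ! j) 0 < N" if "j \<in> P" for j using t(2) P[OF that] that by (meson le_neq_implies_less)
      then obtain N' where N': "N = Suc N'" using dom by (auto simp: dominated_def) (metis not_gr_zero not_less_zero old.nat.exhaust)
      have "(t ! i) 0 \<le> N'" if i: "i < length w" for i
      proof -
        obtain j where "j \<in> P" "(t ! i) 0 \<le> (t ! j) 0" using dom t(1) i unfolding dominated_def by blast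
        then show ?thesis using lt N' by fastforce
      qed
      then have "(t, N') \<in> cap w {}" using t(1) by (simp add: cap_def)
      then show ?thesis using tN N' by force
    qed
  next
    fix p assume "p \<in> ?F \<union> ?s ` cap w {}"
    then show "p \<in> cap w {}" by (auto simp: cap_def le_SucI)
  qed
  have "?F \<inter> ?s ` cap w {} = {}"
  proof -
    have "(t ! j) 0 \<noteq> Suc N" if "(t, N) \<in> cap w {}" "j \<in> P" for t N j
    proof -
      have "(t ! j) 0 \<le> N" using that P by (simp add: cap_def)
      then show ?thesis by simp
    qed
    then show ?thesis by (auto simp: cap_def)
  qed
  moreover have "graded (cwt m) ?F" "graded (cwt m) (?s ` cap w {})"
    using graded_subset[OF gr] un by blast+
  ultimately have "gf (cwt m) (?F \<union> ?s ` cap w {}) = gf (cwt m) ?F + gf (cwt m) (?s ` cap w {})"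
    by (intro gf_Un_disjoint)
  then have "phi w m = gf (cwt m) ?F + gf (cwt m) (?s ` cap w {})"
    unfolding phi_def un[symmetric] .
  moreover have "gf (\<lambda>p. cwt m p + int m) (cap w {}) = gf (cwt m) (?s ` cap w {})"
    by (rule gf_bij[where f = ?s]) (auto simp: bij_betw_def inj_on_def cwt_def algebra_simps)
  ultimately show ?thesis
    unfolding gf_shift[OF gr] phi_def[symmetric] by (simp add: algebra_simps)
qed

text \<open>The case \<open>m = 0\<close>, out of reach of \<open>phi_attained\<close>: free caps
  cost nothing, so fibres are infinite and \<open>1 - q ^ m\<close> vanishes. An attained cap,
  however, is determined by the sequence.\<close>

lemma cyl_attained:
  assumes dom: "dominated w P"
  shows "gf (wt (replicate (length w) 1)) (cyl w) = gf (cwt 0) (\<Union>j\<in>P. cap w {j})"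
proof (rule gf_bij[symmetric])
  have P: "j < length w" if "j \<in> P" for j using dom that by (auto simp: dominated_def)
  show "bij_betw fst (\<Union>j\<in>P. cap w {j}) (cyl w)"
    unfolding bij_betw_def
  proof (intro conjI equalityI subsetI)
    show "inj_on fst (\<Union>j\<in>P. cap w {j})"
    proof (rule inj_onI)
      fix p p' assume p: "p \<in> (\<Union>j\<in>P. cap w {j})" "p' \<in> (\<Union>j\<in>P. cap w {j})" "fst p = fst p'"
      obtain t N N' where tN: "p = (t, N)" "p' = (t, N')" using p(3) by (cases p; cases p') auto
      obtain j j' where "j \<in> P" "p \<in> cap w {j}" "j' \<in> P" "p' \<in> cap w {j'}" using p by blast
      then have "N \<le> N'" "N' \<le> N" using tN P by (auto simp: cap_def)
      then show "p = p'" using tN by simp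
    qed
    fix t assume t: "t \<in> fst ` (\<Union>j\<in>P. cap w {j})"
    then show "t \<in> cyl w" by (auto simp: cap_def)
  next
    fix t assume t: "t \<in> cyl w"
    have fin: "finite P" "P \<noteq> {}" using dom unfolding dominated_def by (auto intro: finite_subset)
    define N where "N = Max ((\<lambda>j. (t ! j) 0) ` P)"
    have "N \<in> (\<lambda>j. (t ! j) 0) ` P" unfolding N_def by (rule Max_in) (use fin in auto)
    then obtain j where j: "j \<in> P" "(t ! j) 0 = N" by auto
    have "(t ! i) 0 \<le> N" if "i < length w" for i
    proof -
      obtain j' where j': "j' \<in> P" "(t ! i) 0 \<le> (t ! j') 0" using dom t \<open>i < length w\<close> unfolding dominated_def by blast
      have "(t ! j') 0 \<le> N" unfolding N_def by (rule Max_ge) (use fin j' in auto)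
      with j'(2) show ?thesis by simp
    qed
    then have "(t, N) \<in> cap w {j}" using t j by (simp add: cap_def)
    then show "t \<in> fst ` (\<Union>j\<in>P. cap w {j})" using j(1) by force
  qed
  fix p assume p: "p \<in> (\<Union>j\<in>P. cap w {j})"
  then show "wt (replicate (length w) 1) (fst p) = cwt 0 p" by (auto simp: cap_def cwt_def cyl_def)
qed

lemma phi_rotate1: "phi (rotate1 w) m = phi w m"
  unfolding phi_def
proof (rule gf_bij[symmetric])
  let ?f = "\<lambda>(t, N). (rotate1 t, N :: nat)"
  have im: "rotate1 ` cyl w = cyl (rotate1 w)" and inj: "inj_on rotate1 (cyl w)"
    using rotate1_bij[of w] by (auto simp: bij_betw_def)
  have c: "(rotate1 t, N) \<in> cap (rotate1 w) {} \<longleftrightarrow> (t, N) \<in> cap w {}" for t N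
  proof (cases "length t = length w")
    case True
    have "(\<forall>i<length w. (rotate1 t ! i) 0 \<le> N) \<longleftrightarrow> (\<forall>i<length w. (t ! (Suc i mod length w)) 0 \<le> N)"
      using True by (simp add: nth_rotate1)
    also have "\<dots> \<longleftrightarrow> (\<forall>i<length w. (t ! i) 0 \<le> N)" by (rule all_less_Suc_mod)
    finally show ?thesis by (simp add: cap_def rotate1_cyl)
  qed (simp add: cap_def cyl_def)
  show "bij_betw ?f (cap w {}) (cap (rotate1 w) {})"
    unfolding bij_betw_def
  proof (intro conjI equalityI subsetI)
    show "inj_on ?f (cap w {})" using inj by (auto simp: inj_on_def cap_def)
    fix p assume "p \<in> ?f ` cap w {}"
    then show "p \<in> cap (rotate1 w) {}" using c by auto
  next
    fix p assume p: "p \<in> cap (rotate1 w) {}"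
    obtain t N where tN: "p = (t, N)" by (cases p)
    have "t \<in> cyl (rotate1 w)" using p tN by (simp add: cap_def)
    then obtain t' where t': "t = rotate1 t'" using im by blast
    then have "(t', N) \<in> cap w {}" using p tN c by simp
    then show "p \<in> ?f ` cap w {}" using tN t' by force
  qed
  fix p assume "p \<in> cap w {}"
  then obtain t N where tN: "p = (t, N)" by (cases p)
  have "wt (rotate1 (replicate (length t) 1)) (rotate1 t) = wt (replicate (length t) 1) t"
    by (rule wt_rotate1) simp
  moreover have "rotate1 (replicate n x) = replicate n x" for n and x :: int
    by (cases n) (simp_all add: replicate_append_same)
  ultimately show "cwt m (?f p) = cwt m p" by (simp add: tN cwt_def)
qed

text \<open>A positive cap already costs \<open>m\<close>, and cap 0 forces every partition to
  vanish.\<close>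

lemma phi_cong_1: "q ^ m dvd phi w m - 1"
  unfolding phi_def
proof (rule gf_cong_1)
  let ?z = "replicate (length w) (\<lambda>_. 0 :: nat)"
  have z: "fin_supp (\<lambda>_. 0)" by (simp add: fin_supp_def)
  have "Suc i mod length w < length w" if "i < length w" for i
    using that by (intro mod_less_divisor) linarith
  then show "(?z, 0) \<in> cap w {}" by (auto simp: cap_def cyl_def edge_def interlaces_def z)
  show "cwt m (?z, 0) = 0" by (simp add: cwt_def wt_ones psum_def)
  fix p assume p: "p \<in> cap w {}" "p \<noteq> (?z, 0)"
  obtain t N where tN: "p = (t, N)" by (cases p)
  have t: "t \<in> cyl w" "length t = length w" "\<forall>i<length w. (t ! i) 0 \<le> N" using p tN by (auto simp: cap_def cyl_def)
  have "N \<noteq> 0"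
  proof
    assume N: "N = 0"
    have "t ! i = (\<lambda>_. 0)" if i: "i < length w" for i
    proof
      fix k
      have "edge (w ! i) (t ! i) (t ! (Suc i mod length w))" using t(1) i by (simp add: cyl_def)
      then have "(t ! i) k \<le> (t ! i) 0" using lift_Suc_antimono_le[of "t ! i" 0 k] edge_antimono(1) by blast
      then show "(t ! i) k = 0" using t(3) i N by simp
    qed
    then have "t = ?z" using t(2) by (intro nth_equalityI) auto
    then show False using p(2) tN N by simp
  qed
  then have "m \<le> m * N" by simp
  moreover have "0 \<le> wt (replicate (length t) 1) t" unfolding wt_ones by (rule of_nat_0_le_iff)
  ultimately show "int m \<le> cwt m p" unfolding tN cwt_def prod.case by linarith
qed

lemma cap_Int: "cap w J \<inter> cap w J' = cap w (J \<union> J')"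
  by (auto simp: cap_def)

lemma remove_one: "peak w i \<Longrightarrow> gf (cwt m) (cap w {i}) = phi (flip i w) (m + 1)"
  using remove_gf[of w i "{i}" m] by (simp add: phi_def)

lemma remove_two:
  assumes "peak w i" "peak (flip i w) j" "i \<noteq> j"
  shows "gf (cwt m) (cap w {i, j}) = phi (flip j (flip i w)) (m + 2)"
proof -
  have "{i, j} - {i} = {j}" using assms(3) by auto
  then show ?thesis using remove_gf[OF assms(1), of "{i, j}" m] remove_one[OF assms(2), of "m + 1"] by (simp add: eval_nat_numeral)
qed

lemma remove_three:
  assumes "peak w i" "peak (flip i w) j" "peak (flip j (flip i w)) k" "i \<noteq> j" "i \<noteq> k" "j \<noteq> k"
  shows "gf (cwt m) (cap w {i, j, k}) = phi (flip k (flip j (flip i w))) (m + 3)"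
proof -
  have "{i, j, k} - {i} = {j, k}" using assms(4,5) by auto
  then show ?thesis using remove_gf[OF assms(1), of "{i, j, k}" m] remove_two[OF assms(2,3,6), of "m + 1"]
    by (simp add: eval_nat_numeral)
qed

text \<open>Attaining the cap at both peaks is the intersection of the two sets. There the peaks are
  removed one after the other, and each removal raises \<open>m\<close> by 1.\<close>

lemma attained_two:
  assumes "peak w i" "peak w j" "peak (flip i w) j" "i \<noteq> j"
  shows "gf (cwt m) (\<Union>l\<in>{i, j}. cap w {l}) = phi (flip i w) (m + 1) + phi (flip j w) (m + 1) - phi (flip j (flip i w)) (m + 2)"
proof -
  have gr: "graded (cwt m) (cap w {i})" "graded (cwt m) (cap w {j})"
    by (rule graded_cap, use assms in \<open>simp add: peak_def\<close>)+
  have "(\<Union>l\<in>{i, j}. cap w {l}) = cap w {i} \<union> cap w {j}" by simp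
  moreover have "cap w {i} \<inter> cap w {j} = cap w {i, j}" by (simp add: cap_Int insert_commute)
  ultimately show ?thesis
    using gf_Un[OF gr] remove_one[OF assms(1)] remove_one[OF assms(2)] remove_two[OF assms(1,3,4)] by simp
qed

lemma attained_three:
  assumes "peak w i" "peak w j" "peak w k" "peak (flip i w) j" "peak (flip i w) k" "peak (flip j w) k"
    "peak (flip j (flip i w)) k" "i \<noteq> j" "i \<noteq> k" "j \<noteq> k"
  shows "gf (cwt m) (\<Union>l\<in>{i, j, k}. cap w {l}) = phi (flip i w) (m + 1) + phi (flip j w) (m + 1) + phi (flip k w) (m + 1)
    - phi (flip j (flip i w)) (m + 2) - phi (flip k (flip i w)) (m + 2) - phi (flip k (flip j w)) (m + 2)
    + phi (flip k (flip j (flip i w))) (m + 3)"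
proof -
  have gr: "graded (cwt m) (cap w (insert i J))" "graded (cwt m) (cap w (insert j J))" "graded (cwt m) (cap w (insert k J))" for J
    by (rule graded_cap, use assms in \<open>auto simp: peak_def\<close>)+
  have un: "(\<Union>l\<in>{i, j, k}. cap w {l}) = cap w {i} \<union> (cap w {j} \<union> cap w {k})" by simp
  have "cap w {i} \<inter> (cap w {j} \<union> cap w {k}) = cap w {i, j} \<union> cap w {i, k}"
    by (simp add: Int_Un_distrib cap_Int insert_commute)
  moreover have "cap w {i, j} \<inter> cap w {i, k} = cap w {i, j, k}" by (simp add: cap_Int insert_commute)
  moreover have "cap w {j} \<inter> cap w {k} = cap w {j, k}" by (simp add: cap_Int insert_commute)
  ultimately have "gf (cwt m) (\<Union>l\<in>{i, j, k}. cap w {l}) = gf (cwt m) (cap w {i}) + (gf (cwt m) (cap w {j}) + gf (cwt m) (cap w {k})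
      - gf (cwt m) (cap w {j, k})) - (gf (cwt m) (cap w {i, j}) + gf (cwt m) (cap w {i, k}) - gf (cwt m) (cap w {i, j, k}))"
    unfolding un using gf_Un[OF gr(1) graded_Un[OF gr(2,3)], of "{}" "{}" "{}"] gf_Un[OF gr(2,3), of "{}" "{}"]
      gf_Un[OF gr(1,1), of "{j}" "{k}"] by simp
  then show ?thesis
    using remove_one[OF assms(1)] remove_one[OF assms(2)] remove_one[OF assms(3)]
      remove_two[OF assms(1,4,8)] remove_two[OF assms(1,5,9)] remove_two[OF assms(2,6,10)]
      remove_three[OF assms(1,4,7,8,9,10)] by simp
qed

text \<open>The digits of the profile names count the letters \<open>True\<close> before each
  \<open>False\<close>. Up to rotation these three words and \<open>zigzag\<close> are all words
  with three letters of each kind, so the recursion closes on them.\<close>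

definition profile_300 :: "bool list" where "profile_300 = [True, True, True, False, False, False]"
definition profile_210 :: "bool list" where "profile_210 = [True, True, False, True, False, False]"
definition profile_201 :: "bool list" where "profile_201 = [True, True, False, False, True, False]"

lemma dominatedI:
  assumes "length w = 6" "P \<noteq> {}" "P \<subseteq> {..<6}"
    and "\<And>x :: nat \<Rightarrow> nat. (\<forall>i<6. if w ! i then x i \<le> x (Suc i mod 6) else x (Suc i mod 6) \<le> x i) \<Longrightarrow> \<forall>i<6. \<exists>j\<in>P. x i \<le> x j"
  shows "dominated w P"
proof -
  have "\<forall>i<6. \<exists>j\<in>P. (t ! i) 0 \<le> (t ! j) 0" if t: "t \<in> cyl w" for t
  proof (rule assms(4)[of "\<lambda>i. (t ! i) 0"], intro allI impI)
    fix i assume "i < (6::nat)"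
    then have "edge (w ! i) (t ! i) (t ! (Suc i mod 6))" using t assms(1) by (simp add: cyl_def)
    then show "if w ! i then (t ! i) 0 \<le> (t ! (Suc i mod 6)) 0 else (t ! (Suc i mod 6)) 0 \<le> (t ! i) 0"
      by (cases "w ! i") (auto simp: edge_def interlaces_def)
  qed
  then show ?thesis using assms(1-3) by (simp add: dominated_def)
qed

lemma dominated_words: "dominated profile_300 {3}" "dominated profile_210 {2, 4}" "dominated profile_201 {2, 5}" "dominated zigzag {1, 3, 5}"
proof -
  have n: "Suc (Suc 0) = 2" "Suc 2 = 3" "Suc 3 = 4" "Suc 4 = 5" "Suc 5 = 6" by simp_all
  note sm = all6 n profile_300_def profile_210_def profile_201_def zigzag_def
  show "dominated profile_300 {3}" by (rule dominatedI) (simp add: profile_300_def, simp, simp, simp add: sm, linarith?)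
  show "dominated profile_210 {2, 4}" by (rule dominatedI) (simp add: profile_210_def, simp, simp, simp add: sm, linarith?)
  show "dominated profile_201 {2, 5}" by (rule dominatedI) (simp add: profile_201_def, simp, simp, simp add: sm, linarith?)
  show "dominated zigzag {1, 3, 5}" by (rule dominatedI) (simp add: zigzag_def, simp, simp, simp add: sm, linarith?)
qed

lemma phi_rotate: "phi ((rotate1 ^^ n) w) m = phi w m"
  by (induction n) (simp_all add: phi_rotate1)

lemma single_peak_attained: "gf (cwt m) (\<Union>j\<in>{3}. cap profile_300 {j}) = phi profile_210 (m + 1)"
proof -
  have "peak profile_300 3" "flip 3 profile_300 = profile_210"
    by (simp_all add: peak_def flip_def profile_300_def profile_210_def list_update_numeral)
  then show ?thesis using remove_one[of profile_300 3 m] by simp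
qed

text \<open>By the symmetry of the alternating word, flips of equally many peaks give rotations of
  one word: \<open>profile_210\<close> for one peak, \<open>profile_201\<close> for two,
  \<open>zigzag\<close> itself for all three.\<close>

lemma zigzag_attained:
  "gf (cwt m) (\<Union>j\<in>{1, 3, 5}. cap zigzag {j}) = 3 * phi profile_210 (m + 1) - 3 * phi profile_201 (m + 2) + phi zigzag (m + 3)"
proof -
  let ?w1 = "[False, True, True, False, True, False]" and ?w3 = "[True, False, False, True, True, False]"
    and ?w5 = "[True, False, True, False, False, True]" and ?w13 = "[False, True, False, True, True, False]"
    and ?w15 = "[False, True, True, False, False, True]" and ?w35 = "[True, False, False, True, False, True]"
    and ?w135 = "[False, True, False, True, False, True]"
  have f: "flip 1 zigzag = ?w1" "flip 3 zigzag = ?w3" "flip 5 zigzag = ?w5" "flip 3 ?w1 = ?w13" "flip 5 ?w1 = ?w15"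
    "flip 5 ?w3 = ?w35" "flip 5 ?w13 = ?w135"
    by (simp_all add: flip_def zigzag_def list_update_numeral)
  have p: "peak zigzag 1" "peak zigzag 3" "peak zigzag 5" "peak ?w1 3" "peak ?w1 5" "peak ?w3 5" "peak ?w13 5"
    by (simp_all add: peak_def zigzag_def)
  have r: "(rotate1 ^^ 5) profile_210 = ?w1" "(rotate1 ^^ 3) profile_210 = ?w3" "(rotate1 ^^ 1) profile_210 = ?w5" "(rotate1 ^^ 3) profile_201 = ?w13"
    "(rotate1 ^^ 5) profile_201 = ?w15" "(rotate1 ^^ 1) profile_201 = ?w35" "(rotate1 ^^ 1) zigzag = ?w135"
    by (simp_all add: profile_210_def profile_201_def zigzag_def eval_nat_numeral)
  have "gf (cwt m) (\<Union>j\<in>{1, 3, 5}. cap zigzag {j}) = phi ?w1 (m + 1) + phi ?w3 (m + 1) + phi ?w5 (m + 1)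
    - phi ?w13 (m + 2) - phi ?w15 (m + 2) - phi ?w35 (m + 2) + phi ?w135 (m + 3)"
    using attained_three[of zigzag 1 3 5 m, unfolded f, OF p] by simp
  then show ?thesis unfolding r[symmetric] phi_rotate by simp
qed

lemma phi_recurrences:
  assumes "1 \<le> m"
  shows "(1 - q ^ m) * phi profile_300 m = phi profile_210 (m + 1)"
    and "(1 - q ^ m) * phi profile_210 m = 2 * phi profile_201 (m + 1) - phi zigzag (m + 2)"
    and "(1 - q ^ m) * phi profile_201 m = phi zigzag (m + 1) + phi profile_300 (m + 1) - phi profile_210 (m + 2)"
    and "(1 - q ^ m) * phi zigzag m = 3 * phi profile_210 (m + 1) - 3 * phi profile_201 (m + 2) + phi zigzag (m + 3)"
proof -
  show "(1 - q ^ m) * phi profile_300 m = phi profile_210 (m + 1)"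
    using phi_attained[OF assms dominated_words(1)] unfolding single_peak_attained .
  show "(1 - q ^ m) * phi zigzag m = 3 * phi profile_210 (m + 1) - 3 * phi profile_201 (m + 2) + phi zigzag (m + 3)"
    using phi_attained[OF assms dominated_words(4)] unfolding zigzag_attained .
  let ?d2 = "[True, False, True, True, False, False]" and ?e5 = "[True, True, False, False, False, True]"
    and ?e25 = "[True, False, True, False, False, True]"
  have f: "flip 2 profile_210 = ?d2" "flip 4 profile_210 = profile_201" "flip 4 ?d2 = zigzag" "flip 2 profile_201 = zigzag" "flip 5 profile_201 = ?e5" "flip 5 zigzag = ?e25"
    by (simp_all add: flip_def profile_210_def profile_201_def zigzag_def list_update_numeral)
  have p: "peak profile_210 2" "peak profile_210 4" "peak ?d2 4" "peak profile_201 2" "peak profile_201 5" "peak zigzag 5"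
    by (simp_all add: peak_def profile_210_def profile_201_def zigzag_def)
  have r: "(rotate1 ^^ 4) profile_201 = ?d2" "(rotate1 ^^ 1) profile_300 = ?e5" "(rotate1 ^^ 1) profile_210 = ?e25"
    by (simp_all add: profile_210_def profile_201_def profile_300_def eval_nat_numeral)
  have "gf (cwt m) (\<Union>j\<in>{2, 4}. cap profile_210 {j}) = phi ?d2 (m + 1) + phi profile_201 (m + 1) - phi zigzag (m + 2)"
    using attained_two[of profile_210 2 4 m, unfolded f, OF p(1-3)] by simp
  then show "(1 - q ^ m) * phi profile_210 m = 2 * phi profile_201 (m + 1) - phi zigzag (m + 2)"
    using phi_attained[OF assms dominated_words(2)] unfolding r[symmetric] phi_rotate by simp
  have "gf (cwt m) (\<Union>j\<in>{2, 5}. cap profile_201 {j}) = phi zigzag (m + 1) + phi ?e5 (m + 1) - phi ?e25 (m + 2)"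
    using attained_two[of profile_201 2 5 m, unfolded f, OF p(4-6)] by simp
  then show "(1 - q ^ m) * phi profile_201 m = phi zigzag (m + 1) + phi profile_300 (m + 1) - phi profile_210 (m + 2)"
    using phi_attained[OF assms dominated_words(3)] unfolding r[symmetric] phi_rotate by simp
qed

section \<open>A two-variable family\<close>

text \<open>
  \<open>SS i j\<close> and \<open>KK i j\<close> are the values at $x = q^{3i}$, $y = q^{3j}$ of series $S(x,y)$ and $K(x,y)$
  defined by a linear system with the shift $(x,y) \mapsto (xq^3,yq^6)$. Here \<open>x\<close> marks
  single parts of members of \<open>R\<close>, and \<open>y\<close> marks the pairs $(3k,\underline{3k}_c)$ and one of the
  two kinds of pairs $(3k+2,3k+1)$; \<open>K\<close> is the series for the lists that can be put on top of
  such a pair $(3k,\underline{3k}_c)$.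
\<close>

definition stepK :: "nat \<Rightarrow> nat \<Rightarrow> rat fps \<Rightarrow> rat fps \<Rightarrow> rat fps \<Rightarrow> rat fps" where
  "stepK i j s k l = (let x = q ^ (3 * i); y = q ^ (3 * j) in
     s + (2 * x * q^3 + y * q^6) * k + 3 * x\<^sup>2 * q^8 * l)"

text \<open>At $y = x^2$ the coefficients are weights of blocks. \<open>3 * x^2 * q^8\<close> in
  \<open>stepK\<close> counts the colourings of $3k+3$ followed by $3k+5$. Here
  \<open>3 * x^2 * q^4\<close> counts those of the pair $(3k+3,3k+1)$, and
  \<open>4 * x^3 * q^9\<close> those of this pair followed by $3k+5$. The negative term removes the
  forbidden quadruple of (D3), two pairs in consecutive blocks.\<close>

definition stepS :: "nat \<Rightarrow> nat \<Rightarrow> rat fps \<Rightarrow> rat fps \<Rightarrow> rat fps \<Rightarrow> rat fps" where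
  "stepS i j s k l = (let x = q ^ (3 * i); y = q ^ (3 * j) in
     stepK i j s k l + (2 * x * q + 2 * x * q\<^sup>2 + x\<^sup>2 * q^3 + y * q^3) * s
       + 3 * x\<^sup>2 * q^4 * k + (4 * x^3 * q^9 - x\<^sup>2 * y * q^12) * l)"

text \<open>Approximations of the system by \<open>n\<close> unfoldings from the value 1. The third
  component carries \<open>S\<close> at the shifted point \<open>(i + 1, j + 2)\<close>, which turns
  a recursion of second order in the shift into one of first order.\<close>

fun SKL :: "nat \<Rightarrow> nat \<Rightarrow> nat \<Rightarrow> rat fps \<times> rat fps \<times> rat fps" where
  "SKL 0 i j = (1, 1, 1)"
| "SKL (Suc n) i j = (case SKL n (i + 1) (j + 2) of (s, k, l) \<Rightarrow> (stepS i j s k l, stepK i j s k l, s))"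

definition SS :: "nat \<Rightarrow> nat \<Rightarrow> rat fps" where
  "SS i j = flim (\<lambda>n. fst (SKL n i j))"

definition KK :: "nat \<Rightarrow> nat \<Rightarrow> rat fps" where
  "KK i j = flim (\<lambda>n. fst (snd (SKL n i j)))"

lemma step_dvd:
  assumes "d dvd s - s'" "d dvd k - k'" "d dvd l - l'"
  shows "d dvd stepS i j s k l - stepS i j s' k' l'" "d dvd stepK i j s k l - stepK i j s' k' l'"
proof -
  obtain u v w where "s = s' + d * u" "k = k' + d * v" "l = l' + d * w"
    using assms unfolding dvd_def by (metis add_diff_cancel_left' diff_add_cancel add.commute)
  then show "d dvd stepS i j s k l - stepS i j s' k' l'" "d dvd stepK i j s k l - stepK i j s' k' l'"
    unfolding stepS_def stepK_def Let_def by (simp_all add: algebra_simps)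
qed

lemma step_1: "q ^ min i j dvd stepS i j 1 1 1 - 1" "q ^ min i j dvd stepK i j 1 1 1 - 1"
proof -
  have "q ^ min i j dvd q ^ (3 * i)" "q ^ min i j dvd q ^ (3 * j)"
    by (rule le_imp_power_dvd; simp)+
  then obtain u v where "q ^ (3 * i) = q ^ min i j * u" "q ^ (3 * j) = q ^ min i j * v"
    unfolding dvd_def by blast
  moreover define d where "d = q ^ min i j"
  ultimately have eq: "q ^ (3 * i) = d * u" "q ^ (3 * j) = d * v" by auto
  have "d dvd stepS i j 1 1 1 - 1" "d dvd stepK i j 1 1 1 - 1"
    unfolding stepS_def stepK_def Let_def eq
    by (simp_all add: power_mult_distrib power2_eq_square power3_eq_cube algebra_simps)
  then show "q ^ min i j dvd stepS i j 1 1 1 - 1" "q ^ min i j dvd stepK i j 1 1 1 - 1"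
    unfolding d_def .
qed

text \<open>One more unfolding expresses the differences at \<open>(i, j)\<close> linearly by those
  at \<open>(i + 1, j + 2)\<close>, where \<open>min\<close> is larger by at least 1. At
  \<open>n = 0\<close> every correction carries a factor $x$ or $y$.\<close>

lemma SKL_cong:
  "q ^ (min i j + n) dvd fst (SKL (Suc n) i j) - fst (SKL n i j) \<and>
   q ^ (min i j + n) dvd fst (snd (SKL (Suc n) i j)) - fst (snd (SKL n i j)) \<and>
   q ^ (min i j + n) dvd snd (snd (SKL (Suc n) i j)) - snd (snd (SKL n i j))"
proof (induction n arbitrary: i j)
  case 0
  then show ?case using step_1[of i j] by simp
next
  case (Suc n)
  obtain s k l where 1: "SKL n (i + 1) (j + 2) = (s, k, l)" by (metis prod_cases3)
  obtain s' k' l' where 2: "SKL (Suc n) (i + 1) (j + 2) = (s', k', l')" by (metis prod_cases3)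
  have *: "q ^ (min i j + Suc n) dvd q ^ (min (i + 1) (j + 2) + n)" by (rule le_imp_power_dvd) simp
  then have "q ^ (min i j + Suc n) dvd s' - s" "q ^ (min i j + Suc n) dvd k' - k" "q ^ (min i j + Suc n) dvd l' - l"
    using Suc.IH[of "i + 1" "j + 2"] dvd_trans[OF *] unfolding 1 2 by auto
  then have "q ^ (min i j + Suc n) dvd s' - s \<and> q ^ (min i j + Suc n) dvd stepS i j s' k' l' - stepS i j s k l
     \<and> q ^ (min i j + Suc n) dvd stepK i j s' k' l' - stepK i j s k l"
    using step_dvd by blast
  then show ?case unfolding SKL.simps(2)[of "Suc n" i j] SKL.simps(2)[of n i j] 1 2 by simp
qed

lemma dvd_powerD: "q ^ (m + n) dvd f \<Longrightarrow> q ^ n dvd f"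
  by (metis power_add dvd_mult_right)

lemma SS_cong: "q ^ n dvd SS i j - fst (SKL n i j)"
  unfolding SS_def by (rule flim_cong) (use SKL_cong dvd_powerD in blast)

lemma KK_cong: "q ^ n dvd KK i j - fst (snd (SKL n i j))"
  unfolding KK_def by (rule flim_cong) (use SKL_cong dvd_powerD in blast)

lemma SS_rec: "SS i j = stepS i j (SS (i + 1) (j + 2)) (KK (i + 1) (j + 2)) (SS (i + 2) (j + 4))"
  and KK_rec: "KK i j = stepK i j (SS (i + 1) (j + 2)) (KK (i + 1) (j + 2)) (SS (i + 2) (j + 4))"
proof -
  have *: "q ^ n dvd SS i j - stepS i j (SS (i + 1) (j + 2)) (KK (i + 1) (j + 2)) (SS (i + 2) (j + 4)) \<and>
     q ^ n dvd KK i j - stepK i j (SS (i + 1) (j + 2)) (KK (i + 1) (j + 2)) (SS (i + 2) (j + 4))" for n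
  proof -
    obtain s k l where 1: "SKL (Suc n) (i + 1) (j + 2) = (s, k, l)" by (metis prod_cases3)
    have d: "q ^ n dvd q ^ Suc n" "q ^ n dvd q ^ Suc (Suc n)" by (rule le_imp_power_dvd; simp)+
    have l: "l = fst (SKL n (i + 2) (j + 4))"
      using 1 by (auto simp: eval_nat_numeral split: prod.splits)
    have "q ^ n dvd s - SS (i + 1) (j + 2)" "q ^ n dvd k - KK (i + 1) (j + 2)" "q ^ n dvd l - SS (i + 2) (j + 4)"
      using SS_cong[of "Suc n" "i + 1" "j + 2"] KK_cong[of "Suc n" "i + 1" "j + 2"] SS_cong[of n "i + 2" "j + 4"]
        dvd_trans[OF d(1)] unfolding l 1 by (auto simp: dvd_diff_commute)
    note st = step_dvd[OF this, of i j]
    have "fst (SKL (Suc (Suc n)) i j) = stepS i j s k l" "fst (snd (SKL (Suc (Suc n)) i j)) = stepK i j s k l"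
      unfolding SKL.simps(2)[of "Suc n" i j] 1 by simp_all
    then have "q ^ n dvd SS i j - stepS i j s k l" "q ^ n dvd KK i j - stepK i j s k l"
      using SS_cong[of "Suc (Suc n)" i j] KK_cong[of "Suc (Suc n)" i j] dvd_trans[OF d(2)] by simp_all
    then show ?thesis using st dvd_diff_trans by blast
  qed
  show "SS i j = stepS i j (SS (i + 1) (j + 2)) (KK (i + 1) (j + 2)) (SS (i + 2) (j + 4))"
    "KK i j = stepK i j (SS (i + 1) (j + 2)) (KK (i + 1) (j + 2)) (SS (i + 2) (j + 4))"
    by (rule fps_eqI_dvd; use * in blast)+
qed

lemma SKL_1: "q ^ min i j dvd fst (SKL n i j) - 1 \<and> q ^ min i j dvd fst (snd (SKL n i j)) - 1"
proof (induction n)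
  case (Suc n)
  then show ?case using SKL_cong[of i j n] dvd_diff_trans
    by (meson power_add dvd_mult_left dvd_trans le_imp_power_dvd le_add1)
qed simp

lemma SS_1: "q ^ min i j dvd SS i j - 1" and KK_1: "q ^ min i j dvd KK i j - 1"
  using SKL_1[of i j "min i j"] SS_cong[of "min i j" i j] KK_cong[of "min i j" i j] dvd_diff_trans by blast+

lemma q_shift: "q ^ (3 * (i + 1)) = q ^ (3 * i) * q^3" "q ^ (3 * (i + 2)) = q ^ (3 * i) * q^6"
  "q ^ (3 * (i + 3)) = q ^ (3 * i) * q^9" "q ^ (3 * (i + 4)) = q ^ (3 * i) * q^12" "q ^ (3 * (i + 5)) = q ^ (3 * i) * q^15"
  by (simp_all add: power_add algebra_simps flip: power_mult)

text \<open>Every use of the equations raises \<open>min i j\<close> by at least 1, so the initial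
  divisibility improves without bound. Divisibility of \<open>k\<close> comes first, as the equation
  for \<open>e\<close> involves \<open>k\<close> at the same point.\<close>

lemma coupled_zero:
  fixes e :: "nat \<Rightarrow> nat \<Rightarrow> rat fps"
  assumes base: "\<And>i j. q ^ min i j dvd e i j" "\<And>i j. q ^ min i j dvd k i j"
  assumes "\<And>i j. \<exists>a b c d. k i j = a * e (i + 1) (j + 2) + b * k (i + 1) (j + 2) + c * e (i + 2) (j + 4)"
  assumes "\<And>i j. \<exists>a b c d. e i j = d * k i j + a * e (i + 1) (j + 2) + b * k (i + 1) (j + 2) + c * e (i + 2) (j + 4)"
  shows "e i j = 0" "k i j = 0"
proof -
  have *: "q ^ (min i j + n) dvd e i j \<and> q ^ (min i j + n) dvd k i j" for n i j
  proof (induction n arbitrary: i j)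
    case (Suc n)
    have l: "q ^ (min i j + Suc n) dvd q ^ (min (i + 1) (j + 2) + n)" "q ^ (min i j + Suc n) dvd q ^ (min (i + 2) (j + 4) + n)"
      by (rule le_imp_power_dvd; arith)+
    have d: "q ^ (min i j + Suc n) dvd e (i + 1) (j + 2)" "q ^ (min i j + Suc n) dvd k (i + 1) (j + 2)"
      "q ^ (min i j + Suc n) dvd e (i + 2) (j + 4)"
      using Suc.IH dvd_trans[OF l(1)] dvd_trans[OF l(2)] by blast+
    obtain a b c where 1: "k i j = a * e (i + 1) (j + 2) + b * k (i + 1) (j + 2) + c * e (i + 2) (j + 4)"
      using assms(3) by blast
    have k: "q ^ (min i j + Suc n) dvd k i j" unfolding 1 by (intro dvd_add dvd_mult d)
    obtain a b c d' where 2: "e i j = d' * k i j + a * e (i + 1) (j + 2) + b * k (i + 1) (j + 2) + c * e (i + 2) (j + 4)"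
      using assms(4) by blast
    have "q ^ (min i j + Suc n) dvd e i j" unfolding 2 by (intro dvd_add dvd_mult d k)
    with k show ?case by blast
  qed (simp add: base)
  show "e i j = 0" "k i j = 0"
    by (rule fps_eqI_dvd, unfold diff_0_right, rule dvd_powerD, rule *[THEN conjunct1] *[THEN conjunct2])+
qed

section \<open>Shifting y alone\<close>

lemma diff_cong_1: "(d :: rat fps) dvd a - 1 \<Longrightarrow> d dvd b - 1 \<Longrightarrow> d dvd a - b"
  using dvd_diff[of d "a - 1" "b - 1"] by simp

text \<open>Suffix \<open>T\<close> stands for the shift of \<open>(i, j)\<close> by
  \<open>(1, 2)\<close>, suffix \<open>U\<close> for the shift by \<open>(0, 1)\<close>, which
  multiplies \<open>y\<close> by \<open>q^3\<close>. After the defects are collected, the remainder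
  is \<open>y * q^9\<close> times the equation for \<open>KT\<close>.\<close>

lemma K_discrepancy:
  fixes q x y :: "'a::idom"
  assumes "K = ST + (2 * x * q^3 + y * q^6) * KT + 3 * x\<^sup>2 * q^8 * STT"
    "KU = STU + (2 * x * q^3 + y * q^9) * KTU + 3 * x\<^sup>2 * q^8 * STTU"
    "KT = STT + (2 * x * q^6 + y * q^12) * KTT + 3 * x\<^sup>2 * q^14 * STTT"
  shows "K - KU - y * q^6 * KT = (ST - STU - y * q^9 * STT) + (2 * x * q^3 + y * q^9) * (KT - KTU - y * q^12 * KTT)
    + 3 * x\<^sup>2 * q^8 * (STT - STTU - y * q^15 * STTT)"
proof -
  have "K - KU - y * q^6 * KT - ((ST - STU - y * q^9 * STT) + (2 * x * q^3 + y * q^9) * (KT - KTU - y * q^12 * KTT)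
    + 3 * x\<^sup>2 * q^8 * (STT - STTU - y * q^15 * STTT))
    = y * q^9 * (STT + (2 * x * q^6 + y * q^12) * KTT + 3 * x\<^sup>2 * q^14 * STTT - KT)"
    unfolding assms(1,2) by algebra
  then show ?thesis using assms(3) by simp
qed

text \<open>The remainder is now \<open>y * q^6\<close> times the equation for \<open>ST\<close>.
  The coefficient \<open>x^2 * q^3\<close> alone scales with the wrong power of \<open>q\<close>
  under the shift; the term \<open>- x^2 * y * q^12\<close> compensates for exactly this.\<close>

lemma S_discrepancy:
  fixes q x y :: "'a::idom"
  assumes "S = K + (2 * x * q + 2 * x * q\<^sup>2 + x\<^sup>2 * q^3 + y * q^3) * ST
       + 3 * x\<^sup>2 * q^4 * KT + (4 * x^3 * q^9 - x\<^sup>2 * y * q^12) * STT"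
    "SU = KU + (2 * x * q + 2 * x * q\<^sup>2 + x\<^sup>2 * q^3 + y * q^6) * STU
       + 3 * x\<^sup>2 * q^4 * KTU + (4 * x^3 * q^9 - x\<^sup>2 * y * q^15) * STTU"
    "ST = KT + (2 * x * q^4 + 2 * x * q^5 + x\<^sup>2 * q^9 + y * q^9) * STT
       + 3 * x\<^sup>2 * q^10 * KTT + (4 * x^3 * q^18 - x\<^sup>2 * y * q^24) * STTT"
  shows "S - SU - y * q^3 * ST = (K - KU - y * q^6 * KT)
    + (2 * x * q + 2 * x * q\<^sup>2 + x\<^sup>2 * q^3 + y * q^6) * (ST - STU - y * q^9 * STT)
    + 3 * x\<^sup>2 * q^4 * (KT - KTU - y * q^12 * KTT) + (4 * x^3 * q^9 - x\<^sup>2 * y * q^15) * (STT - STTU - y * q^15 * STTT)"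
proof -
  have "S - SU - y * q^3 * ST - ((K - KU - y * q^6 * KT)
    + (2 * x * q + 2 * x * q\<^sup>2 + x\<^sup>2 * q^3 + y * q^6) * (ST - STU - y * q^9 * STT)
    + 3 * x\<^sup>2 * q^4 * (KT - KTU - y * q^12 * KTT) + (4 * x^3 * q^9 - x\<^sup>2 * y * q^15) * (STT - STTU - y * q^15 * STTT))
   = y * q^6 * (KT + (2 * x * q^4 + 2 * x * q^5 + x\<^sup>2 * q^9 + y * q^9) * STT
       + 3 * x\<^sup>2 * q^10 * KTT + (4 * x^3 * q^18 - x\<^sup>2 * y * q^24) * STTT - ST)"
    unfolding assms(1,2) by algebra
  then show ?thesis using assms(3) by simp
qed

lemma discrepancy:
  defines "e \<equiv> \<lambda>i j. SS i j - SS i (j + 1) - q ^ (3 * j) * q^3 * SS (i + 1) (j + 2)"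
  defines "k \<equiv> \<lambda>i j. KK i j - KK i (j + 1) - q ^ (3 * j) * q^6 * KK (i + 1) (j + 2)"
  shows "k i j = e (i + 1) (j + 2) + (2 * q ^ (3 * i) * q^3 + q ^ (3 * j) * q^9) * k (i + 1) (j + 2)
    + 3 * (q ^ (3 * i))\<^sup>2 * q^8 * e (i + 2) (j + 4)" (is ?K)
    and "\<exists>a b c. e i j = k i j + a * e (i + 1) (j + 2) + b * k (i + 1) (j + 2) + c * e (i + 2) (j + 4)" (is ?S)
proof -
  define x y where "x = q ^ (3 * i)" and "y = q ^ (3 * j)"
  have idx: "i + 1 + 1 = i + 2" "j + 2 + 2 = j + 4" "i + 1 + 2 = i + 3" "j + 2 + 4 = j + 6" "j + 1 + 2 = j + 3"
    "j + 1 + 4 = j + 5" "j + 2 + 1 = j + 3" "j + 4 + 1 = j + 5" "i + 2 + 1 = i + 3" "j + 4 + 2 = j + 6"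
    by simp_all
  note nf = stepK_def stepS_def Let_def q_shift idx x_def[symmetric] y_def[symmetric]
  have K: "KK i j = SS (i+1) (j+2) + (2 * x * q^3 + y * q^6) * KK (i+1) (j+2) + 3 * x\<^sup>2 * q^8 * SS (i+2) (j+4)"
    by (subst KK_rec) (simp only: nf)
  have KU: "KK i (j+1) = SS (i+1) (j+3) + (2 * x * q^3 + y * q^9) * KK (i+1) (j+3) + 3 * x\<^sup>2 * q^8 * SS (i+2) (j+5)"
    by (subst KK_rec, simp only: nf, algebra)
  have KT: "KK (i+1) (j+2) = SS (i+2) (j+4) + (2 * x * q^6 + y * q^12) * KK (i+2) (j+4) + 3 * x\<^sup>2 * q^14 * SS (i+3) (j+6)"
    by (subst KK_rec, simp only: nf, algebra)
  have S: "SS i j = KK i j + (2 * x * q + 2 * x * q\<^sup>2 + x\<^sup>2 * q^3 + y * q^3) * SS (i+1) (j+2)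
       + 3 * x\<^sup>2 * q^4 * KK (i+1) (j+2) + (4 * x^3 * q^9 - x\<^sup>2 * y * q^12) * SS (i+2) (j+4)"
    by (subst SS_rec, subst KK_rec) (simp only: nf)
  have SU: "SS i (j+1) = KK i (j+1) + (2 * x * q + 2 * x * q\<^sup>2 + x\<^sup>2 * q^3 + y * q^6) * SS (i+1) (j+3)
       + 3 * x\<^sup>2 * q^4 * KK (i+1) (j+3) + (4 * x^3 * q^9 - x\<^sup>2 * y * q^15) * SS (i+2) (j+5)"
    by (subst SS_rec, subst KK_rec, simp only: nf, algebra)
  have ST: "SS (i+1) (j+2) = KK (i+1) (j+2) + (2 * x * q^4 + 2 * x * q^5 + x\<^sup>2 * q^9 + y * q^9) * SS (i+2) (j+4)
       + 3 * x\<^sup>2 * q^10 * KK (i+2) (j+4) + (4 * x^3 * q^18 - x\<^sup>2 * y * q^24) * SS (i+3) (j+6)"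
    by (subst SS_rec, subst KK_rec, simp only: nf, algebra)
  have y3: "y * q^6 * q^3 = y * q^9" "y * q^6 * q^6 = y * q^12" "y * q^12 * q^3 = y * q^15" by algebra+
  show ?K unfolding e_def k_def q_shift idx x_def[symmetric] y_def[symmetric] y3
    by (rule K_discrepancy[OF K KU KT])
  show ?S unfolding e_def k_def q_shift idx x_def[symmetric] y_def[symmetric] y3
    using S_discrepancy[OF S SU ST] by blast
qed

text \<open>
  The defects of these two identities satisfy the homogeneous version of the defining system,
  which has no solution tending to 0 except 0.
\<close>

lemma SS_shift: "SS i j = SS i (j + 1) + q ^ (3 * j) * q^3 * SS (i + 1) (j + 2)"
  and KK_shift: "KK i j = KK i (j + 1) + q ^ (3 * j) * q^6 * KK (i + 1) (j + 2)"
proof -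
  define e where "e = (\<lambda>i j. SS i j - SS i (j + 1) - q ^ (3 * j) * q^3 * SS (i + 1) (j + 2))"
  define k where "k = (\<lambda>i j. KK i j - KK i (j + 1) - q ^ (3 * j) * q^6 * KK (i + 1) (j + 2))"
  have d: "q ^ min i j dvd q ^ min i (j + 1)" "q ^ min i j dvd q ^ (3 * j)" for i j
    by (rule le_imp_power_dvd; simp)+
  have "q ^ min i j dvd e i j" "q ^ min i j dvd k i j" for i j
    unfolding e_def k_def
    by (rule dvd_diff[OF diff_cong_1[OF SS_1 dvd_trans[OF d(1) SS_1]] dvd_mult2[OF dvd_mult2[OF d(2)]]],
        rule dvd_diff[OF diff_cong_1[OF KK_1 dvd_trans[OF d(1) KK_1]] dvd_mult2[OF dvd_mult2[OF d(2)]]])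
  moreover have "\<exists>a b c d. k i j = a * e (i + 1) (j + 2) + b * k (i + 1) (j + 2) + c * e (i + 2) (j + 4)" for i j
    by (intro exI[of _ 1] exI) (unfold mult_1, unfold e_def k_def, rule discrepancy(1))
  moreover have "\<exists>a b c d. e i j = d * k i j + a * e (i + 1) (j + 2) + b * k (i + 1) (j + 2) + c * e (i + 2) (j + 4)" for i j
  proof -
    from discrepancy(2)[of i j] obtain a b c where
      "e i j = k i j + a * e (i + 1) (j + 2) + b * k (i + 1) (j + 2) + c * e (i + 2) (j + 4)"
      unfolding e_def k_def by blast
    then have "e i j = 1 * k i j + a * e (i + 1) (j + 2) + b * k (i + 1) (j + 2) + c * e (i + 2) (j + 4)" by simp
    then show ?thesis by blast
  qed
  ultimately have "e i j = 0" "k i j = 0" by (rule coupled_zero[of e k])+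
  then show "SS i j = SS i (j + 1) + q ^ (3 * j) * q^3 * SS (i + 1) (j + 2)"
    "KK i j = KK i (j + 1) + q ^ (3 * j) * q^6 * KK (i + 1) (j + 2)"
    by (simp_all add: e_def k_def algebra_simps)
qed

lemma geometric_zero:
  fixes f :: "nat \<Rightarrow> nat \<Rightarrow> rat fps"
  assumes "\<And>i j. f i j = q ^ m j * f (i + 1) (j + 2)" "\<And>j. m j > 0"
  shows "f i j = 0"
proof -
  have "q ^ n dvd f i j" for n i j
  proof (induction n arbitrary: i j)
    case (Suc n)
    have "q ^ 1 dvd q ^ m j" using assms(2)[of j] by (intro le_imp_power_dvd) simp
    then have "q ^ 1 * q ^ n dvd q ^ m j * f (i + 1) (j + 2)" using Suc mult_dvd_mono by blast
    then show ?case using assms(1)[of i j] by simp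
  qed simp
  then show ?thesis by (intro fps_eqI_dvd) simp
qed

text \<open>\<open>S1\<close>, \<open>K1\<close> are values at \<open>(i + 1, j + 1)\<close>,
  \<open>S2\<close>, \<open>K2\<close> at \<open>(i + 2, j + 3)\<close>, and \<open>S3\<close> at
  \<open>(i + 3, j + 5)\<close>. The defect of the new form reproduces itself at the shifted point
  with a factor divisible by \<open>q\<close>.\<close>

lemma KK_alt_step:
  fixes q x y :: "'a::idom"
  assumes "K = ST + (2 * x * q^3 + y * q^6) * KT + 3 * x\<^sup>2 * q^8 * STT"
    "S1 = ST + y * q^6 * S2" "K1 = KT + y * q^9 * K2" "S2 = STT + y * q^12 * S3"
  shows "K - (S1 + 2 * x * q^3 * K1 + 3 * x\<^sup>2 * q^8 * S2)
    = y * q^6 * (KT - (S2 + 2 * x * q^6 * K2 + 3 * x\<^sup>2 * q^14 * S3))"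
proof -
  have "STT = S2 - y * q^12 * S3" using assms(4) by simp
  then show ?thesis unfolding assms(1-3) by algebra
qed

lemma SS_alt_step:
  fixes q x y :: "'a::idom"
  assumes "S = K + (2 * x * q + 2 * x * q\<^sup>2 + x\<^sup>2 * q^3 + y * q^3) * ST
       + 3 * x\<^sup>2 * q^4 * KT + (4 * x^3 * q^9 - x\<^sup>2 * y * q^12) * STT"
    "S1 = ST + y * q^6 * S2" "K1 = KT + y * q^9 * K2" "S2 = STT + y * q^12 * S3"
  shows "S - (K + y * q^3 * K1 + (2 * x * q + 2 * x * q\<^sup>2) * S1 + x\<^sup>2 * q^3 * ST + 3 * x\<^sup>2 * q^4 * K1 + 4 * x^3 * q^9 * S2)
    = y * q^3 * (ST - (KT + y * q^9 * K2 + (2 * x * q^4 + 2 * x * q^5) * S2 + x\<^sup>2 * q^9 * STT + 3 * x\<^sup>2 * q^10 * K2 + 4 * x^3 * q^18 * S3))"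
  unfolding assms(1-4) by algebra

text \<open>This form prepares the restriction to \<open>j = i\<close>: the original shift
  \<open>(1, 2)\<close> leaves the diagonal, whereas \<open>(1, 1)\<close> stays on it, and the
  remaining values off the diagonal lie only one step beside it.\<close>

lemma KK_alt: "KK i j = SS (i + 1) (j + 1) + 2 * q ^ (3 * i) * q^3 * KK (i + 1) (j + 1)
    + 3 * (q ^ (3 * i))\<^sup>2 * q^8 * SS (i + 2) (j + 3)" (is ?K)
  and SS_alt: "SS i j = KK i j + q ^ (3 * j) * q^3 * KK (i + 1) (j + 1)
    + (2 * q ^ (3 * i) * q + 2 * q ^ (3 * i) * q\<^sup>2) * SS (i + 1) (j + 1)
    + (q ^ (3 * i))\<^sup>2 * q^3 * SS (i + 1) (j + 2) + 3 * (q ^ (3 * i))\<^sup>2 * q^4 * KK (i + 1) (j + 1)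
    + 4 * (q ^ (3 * i))^3 * q^9 * SS (i + 2) (j + 3)" (is ?S)
proof -
  define f where "f = (\<lambda>i j. KK i j - (SS (i + 1) (j + 1) + 2 * q ^ (3 * i) * q^3 * KK (i + 1) (j + 1)
    + 3 * (q ^ (3 * i))\<^sup>2 * q^8 * SS (i + 2) (j + 3)))"
  define g where "g = (\<lambda>i j. SS i j - (KK i j + q ^ (3 * j) * q^3 * KK (i + 1) (j + 1)
    + (2 * q ^ (3 * i) * q + 2 * q ^ (3 * i) * q\<^sup>2) * SS (i + 1) (j + 1)
    + (q ^ (3 * i))\<^sup>2 * q^3 * SS (i + 1) (j + 2) + 3 * (q ^ (3 * i))\<^sup>2 * q^4 * KK (i + 1) (j + 1)
    + 4 * (q ^ (3 * i))^3 * q^9 * SS (i + 2) (j + 3)))"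
  have fg: "f i j = q ^ (3 * j + 6) * f (i + 1) (j + 2) \<and> g i j = q ^ (3 * j + 3) * g (i + 1) (j + 2)" for i j
  proof -
    define x y where "x = q ^ (3 * i)" and "y = q ^ (3 * j)"
    have idx: "i + 1 + 1 = i + 2" "j + 1 + 1 = j + 2" "j + 2 + 2 = j + 4" "i + 1 + 2 = i + 3" "j + 2 + 1 = j + 3" "j + 1 + 2 = j + 3"
      "j + 2 + 3 = j + 5" "i + 2 + 1 = i + 3" "j + 3 + 1 = j + 4" "j + 3 + 2 = j + 5"
      by simp_all
    note nf = stepK_def stepS_def Let_def q_shift idx x_def[symmetric] y_def[symmetric]
    have K: "KK i j = SS (i+1) (j+2) + (2 * x * q^3 + y * q^6) * KK (i+1) (j+2) + 3 * x\<^sup>2 * q^8 * SS (i+2) (j+4)"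
      by (subst KK_rec) (simp only: nf)
    have S: "SS i j = KK i j + (2 * x * q + 2 * x * q\<^sup>2 + x\<^sup>2 * q^3 + y * q^3) * SS (i+1) (j+2)
         + 3 * x\<^sup>2 * q^4 * KK (i+1) (j+2) + (4 * x^3 * q^9 - x\<^sup>2 * y * q^12) * SS (i+2) (j+4)"
      by (subst SS_rec, subst KK_rec) (simp only: nf)
    have S1: "SS (i+1) (j+1) = SS (i+1) (j+2) + y * q^6 * SS (i+2) (j+3)"
      by (subst SS_shift, simp only: nf, algebra)
    have K1: "KK (i+1) (j+1) = KK (i+1) (j+2) + y * q^9 * KK (i+2) (j+3)"
      by (subst KK_shift, simp only: nf, algebra)
    have S2: "SS (i+2) (j+3) = SS (i+2) (j+4) + y * q^12 * SS (i+3) (j+5)"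
      by (subst SS_shift, simp only: nf, algebra)
    have e: "q ^ (3 * j + 6) = y * q^6" "q ^ (3 * j + 3) = y * q^3" by (simp_all add: y_def power_add)
    have xs: "2 * (x * q ^ 3) * q ^ 3 = 2 * x * q^6" "3 * (x * q ^ 3)\<^sup>2 * q ^ 8 = 3 * x\<^sup>2 * q^14"
      "y * q ^ 6 * q ^ 3 = y * q^9" "2 * (x * q ^ 3) * q + 2 * (x * q ^ 3) * q\<^sup>2 = 2 * x * q^4 + 2 * x * q^5"
      "(x * q ^ 3)\<^sup>2 * q ^ 3 = x\<^sup>2 * q^9" "3 * (x * q ^ 3)\<^sup>2 * q ^ 4 = 3 * x\<^sup>2 * q^10"
      "4 * (x * q ^ 3)^3 * q ^ 9 = 4 * x^3 * q^18"
      by algebra+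
    show ?thesis unfolding f_def g_def q_shift idx x_def[symmetric] y_def[symmetric] e xs
      using KK_alt_step[OF K S1 K1 S2] SS_alt_step[OF S S1 K1 S2] by blast
  qed
  have "f i j = 0" by (rule geometric_zero[where m = "\<lambda>j. 3 * j + 6"]) (rule fg[THEN conjunct1], simp)
  then show ?K unfolding f_def by simp
  have "g i j = 0" by (rule geometric_zero[where m = "\<lambda>j. 3 * j + 3"]) (rule fg[THEN conjunct2], simp)
  then show ?S unfolding g_def by simp
qed

section \<open>Restriction to the diagonal\<close>

definition CC :: "nat \<Rightarrow> rat fps" where "CC i = SS i i"
text \<open>After \<open>SS (i + 1) (i + 2)\<close> is eliminated by \<open>SS_shift\<close>, the
  diagonal equations contain \<open>KK (i + 1) (i + 1)\<close> and \<open>SS (i + 2) (i + 3)\<close>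
  only in this combination, taken at \<open>i + 1\<close>.\<close>

definition DD :: "nat \<Rightarrow> rat fps" where "DD i = KK i i + q ^ (3 * i) * q\<^sup>2 * SS (i + 1) (i + 2)"

lemma diag_step:
  fixes q x :: "'a::idom"
  assumes K: "K = C1 + 2 * x * q^3 * K1 + 3 * x\<^sup>2 * q^8 * S2"
    and S: "C = K + x * q^3 * K1 + (2 * x * q + 2 * x * q\<^sup>2) * C1 + x\<^sup>2 * q^3 * ST + 3 * x\<^sup>2 * q^4 * K1 + 4 * x^3 * q^9 * S2"
    and ST: "C1 = ST + x * q^6 * S2"
  shows "C = (1 + 2 * x * q + 2 * x * q\<^sup>2 + x\<^sup>2 * q^3) * C1 + 3 * x * q^3 * (1 + x * q) * (K1 + x * q^5 * S2)"
    and "K + x * q\<^sup>2 * ST = (1 + x * q\<^sup>2) * C1 + 2 * x * q^3 * (K1 + x * q^5 * S2)"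
  unfolding S K ST by algebra+

lemma CC_rec: "CC i = (1 + 2 * q ^ (3 * i) * q + 2 * q ^ (3 * i) * q\<^sup>2 + (q ^ (3 * i))\<^sup>2 * q^3) * CC (i + 1)
      + 3 * q ^ (3 * i) * q^3 * (1 + q ^ (3 * i) * q) * DD (i + 1)"
  and DD_rec: "DD i = (1 + q ^ (3 * i) * q\<^sup>2) * CC (i + 1) + 2 * q ^ (3 * i) * q^3 * DD (i + 1)"
proof -
  have ST: "SS (i + 1) (i + 1) = SS (i + 1) (i + 2) + q ^ (3 * i) * q^6 * SS (i + 2) (i + 3)"
  proof -
    have idx: "i + 1 + 1 = i + 2" "i + 1 + 2 = i + 3" by simp_all
    show ?thesis by (subst SS_shift, simp only: idx q_shift, algebra)
  qed
  have D: "DD (i + 1) = KK (i + 1) (i + 1) + q ^ (3 * i) * q^5 * SS (i + 2) (i + 3)"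
    unfolding DD_def q_shift by (simp add: algebra_simps eval_nat_numeral)
  note st = diag_step[OF KK_alt[of i i] SS_alt[of i i] ST]
  show "CC i = (1 + 2 * q ^ (3 * i) * q + 2 * q ^ (3 * i) * q\<^sup>2 + (q ^ (3 * i))\<^sup>2 * q^3) * CC (i + 1)
      + 3 * q ^ (3 * i) * q^3 * (1 + q ^ (3 * i) * q) * DD (i + 1)"
    unfolding D using st(1) unfolding CC_def .
  show "DD i = (1 + q ^ (3 * i) * q\<^sup>2) * CC (i + 1) + 2 * q ^ (3 * i) * q^3 * DD (i + 1)"
    unfolding D using st(2) unfolding CC_def DD_def .
qed

lemma CC_1: "q ^ i dvd CC i - 1" and DD_1: "q ^ i dvd DD i - 1"
proof -
  show "q ^ i dvd CC i - 1" using SS_1[of i i] by (simp add: CC_def)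
  have "q ^ i dvd KK i i - 1" using KK_1[of i i] by simp
  moreover have "q ^ i dvd q ^ (3 * i) * q\<^sup>2 * SS (i + 1) (i + 2)"
    by (intro dvd_mult2 le_imp_power_dvd) simp
  ultimately have "q ^ i dvd (KK i i - 1) + q ^ (3 * i) * q\<^sup>2 * SS (i + 1) (i + 2)" by (rule dvd_add)
  then show "q ^ i dvd DD i - 1" unfolding DD_def by (simp add: algebra_simps)
qed

lemma diag_unique:
  assumes "\<And>i. C i = (1 + 2 * q ^ (3 * i) * q + 2 * q ^ (3 * i) * q\<^sup>2 + (q ^ (3 * i))\<^sup>2 * q^3) * C (i + 1)
      + 3 * q ^ (3 * i) * q^3 * (1 + q ^ (3 * i) * q) * D (i + 1)"
    and "\<And>i. D i = (1 + q ^ (3 * i) * q\<^sup>2) * C (i + 1) + 2 * q ^ (3 * i) * q^3 * D (i + 1)"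
    and "\<And>i. q ^ i dvd C i - 1" "\<And>i. q ^ i dvd D i - 1"
  shows "C i = CC i" "D i = DD i"
proof -
  have *: "q ^ (i + n) dvd C i - CC i \<and> q ^ (i + n) dvd D i - DD i" for n i
  proof (induction n arbitrary: i)
    case 0
    then show ?case using assms(3,4) CC_1 DD_1 by (simp add: diff_cong_1)
  next
    case (Suc n)
    have d: "q ^ (i + Suc n) dvd C (i + 1) - CC (i + 1)" "q ^ (i + Suc n) dvd D (i + 1) - DD (i + 1)"
      using Suc.IH[of "i + 1"] by simp_all
    have lin: "a * c + b * d - (a * c' + b * d') = a * (c - c') + b * (d - d')" for a b c d c' d' :: "rat fps"
      by (simp add: algebra_simps)
    show ?case
      unfolding assms(1)[of i] assms(2)[of i] CC_rec[of i] DD_rec[of i] lin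
      by (intro conjI dvd_add dvd_mult d)
  qed
  show "C i = CC i" "D i = DD i"
    by (rule fps_eqI_dvd, rule dvd_powerD, rule *[THEN conjunct1] *[THEN conjunct2])+
qed

section \<open>Block decomposition of the 2-colored partitions\<close>

definition valid :: "part list \<Rightarrow> bool" where
  "valid l \<longleftrightarrow> partition2 l \<and> D1 l \<and> D2 l \<and> D3 l"

definition forbidden :: "part \<Rightarrow> part list \<Rightarrow> bool" where
  "forbidden x l \<longleftrightarrow> (\<exists>a r. 3 dvd a \<and> 1 \<le> a \<and>
     (x # l = Ord a # Col a # Col (a - 2) # r \<or> x # l = Ord (a + 2) # Ord a # Col a # r \<or>
      x # l = Col (a + 2) # Ord (a + 1) # Ord (a - 1) # Col (a - 2) # r))"

text \<open>(D1)-(D3) relate a part to at most three parts below it, so lists can be tested while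
  parts are put on top one at a time.\<close>

definition good :: "part \<Rightarrow> part list \<Rightarrow> bool" where
  "good x l \<longleftrightarrow> 1 \<le> cont x \<and> \<not> forbidden x l \<and> (case l of [] \<Rightarrow> True | y # _ \<Rightarrow> y \<le> x \<and>
     (cont x \<le> cont y + 1 \<longrightarrow> 3 dvd cont x + cont y \<and> color x \<noteq> color y) \<and>
     (cont x = cont y + 2 \<and> \<not> 3 dvd cont x + cont y \<longrightarrow> (color x, color y) \<noteq> (MinusC, PlusC)))"

lemma all_nat_0_Suc: "(\<forall>a. P a) \<longleftrightarrow> P 0 \<and> (\<forall>a. P (Suc a))"
  using not0_implies_Suc by metis

lemma partition2_Cons: "partition2 (x # l) \<longleftrightarrow> partition2 l \<and> 1 \<le> cont x \<and> (case l of [] \<Rightarrow> True | y # _ \<Rightarrow> y \<le> x)"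
  by (cases l) (auto simp: partition2_def)

lemma D1_Cons: "D1 (x # l) \<longleftrightarrow> D1 l \<and> (case l of [] \<Rightarrow> True | y # _ \<Rightarrow>
    cont x \<le> cont y + 1 \<longrightarrow> 3 dvd cont x + cont y \<and> color x \<noteq> color y)"
  unfolding D1_def by (subst all_nat_0_Suc) (cases l; auto)

lemma D2_Cons: "D2 (x # l) \<longleftrightarrow> D2 l \<and> (case l of [] \<Rightarrow> True | y # _ \<Rightarrow>
    cont x = cont y + 2 \<and> \<not> 3 dvd cont x + cont y \<longrightarrow> (color x, color y) \<noteq> (MinusC, PlusC))"
proof -
  have "int (cont x) - int (cont y) = 2 \<longleftrightarrow> cont x = cont y + 2" for y by linarith
  then show ?thesis unfolding D2_def by (subst all_nat_0_Suc) (cases l; auto)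
qed

lemma D3_Cons: "D3 (x # l) \<longleftrightarrow> D3 l \<and> \<not> forbidden x l"
proof -
  have "forbidden x l \<longleftrightarrow> (\<exists>k\<ge>1. prefix [Ord (3*k), Col (3*k), Col (3*k - 2)] (x # l) \<or>
     prefix [Ord (3*k + 2), Ord (3*k), Col (3*k)] (x # l) \<or>
     prefix [Col (3*k + 2), Ord (3*k + 1), Ord (3*k - 1), Col (3*k - 2)] (x # l))"
    unfolding forbidden_def prefix_def append_Cons append_Nil
    by (auto simp only: dvd_def) (metis One_nat_def Suc_le_eq nat_0_less_mult_iff zero_less_numeral)+
  then show ?thesis unfolding D3_def sublist_Cons_right by blast
qed

lemma valid_Cons: "valid (x # l) \<longleftrightarrow> valid l \<and> good x l"
  unfolding valid_def good_def partition2_Cons D1_Cons D2_Cons D3_Cons by (cases l) auto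

lemma valid_Nil: "valid []"
  by (simp add: valid_def partition2_def D1_def D2_def D3_def)

lemma valid_appendD: "valid (l @ c) \<Longrightarrow> valid c"
  by (induction l) (auto simp: valid_Cons)

text \<open>Equal neighbours have content difference 0 and equal colours, which (D1)
  excludes.\<close>

lemma valid_sorted: "valid l \<Longrightarrow> sorted_wrt (>) l"
proof (induction l)
  case (Cons x l)
  then show ?case by (cases l) (auto simp: valid_Cons good_def order.order_iff_strict)
qed simp

lemma graded_psize: "graded (\<lambda>l. int (psize l)) {l. valid l}"
proof -
  have "finite {l. valid l \<and> psize l = n}" for n
  proof (rule finite_subset)
    let ?P = "Ord ` {..n} \<union> Col ` {..n}"
    show "finite {l. set l \<subseteq> ?P \<and> length l \<le> n}" by (rule finite_lists_length_le) simp
    show "{l. valid l \<and> psize l = n} \<subseteq> {l. set l \<subseteq> ?P \<and> length l \<le> n}"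
    proof safe
      fix l assume l: "valid l" "n = psize l"
      then have pos: "\<forall>x\<in>set l. 1 \<le> cont x" by (simp add: valid_def partition2_def)
      then show "length l \<le> psize l" unfolding psize_def by (induction l) auto
      fix x assume x: "x \<in> set l" "x \<notin> Col ` {..psize l}"
      have "cont x \<le> psize l" unfolding psize_def by (rule member_le_sum_list) (use x in auto)
      then show "x \<in> Ord ` {..psize l}" using x(2) by (cases x rule: part.exhaust) auto
    qed
  qed
  then have "finite {l. valid l \<and> int (psize l) = n}" for n
    by (rule finite_subset[rotated, of "{l. valid l \<and> psize l = nat n}"]) auto
  then show ?thesis by (auto simp: graded_def)
qed

section \<open>Adding parts from the smallest upwards\<close>

definition parts_above :: "part \<Rightarrow> part list \<Rightarrow> part list set" where
  "parts_above b c = {l. (\<forall>x\<in>set l. b \<le> x) \<and> valid (l @ c)}"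

definition gf_above :: "part \<Rightarrow> part list \<Rightarrow> rat fps" where
  "gf_above b c = gf (\<lambda>l. int (psize l)) (parts_above b c)"

lemma psize_append: "psize (l @ c) = psize l + psize c"
  by (simp add: psize_def)

lemma graded_parts_above: "graded (\<lambda>l. int (psize l)) (parts_above b c)"
proof -
  have fin: "finite {l. valid l \<and> psize l = m}" for m
    using graded_psize by (simp add: graded_def) (metis (mono_tags, lifting) Collect_cong of_nat_eq_iff)
  have "finite {l \<in> parts_above b c. int (psize l) = n}" for n
  proof (rule finite_imageD)
    show "inj_on (\<lambda>l. l @ c) {l \<in> parts_above b c. int (psize l) = n}" by (rule inj_onI) simp
    show "finite ((\<lambda>l. l @ c) ` {l \<in> parts_above b c. int (psize l) = n})"
      by (rule finite_subset[OF _ fin[of "nat n + psize c"]]) (auto simp: parts_above_def psize_append)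
  qed
  then show ?thesis by (simp add: graded_def)
qed

text \<open>By strictness \<open>b\<close> occurs at most once, and then directly above
  \<open>c\<close>; \<open>b'\<close> is the successor of \<open>b\<close> in the order.\<close>

lemma gf_above_step:
  assumes next_part: "\<And>x. b \<le> x \<longleftrightarrow> x = b \<or> b' \<le> x" and bb: "b < b'"
  shows "gf_above b c = gf_above b' c + (if good b c then q ^ cont b * gf_above b' (b # c) else 0)"
proof -
  have *: "parts_above b c = parts_above b' c \<union> (if good b c then (\<lambda>l. l @ [b]) ` parts_above b' (b # c) else {})"
  proof (intro equalityI subsetI)
    fix l assume l: "l \<in> parts_above b c"
    show "l \<in> parts_above b' c \<union> (if good b c then (\<lambda>l. l @ [b]) ` parts_above b' (b # c) else {})"
    proof (cases l rule: rev_cases)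
      case Nil
      with l show ?thesis by (simp add: parts_above_def)
    next
      case (snoc l' x)
      have v: "valid (l' @ x # c)" using l snoc by (simp add: parts_above_def)
      then have gt: "\<forall>y\<in>set l'. x < y" using valid_sorted[OF v] by (auto simp: sorted_wrt_append)
      have "b \<le> x" using l snoc by (simp add: parts_above_def)
      then consider "x = b" | "b' \<le> x" using next_part by blast
      then show ?thesis
      proof cases
        case 1
        then have "\<forall>y\<in>set l'. b' \<le> y" using gt next_part by (metis order.strict_iff_order)
        moreover have "good b c" using valid_appendD[OF v] 1 by (simp add: valid_Cons)
        ultimately show ?thesis using v snoc 1 by (auto simp: parts_above_def)
      next
        case 2
        then have "\<forall>y\<in>set l'. b' \<le> y" using gt by (meson order.strict_implies_order order.trans)
        then show ?thesis using 2 v snoc by (simp add: parts_above_def)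
      qed
    qed
  next
    fix l assume "l \<in> parts_above b' c \<union> (if good b c then (\<lambda>l. l @ [b]) ` parts_above b' (b # c) else {})"
    moreover have "b \<le> x" if "b' \<le> x" for x using that next_part by blast
    ultimately show "l \<in> parts_above b c" by (auto simp: parts_above_def split: if_splits)
  qed
  show ?thesis
  proof (cases "good b c")
    case False
    then show ?thesis using * by (simp add: gf_above_def)
  next
    case True
    let ?w = "\<lambda>l. int (psize l)"
    let ?I = "(\<lambda>l. l @ [b]) ` parts_above b' (b # c)"
    have un: "parts_above b c = parts_above b' c \<union> ?I" using * True by simp
    have "l @ [b] \<notin> parts_above b' c" for l
      using bb by (auto simp: parts_above_def)
    then have "parts_above b' c \<inter> ?I = {}" by blast
    moreover have "graded ?w (parts_above b' c)" "graded ?w ?I"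
      using graded_subset[OF graded_parts_above[of b c]] un by auto
    ultimately have "gf ?w (parts_above b c) = gf ?w (parts_above b' c) + gf ?w ?I"
      unfolding un by (rule gf_Un_disjoint[rotated 2])
    also have "gf ?w ?I = gf (\<lambda>l. ?w l + int (cont b)) (parts_above b' (b # c))"
      by (rule gf_bij[symmetric, where f = "\<lambda>l. l @ [b]"]) (auto simp: bij_betw_def inj_on_def psize_append psize_def)
    also have "\<dots> = q ^ cont b * gf ?w (parts_above b' (b # c))"
      by (rule gf_shift[OF graded_parts_above])
    finally show ?thesis using True by (simp add: gf_above_def)
  qed
qed

lemma le_Col: "Col k \<le> x \<longleftrightarrow> x = Col k \<or> Ord k \<le> x"
  and le_Ord: "Ord k \<le> x \<longleftrightarrow> x = Ord k \<or> Col (k + 1) \<le> x"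
  by (cases x; auto simp: less_eq_part_def less_part_def)+

lemma gf_above_Col: "gf_above (Col k) c = gf_above (Ord k) c + (if good (Col k) c then q ^ k * gf_above (Ord k) (Col k # c) else 0)"
  using gf_above_step[OF le_Col, of k c] by (simp add: less_part_def)

lemma gf_above_Ord: "gf_above (Ord k) c = gf_above (Col (k + 1)) c + (if good (Ord k) c then q ^ k * gf_above (Col (k + 1)) (Ord k # c) else 0)"
  using gf_above_step[OF le_Ord, of k c] by (simp add: less_part_def)

text \<open>
  The state of a partial partition whose parts are at most \<open>3 * k\<close>, read off its largest parts:
  it determines which parts exceeding \<open>3 * k\<close> may be added.
\<close>

definition state :: "nat \<Rightarrow> part list \<Rightarrow> nat" where
  "state k c = (case c of [] \<Rightarrow> 0 | x # r \<Rightarrow>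
     if x = Col (3 * k) then 1 else
     if x = Ord (3 * k) then (if r \<noteq> [] \<and> hd r = Col (3 * k) then 4 else 2) else
     if x = Ord (3 * k - 1) \<and> r \<noteq> [] \<and> hd r = Col (3 * k - 2) then 3 else 0)"

definition low :: "nat \<Rightarrow> part list \<Rightarrow> bool" where
  "low k c \<longleftrightarrow> (\<forall>x\<in>set c. 1 \<le> cont x \<and> cont x \<le> 3 * k)"

text \<open>The thirteen possible contents of a block, less those excluded from below. On top of a
  part $3k$, (D1) excludes both copies of $3k+1$; if that part is ordinary, (D2) excludes the
  coloured $3k+2$; if the coloured $3k$ stands below it as well, (D3) excludes the ordinary $3k+2$.
  State 3 loses only the upper half of the forbidden quadruple.\<close>

definition blocks :: "nat \<Rightarrow> nat \<Rightarrow> part list list" where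
  "blocks k s = (let e1 = 3 * k + 1; e2 = 3 * k + 2; e3 = 3 * k + 3 in
     [[], [Col e3], [Ord e3], [Ord e3, Col e3]] @
     (if s = 2 \<or> s = 4 then [] else [[Col e2]]) @
     (if s = 4 then [] else [[Ord e2]]) @
     (if s = 0 \<or> s = 3 then
        [[Col e1], [Col e3, Col e1], [Ord e3, Col e1], [Ord e2, Col e1], [Ord e1], [Ord e3, Ord e1]] else []) @
     (if s = 0 then [[Col e2, Ord e1]] else []))"

lemma state_cases:
  assumes "low k c"
  obtains "state k c = 0" "c = []"
    | y r where "state k c = 0" "c = y # r" "cont y < 3 * k"
        "\<not> (y = Ord (3 * k - 1) \<and> r \<noteq> [] \<and> hd r = Col (3 * k - 2))"
    | r where "state k c = 1" "c = Col (3 * k) # r" "1 \<le> k"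
    | r where "state k c = 2" "c = Ord (3 * k) # r" "r = [] \<or> hd r \<noteq> Col (3 * k)" "1 \<le> k"
    | r where "state k c = 3" "c = Ord (3 * k - 1) # Col (3 * k - 2) # r" "1 \<le> k"
    | r where "state k c = 4" "c = Ord (3 * k) # Col (3 * k) # r" "1 \<le> k"
proof (cases c)
  case Nil
  then show ?thesis using that(1) by (simp add: state_def)
next
  case (Cons y r)
  have y: "1 \<le> cont y" "cont y \<le> 3 * k" using assms Cons by (auto simp: low_def)
  then have k: "1 \<le> k" by linarith
  show ?thesis
  proof (cases "cont y = 3 * k")
    case True
    then consider "y = Col (3 * k)" | "y = Ord (3 * k)" by (cases y) auto
    then show ?thesis
    proof cases
      case 1 then show ?thesis using that(3)[of r] Cons k by (simp add: state_def)
    next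
      case 2 then show ?thesis using that(4)[of r] that(6)[of "tl r"] Cons k
        by (cases r) (auto simp: state_def split: if_splits)
    qed
  next
    case False
    then have "y \<noteq> Col (3 * k)" "y \<noteq> Ord (3 * k)" by auto
    then show ?thesis using that(2)[of y r] that(5)[of "tl r"] Cons y False k
      by (cases "y = Ord (3 * k - 1) \<and> r \<noteq> [] \<and> hd r = Col (3 * k - 2)")
        (auto simp: state_def neq_Nil_conv)
  qed
qed

lemma forbidden_simps:
  "\<not> forbidden (Col (3 * k + 1)) l" "\<not> forbidden (Ord (3 * k + 1)) l" "\<not> forbidden (Col (3 * k + 3)) l"
  "forbidden (Col (3 * k + 2)) l \<longleftrightarrow> 1 \<le> k \<and> (\<exists>r. l = Ord (3 * k + 1) # Ord (3 * k - 1) # Col (3 * k - 2) # r)"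
  "forbidden (Ord (3 * k + 2)) l \<longleftrightarrow> 1 \<le> k \<and> (\<exists>r. l = Ord (3 * k) # Col (3 * k) # r)"
  "forbidden (Ord (3 * k + 3)) l \<longleftrightarrow> (\<exists>r. l = Col (3 * k + 3) # Col (3 * k + 1) # r)"
proof -
  show "\<not> forbidden (Col (3 * k + 1)) l" "\<not> forbidden (Ord (3 * k + 1)) l" "\<not> forbidden (Col (3 * k + 3)) l"
    unfolding forbidden_def by (auto, presburger+)
  show "forbidden (Col (3 * k + 2)) l \<longleftrightarrow> 1 \<le> k \<and> (\<exists>r. l = Ord (3 * k + 1) # Ord (3 * k - 1) # Col (3 * k - 2) # r)"
    unfolding forbidden_def by (auto intro!: exI[of _ "3 * k"])
  show "forbidden (Ord (3 * k + 2)) l \<longleftrightarrow> 1 \<le> k \<and> (\<exists>r. l = Ord (3 * k) # Col (3 * k) # r)"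
    unfolding forbidden_def by (auto intro!: exI[of _ "3 * k"]; presburger)
  show "forbidden (Ord (3 * k + 3)) l \<longleftrightarrow> (\<exists>r. l = Col (3 * k + 3) # Col (3 * k + 1) # r)"
    unfolding forbidden_def by (auto intro!: exI[of _ "3 * k + 3"]; presburger)
qed

lemma good_inner:
  fixes k :: nat
  defines "e1 \<equiv> 3 * k + 1" and "e2 \<equiv> 3 * k + 2" and "e3 \<equiv> 3 * k + 3"
  shows "\<not> good (Ord e1) (Col e1 # c)" "\<not> good (Col e2) (Col e1 # c)" "good (Ord e2) (Col e1 # c)"
    "\<not> good (Ord e2) (Ord e1 # c)" "\<not> good (Ord e2) (Col e2 # c)"
    "good (Col e3) (Col e1 # c)" "\<not> good (Col e3) (Ord e1 # c)"
    "\<not> good (Col e3) (Col e2 # c)" "\<not> good (Col e3) (Ord e2 # c)"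
    "good (Ord e3) (Col e1 # c)" "good (Ord e3) (Ord e1 # c)"
    "\<not> good (Ord e3) (Col e2 # c)" "\<not> good (Ord e3) (Ord e2 # c)"
    "\<not> good (Ord e3) (Col e3 # Col e1 # c)"
  unfolding e1_def e2_def e3_def good_def
  by (simp_all add: less_eq_part_def less_part_def forbidden_simps[simplified], presburger+)

lemma good_outer:
  fixes k :: nat
  defines "e1 \<equiv> 3 * k + 1" and "e2 \<equiv> 3 * k + 2" and "e3 \<equiv> 3 * k + 3"
  assumes "low k c"
  shows "good (Col e1) c \<longleftrightarrow> state k c = 0 \<or> state k c = 3" (is ?g1)
    "good (Ord e1) c \<longleftrightarrow> state k c = 0 \<or> state k c = 3" (is ?g2)
    "good (Col e2) c \<longleftrightarrow> state k c \<noteq> 2 \<and> state k c \<noteq> 4" (is ?g3)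
    "good (Ord e2) c \<longleftrightarrow> state k c \<noteq> 4" (is ?g4)
    "good (Col e3) c" "good (Ord e3) c" "good (Ord e3) (Col e3 # c)" (is ?g7)
    "state k c = 0 \<or> state k c = 3 \<Longrightarrow> good (Col e2) (Ord e1 # c) \<longleftrightarrow> state k c = 0" (is "_ \<Longrightarrow> ?g8")
proof -
  have d: "\<not> 3 dvd Suc (6 * k)" "\<not> 3 dvd Suc (Suc (6 * k))" "3 dvd Suc (Suc (Suc (6 * k)))" "\<not> 3 dvd Suc (Suc (Suc (Suc (6 * k))))"
    "3 * k = Suc n \<Longrightarrow> 3 dvd Suc (Suc (n + n))" "3 * k = Suc n \<Longrightarrow> 3 dvd n + Suc (Suc n)" for n
    by presburger+
  consider "c = []" | y r where "c = y # r" "cont y \<le> 3 * k"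
    using assms(4) by (cases c) (auto simp: low_def)
  note hd = this
  note sm = good_def forbidden_simps[simplified] less_eq_part_def less_part_def d
  show ?g1 using assms(4)
    by (cases rule: state_cases) (auto simp: e1_def sm)
  show ?g2 using assms(4)
    by (cases rule: state_cases) (auto simp: e1_def sm)
  show ?g3 using assms(4)
    by (cases rule: state_cases) (auto simp: e2_def sm)
  show ?g4 using assms(4)
    by (cases rule: state_cases) (auto simp: e2_def sm neq_Nil_conv)
  show "good (Col e3) c" "good (Ord e3) c" "good (Ord e3) (Col e3 # c)"
    by (cases rule: hd; auto simp: e3_def sm)+
  show ?g8 if "state k c = 0 \<or> state k c = 3" using assms(4) that
    by (cases rule: state_cases) (auto simp: e1_def e2_def sm)
qed

lemma state_le_4: "state k c \<in> {0, 1, 2, 3, 4}"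
  by (auto simp: state_def split: list.splits)

text \<open>The new state forgets \<open>c\<close>: the parts that \<open>state (k + 1)\<close>
  looks for all exceed \<open>3 * k\<close>. This reduces the recursion to five series per
  block.\<close>

lemma blocks_valid:
  assumes "low k c" "valid c" "b \<in> set (blocks k (state k c))"
  shows "valid (b @ c)" "low (k + 1) (b @ c)" "state (k + 1) (b @ c) = state (k + 1) b"
proof -
  define e1 e2 e3 where "e1 = 3 * k + 1" and "e2 = 3 * k + 2" and "e3 = 3 * k + 3"
  note E = e1_def[symmetric] e2_def[symmetric] e3_def[symmetric]
  note gi = good_inner[of k, unfolded E] and go = good_outer[OF assms(1), unfolded E]
  note bl = blocks_def[of k, unfolded Let_def E]
  consider "state k c = 0" | "state k c = 1" | "state k c = 2" | "state k c = 3" | "state k c = 4"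
    using state_le_4[of k c] by auto
  then show "valid (b @ c)"
    by cases (use assms(3) in \<open>auto simp: bl valid_Cons gi go assms(2)\<close>)
  show "low (k + 1) (b @ c)"
    using assms(1,3) by (auto simp: blocks_def Let_def low_def split: if_splits)
  consider "c = []" | y r where "c = y # r" "cont y \<le> 3 * k"
    using assms(1) by (cases c) (auto simp: low_def)
  then show "state (k + 1) (b @ c) = state (k + 1) b"
    using assms(3) by cases (auto simp: blocks_def Let_def state_def split: if_splits)
qed

lemma gf_above_block:
  assumes "low k c"
  shows "gf_above (Col (3 * k + 1)) c = (\<Sum>b\<leftarrow>blocks k (state k c). q ^ psize b * gf_above (Col (3 * (k + 1) + 1)) (b @ c))"
proof -
  define e1 e2 e3 where "e1 = 3 * k + 1" and "e2 = 3 * k + 2" and "e3 = 3 * k + 3"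
  have e: "e1 + 1 = e2" "e2 + 1 = e3" "3 * (k + 1) + 1 = e3 + 1" by (auto simp: e1_def e2_def e3_def)
  note E = e1_def[symmetric] e2_def[symmetric] e3_def[symmetric]
  note gi = good_inner[of k, unfolded E] and go = good_outer[OF assms, unfolded E]
  have o1: "gf_above (Ord e1) c = gf_above (Col e2) c + (if good (Ord e1) c then q ^ e1 * gf_above (Col e2) (Ord e1 # c) else 0)" for c
    using gf_above_Ord[of e1 c] unfolding e .
  have o2: "gf_above (Ord e2) c = gf_above (Col e3) c + (if good (Ord e2) c then q ^ e2 * gf_above (Col e3) (Ord e2 # c) else 0)" for c
    using gf_above_Ord[of e2 c] unfolding e .
  note st = gf_above_Col[of e1] o1 gf_above_Col[of e2] o2 gf_above_Col[of e3] gf_above_Ord[of e3]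
  note bl = blocks_def[of k, unfolded Let_def E]
  consider "state k c = 0" | "state k c = 1" | "state k c = 2" | "state k c = 3" | "state k c = 4"
    using state_le_4[of k c] by auto
  then show ?thesis unfolding E e bl
    by cases (simp_all add: st gi go psize_def power_add algebra_simps)
qed

text \<open>Evaluated on \<open>j = 2 * k\<close>, that is $y = x^2$, a curve that the block shift
  preserves. State 4 has series \<open>K\<close>. States 2 and 1 allow in addition a single part
  $3k+2$, ordinary only or in both colours. State 3 lacks one block of weight
  \<open>x^2 * q^3\<close> compared with state 0. Each of these blocks leads to state 0, hence the
  factor \<open>S'\<close>.\<close>

definition state_series :: "nat \<Rightarrow> nat \<Rightarrow> rat fps" where
  "state_series k s = (let x = q ^ (3 * k); S = SS k (2 * k); S' = SS (k + 1) (2 * k + 2); K = KK k (2 * k) in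
     if s = 0 then S else if s = 1 then K + 2 * x * q\<^sup>2 * S' else if s = 2 then K + x * q\<^sup>2 * S'
     else if s = 3 then S - x\<^sup>2 * q^3 * S' else K)"

lemma state_series_block:
  assumes "s \<in> {0, 1, 2, 3, 4}"
  shows "state_series k s = (\<Sum>b\<leftarrow>blocks k s. q ^ psize b * state_series (k + 1) (state (k + 1) b))"
proof -
  define x where "x = q ^ (3 * k)"
  have y: "q ^ (3 * (2 * k)) = x\<^sup>2" unfolding x_def by (simp add: power2_eq_square flip: power_add)
  define S1 K1 S2 where "S1 = SS (k + 1) (2 * k + 2)" and "K1 = KK (k + 1) (2 * k + 2)" and "S2 = SS (k + 2) (2 * k + 4)"
  have K: "KK k (2 * k) = S1 + (2 * x * q^3 + x\<^sup>2 * q^6) * K1 + 3 * x\<^sup>2 * q^8 * S2"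
    by (subst KK_rec) (simp only: stepK_def Let_def x_def[symmetric] y S1_def K1_def S2_def)
  have S: "SS k (2 * k) = KK k (2 * k) + (2 * x * q + 2 * x * q\<^sup>2 + x\<^sup>2 * q^3 + x\<^sup>2 * q^3) * S1
       + 3 * x\<^sup>2 * q^4 * K1 + (4 * x^3 * q^9 - x\<^sup>2 * x\<^sup>2 * q^12) * S2"
    by (subst SS_rec, subst KK_rec) (simp only: stepS_def stepK_def Let_def x_def[symmetric] y S1_def K1_def S2_def)
  have h0: "state_series k 0 = SS k (2 * k)" and h1: "state_series k 1 = KK k (2 * k) + 2 * x * q\<^sup>2 * S1"
    and h2: "state_series k 2 = KK k (2 * k) + x * q\<^sup>2 * S1" and h3: "state_series k 3 = SS k (2 * k) - x\<^sup>2 * q^3 * S1"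
    and h4: "state_series k 4 = KK k (2 * k)"
    by (simp_all add: state_series_def Let_def x_def S1_def)
  have idx: "2 * (k + 1) = 2 * k + 2" "2 * k + 2 + 2 = 2 * k + 4" "k + 1 + 1 = k + 2" by simp_all
  have h': "state_series (k + 1) 0 = S1" "state_series (k + 1) 1 = K1 + 2 * x * q^5 * S2" "state_series (k + 1) 2 = K1 + x * q^5 * S2"
    "state_series (k + 1) 3 = S1 - x\<^sup>2 * q^9 * S2" "state_series (k + 1) 4 = K1"
    unfolding state_series_def Let_def q_shift idx S1_def[symmetric] K1_def[symmetric] S2_def[symmetric] x_def[symmetric]
    by (simp_all, algebra+)
  define e1 e2 e3 where "e1 = 3 * k + 1" and "e2 = 3 * k + 2" and "e3 = 3 * k + 3"
  have st: "state (k + 1) [] = 0" "state (k + 1) [Col e3] = 1" "state (k + 1) [Ord e3] = 2" "state (k + 1) [Ord e3, Col e3] = 4"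
    "state (k + 1) [Col e2] = 0" "state (k + 1) [Ord e2] = 0" "state (k + 1) [Col e1] = 0" "state (k + 1) [Col e3, Col e1] = 1"
    "state (k + 1) [Ord e3, Col e1] = 2" "state (k + 1) [Ord e2, Col e1] = 3" "state (k + 1) [Ord e1] = 0"
    "state (k + 1) [Ord e3, Ord e1] = 2" "state (k + 1) [Col e2, Ord e1] = 0"
    by (auto simp: state_def e1_def e2_def e3_def)
  have p: "q ^ psize [] = 1" "q ^ psize [Col e3] = x * q^3" "q ^ psize [Ord e3] = x * q^3" "q ^ psize [Ord e3, Col e3] = x\<^sup>2 * q^6"
    "q ^ psize [Col e2] = x * q\<^sup>2" "q ^ psize [Ord e2] = x * q\<^sup>2" "q ^ psize [Col e1] = x * q" "q ^ psize [Col e3, Col e1] = x\<^sup>2 * q^4"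
    "q ^ psize [Ord e3, Col e1] = x\<^sup>2 * q^4" "q ^ psize [Ord e2, Col e1] = x\<^sup>2 * q^3" "q ^ psize [Ord e1] = x * q"
    "q ^ psize [Ord e3, Ord e1] = x\<^sup>2 * q^4" "q ^ psize [Col e2, Ord e1] = x\<^sup>2 * q^3"
    by (simp_all add: psize_def x_def e1_def e2_def e3_def power_add power2_eq_square eval_nat_numeral algebra_simps)
  note bl = blocks_def[of k, unfolded Let_def e1_def[symmetric] e2_def[symmetric] e3_def[symmetric]]
  have b: "blocks k 0 = [[], [Col e3], [Ord e3], [Ord e3, Col e3], [Col e2], [Ord e2], [Col e1], [Col e3, Col e1],
      [Ord e3, Col e1], [Ord e2, Col e1], [Ord e1], [Ord e3, Ord e1], [Col e2, Ord e1]]"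
    "blocks k 1 = [[], [Col e3], [Ord e3], [Ord e3, Col e3], [Col e2], [Ord e2]]"
    "blocks k 2 = [[], [Col e3], [Ord e3], [Ord e3, Col e3], [Ord e2]]"
    "blocks k 3 = [[], [Col e3], [Ord e3], [Ord e3, Col e3], [Col e2], [Ord e2], [Col e1], [Col e3, Col e1],
      [Ord e3, Col e1], [Ord e2, Col e1], [Ord e1], [Ord e3, Ord e1]]"
    "blocks k 4 = [[], [Col e3], [Ord e3], [Ord e3, Col e3]]"
    by (simp_all add: bl)
  note ex = b list.map sum_list.Cons sum_list.Nil p st h'
  consider "s = 0" | "s = 1" | "s = 2" | "s = 3" | "s = 4" using assms by auto
  then show ?thesis
  proof cases
    case 1 show ?thesis unfolding 1 by (simp only: ex h0 S K, algebra)
  next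
    case 2 show ?thesis unfolding 2 by (simp only: ex h1 S K, algebra)
  next
    case 3 show ?thesis unfolding 3 by (simp only: ex h2 S K, algebra)
  next
    case 4 show ?thesis unfolding 4 by (simp only: ex h3 S K, algebra)
  next
    case 5 show ?thesis unfolding 5 by (simp only: ex h4 S K, algebra)
  qed
qed

lemma gf_above_cong_1:
  assumes "valid c"
  shows "q ^ k dvd gf_above (Col (3 * k + 1)) c - 1"
  unfolding gf_above_def
proof (rule gf_cong_1)
  show "[] \<in> parts_above (Col (3 * k + 1)) c" using assms by (simp add: parts_above_def)
  show "int (psize []) = 0" by (simp add: psize_def)
  fix l assume "l \<in> parts_above (Col (3 * k + 1)) c" "l \<noteq> []"
  then obtain x l' where "l = x # l'" "Col (3 * k + 1) \<le> x" by (cases l) (auto simp: parts_above_def)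
  then show "int k \<le> int (psize l)" by (cases x) (auto simp: psize_def less_eq_part_def less_part_def)
qed

lemma state_series_cong_1: "q ^ k dvd state_series k s - 1"
proof -
  have d: "q ^ k dvd q ^ (3 * k)" "q ^ k dvd (q ^ (3 * k))\<^sup>2" by (simp_all add: le_imp_power_dvd flip: power_mult)
  have S: "q ^ k dvd SS k (2 * k) - 1" and K: "q ^ k dvd KK k (2 * k) - 1"
    using SS_1[of k "2 * k"] KK_1[of k "2 * k"] by simp_all
  have r: "d dvd (a + b) - 1" if "d dvd a - 1" "d dvd b" for d a b :: "rat fps"
    using dvd_add[OF that] by (simp add: algebra_simps)
  have r': "d dvd (a - b) - 1" if "d dvd a - 1" "d dvd b" for d a b :: "rat fps"
    using dvd_diff[OF that] by (simp add: algebra_simps)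
  have e: "q ^ k dvd 2 * q ^ (3 * k) * f * g" "q ^ k dvd q ^ (3 * k) * f * g" "q ^ k dvd (q ^ (3 * k))\<^sup>2 * f * g" for f g
    by (intro dvd_mult2 dvd_mult d)+
  show ?thesis unfolding state_series_def Let_def using S K r[OF K e(1)] r[OF K e(2)] r'[OF S e(3)] by simp
qed

lemma dvd_sum_list_diff:
  fixes d :: "'a::comm_ring_1"
  assumes "\<And>x. x \<in> set xs \<Longrightarrow> d dvd f x - g x"
  shows "d dvd (\<Sum>x\<leftarrow>xs. w x * f x) - (\<Sum>x\<leftarrow>xs. w x * g x)"
  using assms
proof (induction xs)
  case (Cons x xs)
  have "d dvd w x * (f x - g x) + ((\<Sum>x\<leftarrow>xs. w x * f x) - (\<Sum>x\<leftarrow>xs. w x * g x))"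
    using Cons by (intro dvd_add dvd_mult) auto
  then show ?case by (simp add: algebra_simps)
qed simp

text \<open>Both sides satisfy the same block recursion and are 1 modulo \<open>q ^ k\<close>, so
  each block gains one power of \<open>q\<close>.\<close>

lemma gf_above_state_series:
  assumes "low k c" "valid c"
  shows "gf_above (Col (3 * k + 1)) c = state_series k (state k c)"
proof -
  have *: "q ^ (k + n) dvd gf_above (Col (3 * k + 1)) c - state_series k (state k c)" if "low k c" "valid c" for n k c
    using that
  proof (induction n arbitrary: k c)
    case 0
    show ?case using diff_cong_1[OF gf_above_cong_1[OF 0(2)] state_series_cong_1] by simp
  next
    case (Suc n)
    show ?case
    proof (subst gf_above_block[OF Suc(2)], subst state_series_block[OF state_le_4], rule dvd_sum_list_diff)
      fix b assume "b \<in> set (blocks k (state k c))"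
      note v = blocks_valid[OF Suc(2,3) this]
      show "q ^ (k + Suc n) dvd gf_above (Col (3 * (k + 1) + 1)) (b @ c) - state_series (k + 1) (state (k + 1) b)"
        using Suc.IH[OF v(2,1)] unfolding v(3) by simp
    qed
  qed
  show ?thesis by (rule fps_eqI_dvd, rule dvd_powerD, rule *[OF assms])
qed

lemma R_valid: "R = {l. valid l}"
  by (simp add: R_def valid_def)

lemma gf_R: "gf (\<lambda>l. int (psize l)) R = SS 0 0"
proof -
  have "Col 1 \<le> x" if "1 \<le> cont x" for x
    using that by (cases x) (auto simp: less_eq_part_def less_part_def)
  then have "parts_above (Col 1) [] = R"
    by (auto simp: parts_above_def R_valid valid_def partition2_def)
  then show ?thesis using gf_above_state_series[of 0 "[]"] by (simp add: low_def valid_Nil gf_above_def state_series_def state_def)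
qed

text \<open>(D4) makes the ordinary 2 the smallest possible part. What remains of the first block is
  the list for state 2 at \<open>k = 0\<close>, as if an ordinary part 0 stood at the
  bottom.\<close>

lemma gf_R': "gf (\<lambda>l. int (psize l)) R' = KK 0 0 + q\<^sup>2 * SS 1 2"
proof -
  have o: "Ord 2 \<le> x \<longleftrightarrow> 1 \<le> cont x \<and> x \<noteq> Ord 1 \<and> x \<noteq> Col 1 \<and> x \<noteq> Col 2" for x
    by (cases x) (auto simp: less_eq_part_def less_part_def)
  have "D4 l \<longleftrightarrow> (\<forall>x\<in>set l. Ord 2 \<le> x)" if "valid l" for l
    using that by (auto simp: D4_def o valid_def partition2_def)
  then have "R' = parts_above (Ord 2) []"
    unfolding R'_def parts_above_def valid_def by auto
  then have "gf (\<lambda>l. int (psize l)) R' = gf_above (Ord 2) []" by (simp add: gf_above_def)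
  also have "\<dots> = (\<Sum>b\<leftarrow>blocks 0 2. q ^ psize b * gf_above (Col 4) b)"
  proof -
    have g: "good (Ord 2) []" "good (Col 3) []" "good (Ord 3) []" "good (Ord 3) [Col 3]"
      "\<not> good (Col 3) [Ord 2]" "\<not> good (Ord 3) [Ord 2]"
      using good_outer[of 0 "[]"] good_inner[of 0 "[]"] by (simp_all add: low_def state_def numeral_2_eq_2 numeral_3_eq_3)
    have n: "(2::nat) + 1 = 3" "(3::nat) + 1 = 4" by simp_all
    have bl: "blocks 0 2 = [[], [Col 3], [Ord 3], [Ord 3, Col 3], [Ord 2]]"
      by (simp add: blocks_def numeral_2_eq_2)
    have p: "psize [] = 0" "psize [Col 3] = 3" "psize [Ord 3] = 3" "psize [Ord 3, Col 3] = 6" "psize [Ord 2] = 2"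
      by (simp_all add: psize_def)
    show ?thesis
      unfolding gf_above_Ord[of 2, unfolded n] gf_above_Col[of 3] gf_above_Ord[of 3, unfolded n]
      by (simp only: g if_True if_False bl p list.map sum_list.Cons sum_list.Nil, algebra)
  qed
  also have "\<dots> = (\<Sum>b\<leftarrow>blocks 0 2. q ^ psize b * state_series 1 (state 1 b))"
  proof -
    have "gf_above (Col 4) b = state_series 1 (state 1 b)" if "b \<in> set (blocks 0 2)" for b
    proof -
      have "b \<in> set (blocks 0 (state 0 []))" using that by (auto simp: blocks_def state_def)
      note v = blocks_valid[OF _ valid_Nil this, unfolded append_Nil2]
      show ?thesis using gf_above_state_series[of 1 b] v by (simp add: low_def)
    qed
    then show ?thesis by (simp cong: map_cong)
  qed
  also have "\<dots> = state_series 0 2" using state_series_block[of 2 0] by simp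
  also have "\<dots> = KK 0 0 + q\<^sup>2 * SS 1 2" by (simp add: state_series_def numeral_2_eq_2)
  finally show ?thesis .
qed

section \<open>Comparison\<close>

lemma eprod_multisection:
  assumes d: "1 \<le> d" and k: "1 \<le> k"
  shows "eprod a d = (\<Prod>r<k. eprod (a + d * r) (k * d))"
proof -
  let ?f = "\<lambda>a. \<Prod>r<k. eprod (a + d * r) (k * d)"
  have kd: "1 \<le> k * d" using d k by simp
  obtain k' where k': "k = Suc k'" using k by (cases k) auto
  \<comment> \<open>Replacing \<open>a\<close> by \<open>a + d\<close> permutes the factors
    cyclically, except that the one starting at \<open>a\<close> restarts at
    \<open>a + k * d\<close> and thereby loses \<open>1 - q ^ a\<close>.\<close>
  have f_rec: "?f a = (1 - q ^ a) * ?f (a + d)" for a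
  proof -
    have "?f a = eprod a (k * d) * (\<Prod>r<k'. eprod (a + d + d * r) (k * d))"
      unfolding k' prod.lessThan_Suc_shift by (simp add: algebra_simps)
    also have "eprod a (k * d) = (1 - q ^ a) * eprod (a + d + d * k') (k * d)"
      using eprod_rec[OF kd, of a] by (simp add: k' algebra_simps)
    finally show ?thesis unfolding k' prod.lessThan_Suc by (simp only: mult_ac)
  qed
  have f_1: "q ^ a dvd ?f a - 1" for a
  proof -
    have "q ^ a dvd (\<Prod>r<n. eprod (a + d * r) (k * d)) - 1" for n
    proof (induction n)
      case (Suc n)
      have "q ^ a dvd eprod (a + d * n) (k * d) - 1"
        by (rule dvd_trans[OF le_imp_power_dvd eprod_cong_1[OF kd]]) simp
      from dvd_mult_cong[OF Suc this] show ?case by simp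
    qed simp
    then show ?thesis .
  qed
  have *: "q ^ (a + n) dvd eprod a d - ?f a" for n a
  proof (induction n arbitrary: a)
    case 0
    show ?case using diff_cong_1[OF eprod_cong_1[OF d] f_1] by simp
  next
    case (Suc n)
    have "q ^ (a + Suc n) dvd q ^ (a + d + n)" using d by (intro le_imp_power_dvd) simp
    then have "q ^ (a + Suc n) dvd eprod (a + d) d - ?f (a + d)" using Suc.IH[of "a + d"] by (rule dvd_trans)
    then have "q ^ (a + Suc n) dvd (1 - q ^ a) * (eprod (a + d) d - ?f (a + d))" by (rule dvd_mult)
    then show ?case unfolding f_rec[of a] eprod_rec[OF d, of a] by (simp only: right_diff_distrib)
  qed
  show ?thesis by (rule fps_eqI_dvd, rule dvd_powerD, rule *)
qed

text \<open>With $F$ the series in which $z$ marks the largest part, this is $F(q^m)$ times the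
  product of all $1-q^{m+j}$, $j$ at least 1. The factor clears the denominators of the
  recurrences.\<close>

definition norm_phi :: "bool list \<Rightarrow> nat \<Rightarrow> rat fps" where
  "norm_phi w m = eprod m 1 * phi w m"

text \<open>Extends \<open>norm_phi zigzag\<close> to \<open>m = 0\<close>, where capped sequences
  have infinite fibres. The companion \<open>profile_210\<close> is used at indices
  \<open>m + 1\<close> and needs no such extension.\<close>

definition zigzag_series :: "nat \<Rightarrow> rat fps" where
  "zigzag_series m = (if m = 0 then eprod 1 1 * gf (wt [1, 1, 1, 1, 1, 1]) (cyl zigzag) else norm_phi zigzag m)"

lemma eprod_1: "eprod m 1 = (1 - q ^ m) * eprod (m + 1) 1"
  by (rule eprod_rec) simp

lemma eprod_shift: "eprod (m + 1) 1 = (1 - q ^ m * q) * eprod (m + 2) 1"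
  "eprod (m + 2) 1 = (1 - q ^ m * q\<^sup>2) * eprod (m + 3) 1"
  using eprod_1[of "m + 1"] eprod_1[of "m + 2"] by (simp_all add: power_add eval_nat_numeral algebra_simps)

lemma norm_phi_recurrences:
  assumes "1 \<le> m"
  shows "norm_phi profile_300 m = norm_phi profile_210 (m + 1)"
    and "norm_phi profile_210 m = 2 * norm_phi profile_201 (m + 1) - (1 - q ^ m * q) * norm_phi zigzag (m + 2)"
    and "norm_phi profile_201 m = norm_phi zigzag (m + 1) + norm_phi profile_300 (m + 1) - (1 - q ^ m * q) * norm_phi profile_210 (m + 2)"
proof -
  have e: "norm_phi w m = eprod (m + 1) 1 * ((1 - q ^ m) * phi w m)" for w
    unfolding norm_phi_def eprod_1[of m] by (simp only: mult_ac)
  show "norm_phi profile_300 m = norm_phi profile_210 (m + 1)" unfolding e phi_recurrences(1)[OF assms] by (simp only: norm_phi_def)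
  show "norm_phi profile_210 m = 2 * norm_phi profile_201 (m + 1) - (1 - q ^ m * q) * norm_phi zigzag (m + 2)"
    unfolding e phi_recurrences(2)[OF assms] unfolding norm_phi_def eprod_shift(1) by algebra
  show "norm_phi profile_201 m = norm_phi zigzag (m + 1) + norm_phi profile_300 (m + 1) - (1 - q ^ m * q) * norm_phi profile_210 (m + 2)"
    unfolding e phi_recurrences(3)[OF assms] unfolding norm_phi_def eprod_shift(1) by algebra
qed

lemma ones6: "[1, 1, 1, 1, 1, 1] = replicate (length zigzag) (1::int)" "[1, 1, 1, 1, 1, 1] = replicate (length profile_300) (1::int)"
  by (simp_all add: zigzag_def profile_300_def)

lemma zigzag_series_recurrence:
  "zigzag_series m = 3 * norm_phi profile_210 (m + 1) - 3 * (1 - q ^ m * q) * norm_phi profile_201 (m + 2) + (1 - q ^ m * q) * (1 - q ^ m * q\<^sup>2) * norm_phi zigzag (m + 3)"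
proof -
  have "zigzag_series m = eprod (m + 1) 1 * (3 * phi profile_210 (m + 1) - 3 * phi profile_201 (m + 2) + phi zigzag (m + 3))"
  proof (cases "m = 0")
    case True
    have "gf (wt [1, 1, 1, 1, 1, 1]) (cyl zigzag) = 3 * phi profile_210 (0 + 1) - 3 * phi profile_201 (0 + 2) + phi zigzag (0 + 3)"
      unfolding ones6(1) cyl_attained[OF dominated_words(4)] by (rule zigzag_attained)
    then show ?thesis using True by (simp add: zigzag_series_def)
  next
    case False
    then have "1 \<le> m" by simp
    have "zigzag_series m = eprod (m + 1) 1 * ((1 - q ^ m) * phi zigzag m)"
      using False unfolding zigzag_series_def norm_phi_def eprod_1[of m] by (simp only: if_False mult_ac)
    then show ?thesis unfolding phi_recurrences(4)[OF \<open>1 \<le> m\<close>] .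
  qed
  also have "\<dots> = 3 * (eprod (m + 1) 1 * phi profile_210 (m + 1)) - 3 * (eprod (m + 1) 1 * phi profile_201 (m + 2)) + eprod (m + 1) 1 * phi zigzag (m + 3)"
    by (simp only: algebra_simps)
  also have "eprod (m + 1) 1 * phi profile_201 (m + 2) = (1 - q ^ m * q) * norm_phi profile_201 (m + 2)"
    unfolding eprod_shift(1) norm_phi_def by (simp only: mult_ac)
  also have "eprod (m + 1) 1 * phi zigzag (m + 3) = (1 - q ^ m * q) * (1 - q ^ m * q\<^sup>2) * norm_phi zigzag (m + 3)"
    unfolding eprod_shift norm_phi_def by (simp only: mult_ac)
  finally show ?thesis unfolding norm_phi_def by (simp only: mult_ac)
qed

text \<open>\<open>profile_300\<close> and \<open>profile_201\<close> are eliminated from the four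
  recurrences. What is left advances \<open>m\<close> by 3, in step with one block.\<close>

lemma diagonal_system:
  fixes m :: nat
  defines "z \<equiv> q ^ m"
  shows "zigzag_series m = (1 + 2 * z * q + 2 * z * q\<^sup>2 + z\<^sup>2 * q^3) * norm_phi zigzag (m + 3) + 3 * z * q^3 * (1 + z * q) * norm_phi profile_210 (m + 4)"
    and "norm_phi profile_210 (m + 1) = (1 + z * q\<^sup>2) * norm_phi zigzag (m + 3) + 2 * z * q^3 * norm_phi profile_210 (m + 4)"
proof -
  have i: "m + 1 + 1 = m + 2" "m + 1 + 2 = m + 3" "m + 2 + 1 = m + 3" "m + 2 + 2 = m + 4" "m + 3 + 1 = m + 4" by simp_all
  have p: "q ^ (m + 1) = z * q" "q ^ (m + 2) = z * q\<^sup>2" by (simp_all only: z_def power_add power_one_right)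
  have D: "norm_phi profile_210 (m + 1) = 2 * norm_phi profile_201 (m + 2) - (1 - z * q * q) * norm_phi zigzag (m + 3)"
    by (rule norm_phi_recurrences(2)[of "m + 1", OF le_add2, unfolded i p])
  have A: "norm_phi profile_300 (m + 3) = norm_phi profile_210 (m + 4)"
    using norm_phi_recurrences(1)[of "m + 3"] unfolding i by simp
  have E: "norm_phi profile_201 (m + 2) = norm_phi zigzag (m + 3) + norm_phi profile_210 (m + 4) - (1 - z * q\<^sup>2 * q) * norm_phi profile_210 (m + 4)"
    using norm_phi_recurrences(3)[of "m + 2"] unfolding i p A by (simp only: le_add2 trans_le_add2 one_le_numeral)
  show 1: "norm_phi profile_210 (m + 1) = (1 + z * q\<^sup>2) * norm_phi zigzag (m + 3) + 2 * z * q^3 * norm_phi profile_210 (m + 4)"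
    unfolding D E by algebra
  show "zigzag_series m = (1 + 2 * z * q + 2 * z * q\<^sup>2 + z\<^sup>2 * q^3) * norm_phi zigzag (m + 3) + 3 * z * q^3 * (1 + z * q) * norm_phi profile_210 (m + 4)"
    unfolding zigzag_series_recurrence[of m] z_def[symmetric] 1 E by algebra
qed

lemma norm_phi_cong_1: "q ^ m dvd norm_phi w m - 1"
  unfolding norm_phi_def using dvd_mult_cong[OF eprod_cong_1[of 1 m] phi_cong_1[of m w]] by simp

lemma SS_00: "SS 0 0 = zigzag_series 0" and KK_00: "KK 0 0 + q\<^sup>2 * SS 1 2 = norm_phi profile_210 1"
proof -
  let ?C = "\<lambda>i. zigzag_series (3 * i)" and ?D = "\<lambda>i. norm_phi profile_210 (3 * i + 1)"
  have i: "3 * (i + 1) = 3 * i + 3" "3 * i + 3 + 1 = 3 * i + 4" for i :: nat by simp_all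
  have z: "zigzag_series (3 * i + 3) = norm_phi zigzag (3 * i + 3)" for i by (simp add: zigzag_series_def)
  have 1: "?C i = (1 + 2 * q ^ (3 * i) * q + 2 * q ^ (3 * i) * q\<^sup>2 + (q ^ (3 * i))\<^sup>2 * q^3) * ?C (i + 1)
      + 3 * q ^ (3 * i) * q^3 * (1 + q ^ (3 * i) * q) * ?D (i + 1)" for i
    unfolding i z by (rule diagonal_system(1))
  have 2: "?D i = (1 + q ^ (3 * i) * q\<^sup>2) * ?C (i + 1) + 2 * q ^ (3 * i) * q^3 * ?D (i + 1)" for i
    unfolding i z by (rule diagonal_system(2))
  have 3: "q ^ i dvd ?C i - 1" for i
  proof (cases "i = 0")
    case False
    have "q ^ i dvd q ^ (3 * i)" by (rule le_imp_power_dvd) simp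
    then show ?thesis using False dvd_trans[OF _ norm_phi_cong_1] by (simp add: zigzag_series_def)
  qed simp
  have 4: "q ^ i dvd ?D i - 1" for i
    by (rule dvd_trans[OF _ norm_phi_cong_1]) (rule le_imp_power_dvd, simp)
  note u = diag_unique[of ?C ?D, OF 1 2 3 4]
  show "SS 0 0 = zigzag_series 0" using u(1)[of 0] by (simp add: CC_def)
  show "KK 0 0 + q\<^sup>2 * SS 1 2 = norm_phi profile_210 1" using u(2)[of 0] by (simp only: DD_def mult_0_right power_0 mult_1 add_0)
qed

lemma eprod_1_1: "eprod 1 1 = eprod 1 6 * eprod 2 6 * eprod 3 6 * eprod 4 6 * eprod 5 6 * eprod 6 6"
  using eprod_multisection[of 1 6 1] by (simp add: eval_nat_numeral mult_ac)

lemma eprod_1_2: "eprod 1 2 = eprod 1 6 * eprod 3 6 * eprod 5 6"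
  using eprod_multisection[of 2 3 1] by (simp add: eval_nat_numeral mult_ac)

lemma gf_R_product: "gf (\<lambda>l. int (psize l)) R * (eprod 1 6 * eprod 1 6 * eprod 3 6 * eprod 3 6 * eprod 5 6 * eprod 5 6)
    = eprod 2 6 * eprod 4 6"
proof -
  define h where "h = gf (wt [1, 1, 1, 1, 1, 1]) (cyl zigzag)"
  have "h * eprod 1 2 ^ 3 * eprod 6 6 = 1"
    unfolding h_def gf_zigzag by (rule partitions_gf_eprod)
  moreover have "gf (\<lambda>l. int (psize l)) R = eprod 1 1 * h"
    unfolding gf_R SS_00 by (simp add: zigzag_series_def h_def)
  ultimately show ?thesis
    unfolding eprod_1_1 eprod_1_2 by algebra
qed

text \<open>Removing the only peak of \<open>profile_300\<close> at cap charge 0 leads to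
  \<open>profile_210\<close> at \<open>m = 1\<close>. This identifies the second diagonal series at
  its initial point with the profile (3,0,0).\<close>

lemma gf_R'_product: "gf (\<lambda>l. int (psize l)) R' * (eprod 2 6 * eprod 3 6 * eprod 3 6 * eprod 4 6) = 1"
proof -
  define h where "h = gf (wt [1, 1, 1, 1, 1, 1]) (cyl profile_300)"
  have "h = phi profile_210 (0 + 1)"
    unfolding h_def ones6(2) cyl_attained[OF dominated_words(1)] by (rule single_peak_attained)
  then have G: "gf (\<lambda>l. int (psize l)) R' = eprod 1 1 * h"
    unfolding gf_R' KK_00 norm_phi_def by simp
  \<comment> \<open>The product of \<open>gf_single_peak\<close> has its first factors split off as
    \<open>1 - q\<close> and \<open>(1 - q^2)^2\<close>; this restores complete products.\<close>
  have rec: "eprod 1 6 = (1 - q) * eprod 7 6" "eprod 2 6 = (1 - q\<^sup>2) * eprod 8 6"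
    using eprod_rec[of 6 1] eprod_rec[of 6 2] by simp_all
  have "h * ((1 - q) * (1 - q\<^sup>2)\<^sup>2 * (eprod 3 6 ^ 3 * eprod 4 6 ^ 2 * eprod 7 6 * eprod 5 6 * eprod 8 6 ^ 2)) * eprod 6 6 = 1"
    unfolding h_def profile_300_def gf_single_peak by (rule partitions_gf_eprod)
  then show ?thesis
    unfolding G eprod_1_1 rec by algebra
qed

lemma graded_R: "graded (\<lambda>l. int (psize l)) R" and graded_R': "graded (\<lambda>l. int (psize l)) R'"
  by (rule graded_subset[OF graded_psize], auto simp: R_def R'_def valid_def)+

theorem theorem1p1:
  shows "((\<lambda>l. q ^ psize l) has_sum
           (qpochs [q^2, q^4] (q^6) \<infinity> / qpochs [q, q, q^3, q^3, q^5, q^5] (q^6) \<infinity>)) R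
       \<and> ((\<lambda>l. q ^ psize l) has_sum
           (1 / qpochs [q^2, q^3, q^3, q^4] (q^6) \<infinity>)) R'"
proof -
  have e: "qpoch (q ^ a) (q ^ 6) \<infinity> = eprod a 6" if "1 \<le> a" for a using qpoch_eprod[of 6 a] that by simp
  have e1: "qpoch q (q ^ 6) \<infinity> = eprod 1 6" using e[of 1] by simp
  let ?d = "eprod 1 6 * eprod 1 6 * eprod 3 6 * eprod 3 6 * eprod 5 6 * eprod 5 6"
    and ?d' = "eprod 2 6 * eprod 3 6 * eprod 3 6 * eprod 4 6"
  have n: "qpochs [q^2, q^4] (q^6) \<infinity> = eprod 2 6 * eprod 4 6"
    and d: "qpochs [q, q, q^3, q^3, q^5, q^5] (q^6) \<infinity> = ?d" and d': "qpochs [q^2, q^3, q^3, q^4] (q^6) \<infinity> = ?d'"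
    by (simp_all add: qpochs_def e e1 mult.assoc)
  have nz: "?d \<noteq> 0" "?d' \<noteq> 0" using eprod_nonzero[of 6] by simp_all
  have "qpochs [q^2, q^4] (q^6) \<infinity> / qpochs [q, q, q^3, q^3, q^5, q^5] (q^6) \<infinity> = gf (\<lambda>l. int (psize l)) R"
    unfolding n d gf_R_product[symmetric] by (rule nonzero_mult_div_cancel_right[OF nz(1)])
  moreover have "1 / qpochs [q^2, q^3, q^3, q^4] (q^6) \<infinity> = gf (\<lambda>l. int (psize l)) R'"
    unfolding d' gf_R'_product[symmetric] by (rule nonzero_mult_div_cancel_right[OF nz(2)])
  ultimately show ?thesis using gf_has_sum[OF graded_R] gf_has_sum[OF graded_R'] by simp
qed

end
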